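(* For $n\geqslant3$, the semigroup $\mathcal{PORI}_n$ has exactly $$n\varphi(n)+3^n+ \sum_{k=3}^n\binom{n}{k}k(\varepsilon(n,k)+2\delta(n,k)) + ((-1)^n+2)\left((9n+4)2^{n-3}-\frac{5}{2}n(n-1)-1\right) - 2((-1)^n+1)n$$ (semigroup) endomorphisms, and the semigroup $\mathcal{POR}_n$ has exactly $$1+2n+n\varphi(n) + n2^{n-1} + \sum_{k=1}^{n}\binom{n}{k}(\tau^{2k}+\theta^{2k}-k^{2}+k-2) + \frac{(-1)^n+7}{12}\sum_{i=2}^{n}\binom{n}{i}i^2(i^2-1)$$ $$+\sum_{k=3}^n \sum_{i=k}^{n}\binom{n}{i}\sum_{j=1}^{i-k+1}j^{2}\binom{i-j+k-2}{2k-3}\Bigg(k(\varepsilon(n,k)+2\delta(n,k))+\sum_{\ell=1}^{k}\binom{k}{\ell}(\tau^{2\ell}+\theta^{2\ell}-\ell^{2}+\ell-2)$$ $$+ ((-1)^n+2) \bigg( k + k 2^{\lfloor\frac{k}{2}\rfloor} + \frac{(-1)^k+1}{2} \bigg(1 + \frac{k^2+2k}{16}2^{\lfloor\frac{k}{2}\rfloor}\bigg) \bigg)\Bigg)$$ (semigroup) endomorphisms.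
   Context: Let $\Omega_n=\{1<2<\cdots<n\}$. A sequence $(a_1,\ldots,a_t)$ ($t\geqslant0$) in $\Omega_n$ is cyclic [anti-cyclic] if there is at most one index $i\in\{1,\ldots,t\}$ with $a_i>a_{i+1}$ [$a_i<a_{i+1}$], where $a_{t+1}=a_1$. A partial transformation $\alpha$ of $\Omega_n$ with domain $\{a_1<\cdots<a_t\}$ is oriented if $(a_1\alpha,\ldots,a_t\alpha)$ is cyclic or anti-cyclic. $\mathcal{POR}_n$ is the monoid (under composition) of all oriented partial transformations of $\Omega_n$ and $\mathcal{PORI}_n$ is its submonoid of all injective elements (partial permutations); both contain the empty map. $\varphi$ is Euler's totient function, $\tau=\frac{1+\sqrt5}{2}$, $\theta=\frac{1-\sqrt5}{2}$, $$\varepsilon(n,k)=\left|\left\{t\in\{1,2,\ldots,k-1\}\;:\; \tfrac{k}{\gcd(t,k)} \text{ divides } n\right\}\right|,$$ and $\delta(n,k)=1$ if $n$ and $k$ are both even, $\delta(n,k)=0$ otherwise. *)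

theory Defs
  imports Complex_Main "HOL-Algebra.Group" "HOL-Number_Theory.Totient"
begin

text \<open>Sequences in a linear order are lists. With 0-based positions, the cyclic successor
  of position \<open>i\<close> in a list of length \<open>t\<close> is \<open>Suc i mod t\<close>.\<close>

definition cyclic_seq :: "nat list \<Rightarrow> bool" where
  "cyclic_seq xs \<longleftrightarrow>
     card {i. i < length xs \<and> xs ! i > xs ! (Suc i mod length xs)} \<le> 1"

definition anti_cyclic_seq :: "nat list \<Rightarrow> bool" where
  "anti_cyclic_seq xs \<longleftrightarrow>
     card {i. i < length xs \<and> xs ! i < xs ! (Suc i mod length xs)} \<le> 1"

definition partial_transformation :: "nat \<Rightarrow> (nat \<rightharpoonup> nat) \<Rightarrow> bool" where
  "partial_transformation n \<alpha> \<longleftrightarrow> dom \<alpha> \<subseteq> {1..n} \<and> ran \<alpha> \<subseteq> {1..n}"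

definition image_seq :: "(nat \<rightharpoonup> nat) \<Rightarrow> nat list" where
  "image_seq \<alpha> = map (\<lambda>a. the (\<alpha> a)) (sorted_list_of_set (dom \<alpha>))"

definition oriented :: "(nat \<rightharpoonup> nat) \<Rightarrow> bool" where
  "oriented \<alpha> \<longleftrightarrow> cyclic_seq (image_seq \<alpha>) \<or> anti_cyclic_seq (image_seq \<alpha>)"

text \<open>Transformations act on the right, so the product \<open>\<alpha> \<otimes> \<beta>\<close> applies \<open>\<alpha>\<close> first.\<close>

definition POR :: "nat \<Rightarrow> (nat \<rightharpoonup> nat) monoid" where
  "POR n = \<lparr>carrier = {\<alpha>. partial_transformation n \<alpha> \<and> oriented \<alpha>},
            monoid.mult = (\<lambda>\<alpha> \<beta>. \<beta> \<circ>\<^sub>m \<alpha>),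
            one = Some |` {1..n}\<rparr>"

definition PORI :: "nat \<Rightarrow> (nat \<rightharpoonup> nat) monoid" where
  "PORI n = (POR n)\<lparr>carrier := {\<alpha> \<in> carrier (POR n). inj_on \<alpha> (dom \<alpha>)}\<rparr>"

text \<open>\<^const>\<open>hom\<close> requires preservation of products only, not of the identity, so its elements
  are the semigroup homomorphisms. Restricting to extensional functions makes each
  endomorphism be counted once.\<close>

definition semigroup_End :: "('a, 'b) monoid_scheme \<Rightarrow> ('a \<Rightarrow> 'a) set" where
  "semigroup_End S = hom S S \<inter> extensional (carrier S)"

definition \<epsilon> :: "nat \<Rightarrow> nat \<Rightarrow> nat" where
  "\<epsilon> n k = card {t \<in> {1..k - 1}. k div gcd t k dvd n}"

definition \<delta> :: "nat \<Rightarrow> nat \<Rightarrow> nat" where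
  "\<delta> n k = (if even n \<and> even k then 1 else 0)"

definition \<tau> :: real where
  "\<tau> = (1 + sqrt 5) / 2"

definition \<theta> :: real where
  "\<theta> = (1 - sqrt 5) / 2"

end

theory Submission
  imports Defs "HOL-Library.Infinite_Set"
begin

text \<open>Let \<open>\<phi>\<close> be an endomorphism and \<open>f\<close> the image of the empty map. The partial identities of
  rank \<open>k\<close> go to commuting idempotents; if \<open>k\<close> is the least rank at which they are not all
  collapsed to \<open>f\<close>, then the images of these idempotents are proper extensions of the image of \<open>f\<close>,
  pairwise disjoint outside it. So there are at most \<open>n\<close> of them, which forces
  \<open>k \<in> {1, n - 1, n}\<close>, unless \<open>\<phi>\<close> is constant.
  If \<open>k = 1\<close>, then \<open>\<phi>\<close> is conjugation by one of the \<open>2 * n\<close> elements of the dihedral group. If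
  \<open>k = n - 1\<close>, then \<open>\<phi>\<close> is the action on missing points followed by conjugation by one of the
  \<open>n * totient n\<close> affine permutations \<open>x \<mapsto> u * x + v\<close>. In the remaining cases all non-units go to \<open>f\<close>,
  and \<open>\<phi>\<close> amounts to a homomorphism from the dihedral group of units into the group of units of
  the local monoid at an idempotent \<open>e\<close>, together with an idempotent \<open>f\<close> absorbed by its image.
  The local monoid at \<open>e\<close> is the same kind of monoid on \<open>k = card (ran e)\<close> points, with a dihedral
  group of units, so the number of these pairs depends only on \<open>k\<close> and is summed over the idempotents \<open>e\<close>.
  The idempotents themselves are counted by cutting the cycle at their fixed points.\<close>

section \<open>Orientation via winding numbers\<close>

text \<open>Orientation is stated through descents of image sequences, which do not compose well;
  sheets of lifts simply add. Reversing maps are treated through their mirror images. At ranks 1 and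
  \<open>n - 1\<close> the \<open>n\<close> new points use up all of \<open>{1..n}\<close>, so
  \<open>f\<close> is empty and \<open>\<phi>\<close> is governed by a permutation \<open>s\<close>
  of the indices. Compatibility with the rotation makes \<open>s\<close> affine. Here the two ranks
  part: a non-unit moves missing points to at most one value, and such a map stays oriented under
  any conjugation, so rank \<open>n - 1\<close> admits every affine \<open>s\<close>; at rank 1 a
  map with enough fixed points detects every multiplier other than 1 and -1 modulo \<open>n\<close>.
  The powers of \<tau> and \<theta> come from the idempotents: cutting the cycle yields numbers with
  \<open>a (d + 2) = 3 * a (d + 1) - a d\<close>, whose characteristic roots are
  \<open>\<tau>\<^sup>2\<close> and \<open>\<theta>\<^sup>2\<close>. In the injective monoid the
  idempotents are the partial identities, hence the shorter formula. The factor
  \<open>(-1) ^ n + 2\<close> is 3 or 1, the number of index-two subgroups of the dihedral group of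
  order \<open>2 * n\<close>.\<close>

text \<open>A partial map of the cycle \<open>{1..n}\<close> is orientation preserving iff it lifts to a monotone map of
  degree one on the universal cover; \<open>m x\<close> records the sheet on which the value at \<open>x\<close> is placed.\<close>

definition lift_of :: "nat \<Rightarrow> (nat \<rightharpoonup> nat) \<Rightarrow> (nat \<Rightarrow> int) \<Rightarrow> bool" where
  "lift_of n \<alpha> m \<longleftrightarrow> (\<forall>x y a b. \<alpha> x = Some a \<longrightarrow> \<alpha> y = Some b \<longrightarrow> x \<le> y \<longrightarrow>
     int a + int n * m x \<le> int b + int n * m y \<and>
     int b + int n * m y \<le> int a + int n * m x + int n)"

lemma lift_ofD:
  assumes "lift_of n \<alpha> m" "\<alpha> x = Some a" "\<alpha> y = Some b" "x \<le> y"
  shows "int a + int n * m x \<le> int b + int n * m y"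
    "int b + int n * m y \<le> int a + int n * m x + int n"
  using assms unfolding lift_of_def by blast+

lemma sheet_bounds:
  assumes "1 \<le> a" "a \<le> n" "1 \<le> b" "b \<le> n"
    and "int a + int n * k \<le> int b + int n * l" "int b + int n * l \<le> int a + int n * k + int n"
  shows "k \<le> l" "l \<le> k + 1"
proof -
  have "int n * (k - l) < int n * 1" "int n * (l - k) < int n * 2"
    using assms by (auto simp: algebra_simps)
  then have "k - l < 1" "l - k < 2"
    using assms mult_less_cancel_left_pos[of "int n" _ _] by auto
  then show "k \<le> l" "l \<le> k + 1" by auto
qed

lemma pt_val:
  assumes "partial_transformation n \<alpha>" "\<alpha> x = Some a"
  shows "1 \<le> a" "a \<le> n" "1 \<le> x" "x \<le> n"
  using assms unfolding partial_transformation_def by (auto simp: ran_def dom_def subset_iff)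

text \<open>All values lie within one period, so the two inequalities of a lift leave only two cases
  for a pair of points. Lifts are used in this form from here on.\<close>

lemma lift_of_sheets:
  assumes "partial_transformation n \<alpha>" "lift_of n \<alpha> m" "\<alpha> x = Some a" "\<alpha> y = Some b" "x \<le> y"
  shows "m x \<le> m y" "m y \<le> m x + 1" "m x = m y \<Longrightarrow> a \<le> b" "m y \<noteq> m x \<Longrightarrow> b \<le> a"
proof -
  note l = lift_ofD[OF assms(2-5)] and v = pt_val[OF assms(1,3)] pt_val[OF assms(1,4)]
  show s: "m x \<le> m y" "m y \<le> m x + 1" using sheet_bounds[OF v(1,2,5,6) l] by auto
  show "m x = m y \<Longrightarrow> a \<le> b" using l by auto
  assume "m y \<noteq> m x"
  then have "m y = m x + 1" using s by auto
  then show "b \<le> a" using l by (auto simp: algebra_simps)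
qed

lemma nat_chain_le:
  fixes f :: "nat \<Rightarrow> nat"
  assumes "i \<le> j" "\<And>k. i \<le> k \<Longrightarrow> k < j \<Longrightarrow> f k \<le> f (Suc k)"
  shows "f i \<le> f j"
  using assms by (induction j rule: dec_induct) (auto intro: order_trans)

lemma dom_enum:
  assumes "partial_transformation n \<alpha>"
  defines "D \<equiv> sorted_list_of_set (dom \<alpha>)"
  shows "length (image_seq \<alpha>) = length D" "set D = dom \<alpha>"
    "\<And>i. i < length D \<Longrightarrow> \<alpha> (D ! i) = Some (image_seq \<alpha> ! i)"
    "\<And>i j. i < length D \<Longrightarrow> j < length D \<Longrightarrow> D ! i \<le> D ! j \<longleftrightarrow> i \<le> j"
proof -
  have fin: "finite (dom \<alpha>)"
    using assms unfolding partial_transformation_def by (meson finite_atLeastAtMost finite_subset)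
  show "length (image_seq \<alpha>) = length D" by (simp add: image_seq_def D_def)
  show s: "set D = dom \<alpha>" using fin by (simp add: D_def)
  show "\<alpha> (D ! i) = Some (image_seq \<alpha> ! i)" if "i < length D" for i
  proof -
    have "D ! i \<in> dom \<alpha>" using that s nth_mem by blast
    then show ?thesis using that by (auto simp: image_seq_def D_def)
  qed
  have "sorted_wrt (<) D" by (simp add: D_def)
  then show "D ! i \<le> D ! j \<longleftrightarrow> i \<le> j" if "i < length D" "j < length D" for i j
    using that sorted_wrt_nth_less[of "(<)" D i j] sorted_wrt_nth_less[of "(<)" D j i]
    by (cases i j rule: linorder_cases) auto
qed

text \<open>The sheet changes from 0 to 1 at the only descent inside the list. The cyclic condition
  at the wrap-around keeps the last value at most the first, so the lift gains no more than one
  period.\<close>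

lemma cyclic_imp_lift:
  assumes "partial_transformation n \<alpha>" "cyclic_seq (image_seq \<alpha>)"
  shows "\<exists>m. lift_of n \<alpha> m"
proof -
  define D where "D = sorted_list_of_set (dom \<alpha>)"
  define xs where "xs = image_seq \<alpha>"
  note d = dom_enum[OF assms(1), folded D_def xs_def]
  let ?P = "{i. i < length xs \<and> xs ! i > xs ! (Suc i mod length xs)}"
  have c: "card ?P \<le> 1" "finite ?P" using assms(2) by (auto simp: cyclic_seq_def xs_def)
  have uniq: "i = j" if "i \<in> ?P" "j \<in> ?P" for i j
    using that c(1) unfolding One_nat_def card_le_Suc0_iff_eq[OF c(2)] by blast
  have val: "1 \<le> xs ! i \<and> xs ! i \<le> n" if "i < length xs" for i
    using pt_val[OF assms(1) d(3)] that d(1) by auto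
  have red: "\<exists>m. lift_of n \<alpha> m" if h: "\<And>i j. i \<le> j \<Longrightarrow> j < length xs \<Longrightarrow>
     int (xs!i) + int n * m (D!i) \<le> int (xs!j) + int n * m (D!j) \<and>
     int (xs!j) + int n * m (D!j) \<le> int (xs!i) + int n * m (D!i) + int n" for m
  proof (intro exI[of _ m], unfold lift_of_def, intro allI impI)
    fix x y a b assume h': "\<alpha> x = Some a" "\<alpha> y = Some b" "x \<le> y"
    then obtain i j where "i < length D" "j < length D" "x = D!i" "y = D!j"
      by (metis d(2) domI in_set_conv_nth)
    then show "int a + int n * m x \<le> int b + int n * m y \<and>
     int b + int n * m y \<le> int a + int n * m x + int n"
      using h[of i j] h' d(1) d(3)[of i] d(3)[of j] d(4)[of i j] by simp
  qed
  show ?thesis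
  proof (cases "\<exists>i. Suc i < length xs \<and> xs!i > xs!Suc i")
    case False
    then have "xs!k \<le> xs!Suc k" if "Suc k < length xs" for k
      using that by (meson not_less)
    then have mono: "xs!i \<le> xs!j" if "i \<le> j" "j < length xs" for i j
      using that by (rule_tac nat_chain_le[where f="\<lambda>i. xs!i"]) auto
    show ?thesis
    proof (rule red[of "\<lambda>_. 0"])
      fix i j assume "i \<le> j" "j < length xs"
      then show "int (xs!i) + int n * 0 \<le> int (xs!j) + int n * 0 \<and>
         int (xs!j) + int n * 0 \<le> int (xs!i) + int n * 0 + int n"
        using mono[of i j] val[of i] val[of j] by auto
    qed
  next
    case True
    then obtain i0 where i0: "Suc i0 < length xs" "xs!i0 > xs!Suc i0" by blast
    then have i0P: "i0 \<in> ?P" by auto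
    have step: "xs!j \<le> xs!(Suc j)" if "Suc j < length xs" "j \<noteq> i0" for j
      using uniq[OF i0P, of j] that by (auto simp: not_less[symmetric])
    have "Suc (length xs - 1) = length xs" using i0 by auto
    \<comment> \<open>The single permitted descent is already spent at \<open>i0\<close>, so the
      closing step is not a descent.\<close>
    then have wrap: "xs!(length xs - 1) \<le> xs!0"
      using uniq[OF i0P, of "length xs - 1"] i0 by (auto simp: not_less[symmetric])
    have m1: "xs!i \<le> xs!j" if "i \<le> j" "j \<le> i0" for i j
      using that i0 by (rule_tac nat_chain_le[where f="\<lambda>i. xs!i"], simp, rule_tac step) auto
    have m2: "xs!i \<le> xs!j" if "i \<le> j" "i0 < i" "j < length xs" for i j
      using that i0 by (rule_tac nat_chain_le[where f="\<lambda>i. xs!i"], simp, rule_tac step) auto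
    have m3: "xs!j \<le> xs!i" if "i \<le> i0" "i0 < j" "j < length xs" for i j
    proof -
      have "j \<le> length xs - 1" "length xs - 1 < length xs" using that by linarith+
      then show ?thesis using m1[of 0 i] m2[of j "length xs - 1"] wrap that by simp
    qed
    show ?thesis
    proof (rule red[of "\<lambda>x. if x \<le> D!i0 then 0 else 1"])
      fix i j assume ij: "i \<le> j" "j < length xs"
      have e: "D!i \<le> D!i0 \<longleftrightarrow> i \<le> i0" "D!j \<le> D!i0 \<longleftrightarrow> j \<le> i0"
        using d(1,4) ij i0 by auto
      have "1 \<le> xs!i" "xs!i \<le> n" "1 \<le> xs!j" "xs!j \<le> n" using val[of i] val[of j] ij by auto
      then show "int (xs!i) + int n * (if D!i \<le> D!i0 then 0 else 1)
            \<le> int (xs!j) + int n * (if D!j \<le> D!i0 then 0 else 1) \<and>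
         int (xs!j) + int n * (if D!j \<le> D!i0 then 0 else 1)
            \<le> int (xs!i) + int n * (if D!i \<le> D!i0 then 0 else 1) + int n"
        unfolding e using m1[of i j] m2[of i j] m3[of i j] ij by auto
    qed
  qed
qed

text \<open>A descent inside the list raises the sheet, and a descent at the wrap-around forces the
  first and the last point onto the same sheet. As the total rise is at most one, any two descents
  exclude each other.\<close>

lemma lift_imp_cyclic:
  assumes "partial_transformation n \<alpha>" "lift_of n \<alpha> m"
  shows "cyclic_seq (image_seq \<alpha>)"
proof -
  define D where "D = sorted_list_of_set (dom \<alpha>)"
  define xs where "xs = image_seq \<alpha>"
  note d = dom_enum[OF assms(1), folded D_def xs_def]
  let ?P = "{i. i < length xs \<and> xs ! i > xs ! (Suc i mod length xs)}"
  have sh: "m (D!i) \<le> m (D!j) \<and> m (D!j) \<le> m (D!i) + 1 \<and> (m (D!i) = m (D!j) \<longrightarrow> xs!i \<le> xs!j)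
      \<and> (m (D!i) \<noteq> m (D!j) \<longrightarrow> xs!j \<le> xs!i)" if "i \<le> j" "j < length xs" for i j
    using lift_of_sheets[OF assms d(3)[of i] d(3)[of j]] d(1,4) that by auto
  have desc: "m (D!Suc i) = m (D!i) + 1" if "i \<in> ?P" "Suc i < length xs" for i
    using sh[of i "Suc i"] that by auto
  have no: False if "i \<in> ?P" "j \<in> ?P" "i < j" for i j
  proof (cases "Suc j < length xs")
    case True
    have "m (D!Suc i) = m (D!i) + 1" "m (D!Suc j) = m (D!j) + 1" using desc that True by auto
    moreover have "m (D!Suc i) \<le> m (D!j)" "m (D!Suc j) \<le> m (D!i) + 1"
      using sh[of "Suc i" j] sh[of i "Suc j"] that True by auto
    ultimately show False by auto
  next
    case False
    then have j: "Suc j = length xs" using that by auto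
    then have w: "xs!j > xs!0" using that by auto
    have "m (D!Suc i) = m (D!i) + 1" using desc that by auto
    moreover have "m (D!0) \<le> m (D!i)" "m (D!Suc i) \<le> m (D!j)"
      using sh[of 0 i] sh[of "Suc i" j] that j by auto
    ultimately have "m (D!0) \<noteq> m (D!j)" by auto
    then show False using sh[of 0 j] j w by auto
  qed
  have "i = j" if "i \<in> ?P" "j \<in> ?P" for i j
    using no[OF that] no[OF that(2,1)] by (metis nat_neq_iff)
  then have "card ?P \<le> 1"
    by (metis (no_types, lifting) One_nat_def card.infinite card_le_Suc0_iff_eq le0)
  then show ?thesis by (simp add: cyclic_seq_def xs_def)
qed

text \<open>Reversing the order of the values exchanges ascents and descents, so that lifts of
  degree one suffice for both orientations.\<close>

definition mirror :: "nat \<Rightarrow> (nat \<rightharpoonup> nat) \<Rightarrow> (nat \<rightharpoonup> nat)" where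
  "mirror n \<alpha> = (\<lambda>x. map_option (\<lambda>a. n + 1 - a) (\<alpha> x))"

lemma mirror_eq_Some: "mirror n \<alpha> x = Some c \<longleftrightarrow> (\<exists>a. \<alpha> x = Some a \<and> c = n + 1 - a)"
  by (auto simp: mirror_def)

lemma pt_mirror:
  assumes "partial_transformation n \<alpha>" shows "partial_transformation n (mirror n \<alpha>)"
  using assms unfolding partial_transformation_def
  by (fastforce simp: mirror_def dom_def ran_def subset_iff)

lemma anti_cyclic_mirror:
  assumes "partial_transformation n \<alpha>"
  shows "anti_cyclic_seq (image_seq \<alpha>) \<longleftrightarrow> cyclic_seq (image_seq (mirror n \<alpha>))"
proof -
  have dm: "dom (mirror n \<alpha>) = dom \<alpha>" by (auto simp: mirror_def dom_def)
  have len: "length (image_seq (mirror n \<alpha>)) = length (image_seq \<alpha>)" by (simp add: image_seq_def dm)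
  have nth: "image_seq (mirror n \<alpha>) ! i = n + 1 - image_seq \<alpha> ! i \<and> image_seq \<alpha> ! i \<le> n"
    if "i < length (image_seq \<alpha>)" for i
  proof -
    note d = dom_enum[OF assms] and d' = dom_enum[OF pt_mirror[OF assms]]
    have "\<alpha> (sorted_list_of_set (dom \<alpha>) ! i) = Some (image_seq \<alpha> ! i)"
      using d(3)[of i] d(1) that by simp
    moreover have "mirror n \<alpha> (sorted_list_of_set (dom \<alpha>) ! i) = Some (image_seq (mirror n \<alpha>) ! i)"
      using d'(3)[of i] d'(1) that by (simp add: dm len)
    ultimately show ?thesis using pt_val(2)[OF assms] by (auto simp: mirror_def)
  qed
  have "{i. i < length (image_seq \<alpha>) \<and> image_seq \<alpha> ! i < image_seq \<alpha> ! (Suc i mod length (image_seq \<alpha>))}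
     = {i. i < length (image_seq \<alpha>) \<and> image_seq (mirror n \<alpha>) ! i > image_seq (mirror n \<alpha>) ! (Suc i mod length (image_seq \<alpha>))}"
  proof (intro Collect_cong conj_cong refl)
    fix i assume i: "i < length (image_seq \<alpha>)"
    then have "Suc i mod length (image_seq \<alpha>) < length (image_seq \<alpha>)"
      by (metis gr_zeroI mod_less_divisor not_less_zero)
    then show "image_seq \<alpha> ! i < image_seq \<alpha> ! (Suc i mod length (image_seq \<alpha>)) \<longleftrightarrow>
      image_seq (mirror n \<alpha>) ! i > image_seq (mirror n \<alpha>) ! (Suc i mod length (image_seq \<alpha>))"
      using nth[OF i] nth[of "Suc i mod length (image_seq \<alpha>)"] by auto
  qed
  then show ?thesis by (simp add: anti_cyclic_seq_def cyclic_seq_def len)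
qed

definition opres :: "nat \<Rightarrow> (nat \<rightharpoonup> nat) \<Rightarrow> bool" where "opres n \<alpha> \<longleftrightarrow> (\<exists>m. lift_of n \<alpha> m)"

lemma oriented_iff:
  assumes "partial_transformation n \<alpha>"
  shows "oriented \<alpha> \<longleftrightarrow> opres n \<alpha> \<or> opres n (mirror n \<alpha>)"
  unfolding oriented_def opres_def anti_cyclic_mirror[OF assms]
  using cyclic_imp_lift lift_imp_cyclic assms pt_mirror[OF assms] by blast

section \<open>Closure of the oriented maps under composition\<close>

lemma pt_comp:
  assumes "partial_transformation n \<alpha>" "partial_transformation n \<beta>"
  shows "partial_transformation n (\<beta> \<circ>\<^sub>m \<alpha>)"
  using assms unfolding partial_transformation_def
  by (fastforce simp: map_comp_def dom_def ran_def subset_iff split: option.splits)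

lemma opres_comp:
  assumes pa: "partial_transformation n \<alpha>" and pb: "partial_transformation n \<beta>"
    and "opres n \<alpha>" "opres n \<beta>"
  shows "opres n (\<beta> \<circ>\<^sub>m \<alpha>)"
proof -
  obtain m m' where m: "lift_of n \<alpha> m" and m': "lift_of n \<beta> m'" using assms by (auto simp: opres_def)
  \<comment> \<open>Lifts are composed as functions on the universal cover, so the sheets add along
    the orbit of a point.\<close>
  have "lift_of n (\<beta> \<circ>\<^sub>m \<alpha>) (\<lambda>x. m x + m' (the (\<alpha> x)))"
    unfolding lift_of_def
  proof (intro allI impI)
    fix x y a b assume h: "(\<beta> \<circ>\<^sub>m \<alpha>) x = Some a" "(\<beta> \<circ>\<^sub>m \<alpha>) y = Some b" "x \<le> y"
    then obtain u v where uv: "\<alpha> x = Some u" "\<alpha> y = Some v" "\<beta> u = Some a" "\<beta> v = Some b"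
      by (auto simp: map_comp_Some_iff)
    note s = lift_of_sheets[OF pa m uv(1,2) h(3)]
    have "int a + int n * (m x + m' u) \<le> int b + int n * (m y + m' v) \<and>
      int b + int n * (m y + m' v) \<le> int a + int n * (m x + m' u) + int n"
    proof (cases "m x = m y")
      case True
      then have "u \<le> v" using s by auto
      then show ?thesis using lift_ofD[OF m' uv(3,4)] True by (auto simp: algebra_simps)
    next
      \<comment> \<open>The extra sheet gained by \<alpha> compensates the reversed order of
        \<open>u\<close> and \<open>v\<close>: the inequalities for \<beta> are used with the two
        exchanged.\<close>
      case False
      then have e: "v \<le> u" "m y = m x + 1" using s by auto
      then show ?thesis using lift_ofD[OF m' uv(4,3)] by (auto simp: algebra_simps)
    qed
    then show "int a + int n * (m x + m' (the (\<alpha> x))) \<le> int b + int n * (m y + m' (the (\<alpha> y))) \<and>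
      int b + int n * (m y + m' (the (\<alpha> y))) \<le> int a + int n * (m x + m' (the (\<alpha> x))) + int n"
      using uv by simp
  qed
  then show ?thesis by (auto simp: opres_def)
qed

definition flip :: "nat \<Rightarrow> (nat \<rightharpoonup> nat)" where
  "flip n = (\<lambda>x. if x \<in> {1..n} then Some (n + 1 - x) else None)"

lemma pt_flip: "partial_transformation n (flip n)"
  by (auto simp: partial_transformation_def flip_def dom_def ran_def split: if_splits)

lemma mirror_flip: "partial_transformation n \<alpha> \<Longrightarrow> mirror n \<alpha> = flip n \<circ>\<^sub>m \<alpha>"
  by (intro ext) (auto simp: mirror_def flip_def map_comp_def dest: pt_val split: option.splits)

lemma flip_flip: "partial_transformation n \<alpha> \<Longrightarrow> flip n \<circ>\<^sub>m (flip n \<circ>\<^sub>m \<alpha>) = \<alpha>"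
  by (intro ext) (auto simp: flip_def map_comp_def dest: pt_val split: option.splits)

lemma opres_conj_flip:
  assumes pt: "partial_transformation n \<alpha>" and "opres n \<alpha>"
  shows "opres n (flip n \<circ>\<^sub>m (\<alpha> \<circ>\<^sub>m flip n))"
proof -
  obtain m where m: "lift_of n \<alpha> m" using assms by (auto simp: opres_def)
  \<comment> \<open>The reflection reverses order in the source and in the target; negating the
    sheets makes the lift increase again.\<close>
  have "lift_of n (flip n \<circ>\<^sub>m (\<alpha> \<circ>\<^sub>m flip n)) (\<lambda>x. - m (n + 1 - x))"
    unfolding lift_of_def
  proof (intro allI impI)
    fix x y a b assume h: "(flip n \<circ>\<^sub>m (\<alpha> \<circ>\<^sub>m flip n)) x = Some a"
      "(flip n \<circ>\<^sub>m (\<alpha> \<circ>\<^sub>m flip n)) y = Some b" "x \<le> y"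
    have val: "\<exists>u. \<alpha> (n+1-z) = Some u \<and> c = n+1-u \<and> 1 \<le> u \<and> u \<le> n \<and> z \<le> n"
      if "(flip n \<circ>\<^sub>m (\<alpha> \<circ>\<^sub>m flip n)) z = Some c" for z c
      using that unfolding map_comp_Some_iff flip_def by (auto split: if_splits)
    obtain u v where uv: "\<alpha> (n+1-x) = Some u" "\<alpha> (n+1-y) = Some v" and
      ab: "int a = int n+1-int u" "int b = int n+1-int v"
      using val[OF h(1)] val[OF h(2)] by auto
    have "n+1-y \<le> n+1-x" using h(3) by auto
    from lift_ofD[OF m uv(2,1) this] ab show "int a + int n * - m (n + 1 - x) \<le> int b + int n * - m (n + 1 - y) \<and>
      int b + int n * - m (n + 1 - y) \<le> int a + int n * - m (n + 1 - x) + int n"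
      by auto
  qed
  then show ?thesis by (auto simp: opres_def)
qed

lemma map_comp_assoc: "(\<gamma> \<circ>\<^sub>m \<beta>) \<circ>\<^sub>m \<alpha> = \<gamma> \<circ>\<^sub>m (\<beta> \<circ>\<^sub>m \<alpha>)"
  by (auto simp: map_comp_def split: option.splits)

text \<open>Sign rule: each factor is orientation preserving, possibly after composition with the
  flip. A flip that ends up between the factors is cancelled by a second one, and the conjugate of
  \<beta> by the flip is again preserving.\<close>

lemma oriented_comp:
  assumes pa: "partial_transformation n \<alpha>" and pb: "partial_transformation n \<beta>"
    and "oriented \<alpha>" "oriented \<beta>"
  shows "oriented (\<beta> \<circ>\<^sub>m \<alpha>)"
proof -
  let ?F = "flip n"
  have pts: "partial_transformation n (?F \<circ>\<^sub>m \<alpha>)" "partial_transformation n (?F \<circ>\<^sub>m \<beta>)"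
    "partial_transformation n (?F \<circ>\<^sub>m (\<beta> \<circ>\<^sub>m ?F))" "partial_transformation n (?F \<circ>\<^sub>m (?F \<circ>\<^sub>m (\<beta> \<circ>\<^sub>m ?F)))"
    using pt_comp pt_flip pa pb by blast+
  have iff: "oriented \<gamma> \<longleftrightarrow> opres n \<gamma> \<or> opres n (?F \<circ>\<^sub>m \<gamma>)" if "partial_transformation n \<gamma>" for \<gamma>
    using oriented_iff[OF that] mirror_flip[OF that] by simp
  have c: "opres n (\<beta> \<circ>\<^sub>m \<alpha>) \<or> opres n (?F \<circ>\<^sub>m (\<beta> \<circ>\<^sub>m \<alpha>))"
  proof (cases "opres n \<alpha>")
    case True
    then show ?thesis
      using opres_comp[OF pa pb True] opres_comp[OF pa pts(2) True] iff[OF pb] assms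
      by (auto simp: map_comp_assoc)
  next
    case False
    then have a: "opres n (?F \<circ>\<^sub>m \<alpha>)" using iff[OF pa] assms by auto
    have e: "(?F \<circ>\<^sub>m (\<beta> \<circ>\<^sub>m ?F)) \<circ>\<^sub>m (?F \<circ>\<^sub>m \<alpha>) = ?F \<circ>\<^sub>m (\<beta> \<circ>\<^sub>m \<alpha>)"
      "(?F \<circ>\<^sub>m ((?F \<circ>\<^sub>m \<beta>) \<circ>\<^sub>m ?F)) \<circ>\<^sub>m (?F \<circ>\<^sub>m \<alpha>) = \<beta> \<circ>\<^sub>m \<alpha>"
      using flip_flip[OF pa] flip_flip[OF pt_comp[OF pa pb]] by (simp_all add: map_comp_assoc)
    have p4: "partial_transformation n (?F \<circ>\<^sub>m ((?F \<circ>\<^sub>m \<beta>) \<circ>\<^sub>m ?F))"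
      using pt_comp pt_flip pts by blast
    show ?thesis
    proof (cases "opres n \<beta>")
      case True
      show ?thesis using opres_comp[OF pts(1,3) a opres_conj_flip[OF pb True]] e by simp
    next
      case False
      then have "opres n (?F \<circ>\<^sub>m \<beta>)" using iff[OF pb] assms by auto
      then show ?thesis using opres_comp[OF pts(1) p4 a opres_conj_flip[OF pts(2)]] e by simp
    qed
  qed
  then show ?thesis using iff[OF pt_comp[OF pa pb]] by simp
qed

section \<open>Affine maps of the cycle and the two monoids\<close>

text \<open>\<open>res n z\<close> is the representative of \<open>z\<close> modulo \<open>n\<close> in \<open>{1..n}\<close>.\<close>

definition res :: "nat \<Rightarrow> int \<Rightarrow> nat" where "res n z = nat ((z - 1) mod int n) + 1"

lemma int_res:
  assumes "n \<ge> 1" shows "int (res n z) = z - int n * ((z - 1) div int n)"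
proof -
  have "0 \<le> (z - 1) mod int n" using assms by simp
  then have "int (res n z) = (z - 1) mod int n + 1" by (simp add: res_def)
  then show ?thesis by (simp add: minus_mult_div_eq_mod[symmetric])
qed

lemma res_bounds: "n \<ge> 1 \<Longrightarrow> 1 \<le> res n z" "n \<ge> 1 \<Longrightarrow> res n z \<le> n"
proof -
  show "n \<ge> 1 \<Longrightarrow> 1 \<le> res n z" by (simp add: res_def)
  assume "n \<ge> 1"
  then have "(z - 1) mod int n < int n" "0 \<le> (z - 1) mod int n" by simp_all
  then show "res n z \<le> n" unfolding res_def by linarith
qed

lemma res_dvd: "n \<ge> 1 \<Longrightarrow> int n dvd int (res n z) - z"
  by (simp add: int_res)

lemma res_eq_iff:
  assumes "n \<ge> 1" shows "res n z = res n w \<longleftrightarrow> int n dvd z - w"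
proof -
  have "res n z = res n w \<longleftrightarrow> (z - 1) mod int n = (w - 1) mod int n"
    using assms by (auto simp: res_def nat_eq_iff2)
  also have "\<dots> \<longleftrightarrow> int n dvd (z - 1) - (w - 1)" by (rule mod_eq_dvd_iff)
  finally show ?thesis by simp
qed

lemma res_unique:
  assumes "1 \<le> x" "x \<le> n" "int n dvd int x - z" shows "res n z = x"
proof -
  have "n \<ge> 1" using assms by auto
  have "res n (int x) = x" using assms by (simp add: res_def)
  moreover have "res n z = res n (int x)" using res_eq_iff[OF \<open>n \<ge> 1\<close>] assms(3) dvd_diff_commute by blast
  ultimately show ?thesis by simp
qed

definition aff :: "nat \<Rightarrow> int \<Rightarrow> int \<Rightarrow> (nat \<rightharpoonup> nat)" where
  "aff n a b = (\<lambda>x. if x \<in> {1..n} then Some (res n (a * int x + b)) else None)"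

lemma aff_Some: "aff n a b x = Some y \<longleftrightarrow> x \<in> {1..n} \<and> y \<in> {1..n} \<and> int n dvd int y - (a * int x + b)"
proof -
  have "res n (a * int x + b) = y \<longleftrightarrow> y \<in> {1..n} \<and> int n dvd int y - (a * int x + b)" if "x \<in> {1..n}"
    using res_unique[of y n] res_bounds[of n] res_dvd[of n "a * int x + b"] that by auto
  then show ?thesis by (auto simp: aff_def)
qed

lemma dom_aff [simp]: "dom (aff n a b) = {1..n}"
  by (auto simp: aff_def dom_def)

lemma pt_aff: "partial_transformation n (aff n a b)"
  unfolding partial_transformation_def dom_aff by (auto simp: ran_def aff_Some)

lemma aff_comp: "aff n a b \<circ>\<^sub>m aff n c d = aff n (a * c) (a * d + b)"
proof
  fix x
  show "(aff n a b \<circ>\<^sub>m aff n c d) x = aff n (a * c) (a * d + b) x"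
  proof (cases "x \<in> {1..n}")
    case True
    then have n: "n \<ge> 1" by auto
    have r: "res n (c * int x + d) \<in> {1..n}" using res_bounds[OF n] by auto
    have "int n dvd a * (int (res n (c * int x + d)) - (c * int x + d))"
      by (rule dvd_mult[OF res_dvd[OF n]])
    then have "res n (a * int (res n (c * int x + d)) + b) = res n (a * c * int x + (a * d + b))"
      unfolding res_eq_iff[OF n] by (simp add: algebra_simps)
    then show ?thesis using True r by (simp add: aff_def map_comp_def)
  qed (auto simp: aff_def map_comp_def)
qed

lemma aff_eq_iff:
  assumes "n \<ge> 1"
  shows "aff n a b = aff n c d \<longleftrightarrow> int n dvd a - c \<and> int n dvd b - d"
proof
  assume e: "aff n a b = aff n c d"
  have q: "int n dvd (a * int x + b) - (c * int x + d)" if "x \<in> {1..n}" for x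
    using fun_cong[OF e, of x] that by (simp add: aff_def res_eq_iff[OF assms])
  \<comment> \<open>The point \<open>n\<close> represents 0, so evaluation there isolates the
    translation part; evaluation at 1 then gives the multiplier.\<close>
  have "int n dvd (a - c) * int n + (b - d)" using q[of n] assms by (simp add: algebra_simps)
  then have b: "int n dvd b - d" by (metis dvd_add_times_triv_left_iff mult.commute)
  have "int n dvd (a - c) + (b - d)" using q[of 1] assms by (simp add: algebra_simps)
  then show "int n dvd a - c \<and> int n dvd b - d" using b dvd_add_left_iff by blast
next
  assume d: "int n dvd a - c \<and> int n dvd b - d"
  then have "int n dvd (a - c) * int x + (b - d)" for x by auto
  then have "int n dvd (a * int x + b) - (c * int x + d)" for x by (simp add: algebra_simps)
  then show "aff n a b = aff n c d" by (auto simp: aff_def res_eq_iff[OF assms])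
qed

section \<open>Partial identities and the common carrier of both monoids\<close>

abbreviation pid :: "nat set \<Rightarrow> (nat \<rightharpoonup> nat)" where "pid A \<equiv> Some |` A"

lemma pid_Some [simp]: "pid A x = Some y \<longleftrightarrow> x \<in> A \<and> y = x"
  by (auto simp: restrict_map_def)

lemma comp_pid: "\<alpha> \<circ>\<^sub>m pid A = \<alpha> |` A"
  by (auto simp: map_comp_def restrict_map_def)

lemma pid_comp_pid: "pid A \<circ>\<^sub>m pid B = pid (A \<inter> B)"
  by (auto simp: map_comp_def restrict_map_def)

lemma pid_comp_id: "ran \<alpha> \<subseteq> A \<Longrightarrow> pid A \<circ>\<^sub>m \<alpha> = \<alpha>"
  by (rule ext) (auto simp: map_comp_def restrict_map_def ran_def split: option.splits)

lemma comp_pid_id: "dom \<alpha> \<subseteq> A \<Longrightarrow> \<alpha> \<circ>\<^sub>m pid A = \<alpha>"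
  unfolding comp_pid by (rule ext) (metis domIff restrict_map_def subsetD)

lemma dom_pid [simp]: "dom (pid A) = A" and ran_pid [simp]: "ran (pid A) = A"
  by (auto simp: dom_def ran_def restrict_map_def)

lemma aff_1_0: "aff n 1 0 = pid {1..n}"
  by (rule ext) (auto simp: aff_def restrict_map_def intro!: res_unique)

lemma pt_pid: "A \<subseteq> {1..n} \<Longrightarrow> partial_transformation n (pid A)"
  by (simp add: partial_transformation_def)

text \<open>One family for both monoids: the flag selects the injective submonoid, so the structural
  arguments are carried out once and only the counts of idempotents differ.\<close>

definition PORX :: "bool \<Rightarrow> nat \<Rightarrow> (nat \<rightharpoonup> nat) set" where
  "PORX b n = {\<alpha>. partial_transformation n \<alpha> \<and> oriented \<alpha> \<and> (b \<longrightarrow> inj_on \<alpha> (dom \<alpha>))}"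

lemma carrier_POR: "carrier (POR n) = PORX False n" "carrier (PORI n) = PORX True n"
  by (auto simp: POR_def PORI_def PORX_def)

lemma PORX_pt: "\<alpha> \<in> PORX b n \<Longrightarrow> partial_transformation n \<alpha>"
  by (simp add: PORX_def)

lemma PORX_True: "\<alpha> \<in> PORX True n \<Longrightarrow> \<alpha> \<in> PORX b n"
  by (simp add: PORX_def)

lemma inj_on_iff: "inj_on \<alpha> (dom \<alpha>) \<longleftrightarrow> (\<forall>x y a. \<alpha> x = Some a \<longrightarrow> \<alpha> y = Some a \<longrightarrow> x = y)"
  unfolding inj_on_def dom_def by (auto; metis option.exhaust)

lemma PORX_comp:
  assumes "\<alpha> \<in> PORX b n" "\<beta> \<in> PORX b n" shows "\<beta> \<circ>\<^sub>m \<alpha> \<in> PORX b n"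
  using assms pt_comp[of n \<alpha> \<beta>] oriented_comp[of n \<alpha> \<beta>]
  unfolding PORX_def inj_on_iff by (auto simp: map_comp_Some_iff)

lemma finite_PORX: "finite (PORX b n)"
proof (rule finite_subset)
  show "finite (\<Union>A\<in>Pow {1..n}. {\<alpha>. dom \<alpha> = A \<and> ran \<alpha> \<subseteq> {1..n}})"
    by (auto intro!: finite_set_of_finite_maps intro: finite_subset)
qed (auto simp: PORX_def partial_transformation_def)

lemma opres_imp_oriented: "partial_transformation n \<alpha> \<Longrightarrow> opres n \<alpha> \<Longrightarrow> oriented \<alpha>"
  using oriented_iff by blast

lemma mono_oriented:
  assumes "partial_transformation n \<alpha>"
    and "\<And>x y a b. \<alpha> x = Some a \<Longrightarrow> \<alpha> y = Some b \<Longrightarrow> x \<le> y \<Longrightarrow> a \<le> b"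
  shows "oriented \<alpha>"
proof (rule opres_imp_oriented[OF assms(1)])
  have "lift_of n \<alpha> (\<lambda>_. 0)"
    unfolding lift_of_def using assms(2) pt_val(1,2)[OF assms(1)] by (force simp: trans_le_add1)
  then show "opres n \<alpha>" by (auto simp: opres_def)
qed

lemma pid_PORX: "A \<subseteq> {1..n} \<Longrightarrow> pid A \<in> PORX b n"
  unfolding PORX_def inj_on_iff using mono_oriented[OF pt_pid] pt_pid by auto

lemma const_PORX:
  assumes "partial_transformation n \<alpha>" "\<And>x y a c. \<alpha> x = Some a \<Longrightarrow> \<alpha> y = Some c \<Longrightarrow> a = c"
    and "b \<Longrightarrow> inj_on \<alpha> (dom \<alpha>)"
  shows "\<alpha> \<in> PORX b n"
  unfolding PORX_def using assms mono_oriented[OF assms(1)] by (metis (mono_tags, lifting) mem_Collect_eq order_refl)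

lemma aff_inj:
  assumes "int n dvd a * c - 1" shows "inj_on (aff n a b) (dom (aff n a b))"
  unfolding inj_on_iff
proof (intro allI impI)
  fix x y v assume "aff n a b x = Some v" "aff n a b y = Some v"
  then have h: "x \<in> {1..n}" "y \<in> {1..n}" "int n dvd int v - (a * int x + b)" "int n dvd int v - (a * int y + b)"
    by (auto simp: aff_Some)
  have "int n dvd (int v - (a * int x + b)) - (int v - (a * int y + b))" using h dvd_diff by blast
  then have "int n dvd a * (int y - int x)" by (simp add: algebra_simps)
  then have "int n dvd c * (a * (int y - int x))" by (rule dvd_mult)
  moreover have "int n dvd (a * c - 1) * (int y - int x)" using assms by auto
  ultimately have "int n dvd c * (a * (int y - int x)) - (a * c - 1) * (int y - int x)" using dvd_diff by blast
  then have "int n dvd int y - int x" by (simp add: algebra_simps)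
  then show "x = y" using h(1,2) res_unique[of x n "int x"] res_unique[of y n "int x"] by auto
qed

lemma aff_PORX:
  assumes "a = 1 \<or> a = -1" shows "aff n a t \<in> PORX b n"
proof (cases "n = 0")
  case True
  then have "aff n a t = pid {}" by (auto simp: aff_def)
  then show ?thesis using pid_PORX[of "{}" n b] by simp
next
  case False
  then have n: "n \<ge> 1" by auto
  have "opres n (aff n a t) \<or> opres n (mirror n (aff n a t))"
  proof (cases "a = 1")
    case True
    \<comment> \<open>\<open>res\<close> subtracts \<open>n\<close> times this quotient; adding it
      back lifts the map to the translation by \<open>t\<close> of the integers.\<close>
    have "lift_of n (aff n 1 t) (\<lambda>x. (int x + t - 1) div int n)"
      unfolding lift_of_def by (auto simp: aff_def int_res[OF n] split: if_splits)
    then show ?thesis using True by (auto simp: opres_def)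
  next
    case False
    \<comment> \<open>The same quotient with opposite sign: the mirrored reflection lifts to the
      translation by \<open>n + 1 - t\<close>.\<close>
    have "lift_of n (mirror n (aff n (-1) t)) (\<lambda>x. - ((- int x + t - 1) div int n))"
      unfolding lift_of_def
    proof (intro allI impI)
      fix x y u v assume h: "mirror n (aff n (-1) t) x = Some u" "mirror n (aff n (-1) t) y = Some v" "x \<le> y"
      have "int u = int n + 1 - int (res n (- int x + t)) \<and> int v = int n + 1 - int (res n (- int y + t)) \<and> y \<le> n \<and> 1 \<le> x"
        using h res_bounds[OF n] by (auto simp: mirror_eq_Some aff_def of_nat_diff le_SucI split: if_splits)
      then show "int u + int n * - ((- int x + t - 1) div int n) \<le> int v + int n * - ((- int y + t - 1) div int n) \<and>
       int v + int n * - ((- int y + t - 1) div int n) \<le> int u + int n * - ((- int x + t - 1) div int n) + int n"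
        unfolding int_res[OF n] using h(3) by (auto simp: algebra_simps)
    qed
    then show ?thesis using False assms by (auto simp: opres_def)
  qed
  then have "oriented (aff n a t)" using oriented_iff[OF pt_aff] by blast
  moreover have "int n dvd a * a - 1" using assms by auto
  ultimately show ?thesis using aff_inj pt_aff by (auto simp: PORX_def)
qed

text \<open>The lifted values \<open>F 1, ..., F n\<close> are pairwise incongruent modulo
  \<open>n\<close>, hence strictly increasing, and they spread over less than one period. So
  \<open>n\<close> increasing integers fit only if they are consecutive.\<close>

lemma opres_full_inj:
  assumes pt: "partial_transformation n \<alpha>" and o: "opres n \<alpha>" and d: "dom \<alpha> = {1..n}" and i: "inj_on \<alpha> (dom \<alpha>)"
  shows "\<exists>t. \<alpha> = aff n 1 t"
proof (cases "n = 0")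
  case True
  then show ?thesis using d by (auto simp: aff_def)
next
  case False
  obtain m where m: "lift_of n \<alpha> m" using o by (auto simp: opres_def)
  define v where "v x = the (\<alpha> x)" for x
  define F where "F x = int (v x) + int n * m x" for x
  have v: "\<alpha> x = Some (v x)" if "x \<in> {1..n}" for x using that unfolding d[symmetric] v_def by auto
  have le: "F x \<le> F y \<and> F y \<le> F x + int n" if "x \<in> {1..n}" "y \<in> {1..n}" "x \<le> y" for x y
    using lift_ofD[OF m v[OF that(1)] v[OF that(2)] that(3)] by (simp add: F_def)
  have ne: "\<not> int n dvd F x - F y" if "x \<in> {1..n}" "y \<in> {1..n}" "x \<noteq> y" for x y
  proof
    assume "int n dvd F x - F y"
    then have "int n dvd (F x - F y) - int n * (m x - m y)" by (rule dvd_diff) simp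
    then have "int n dvd int (v x) - int (v y)" by (simp add: F_def algebra_simps)
    moreover have "v x \<in> {1..n}" "v y \<in> {1..n}" 
      using pt_val[OF pt v[OF that(1)]] pt_val[OF pt v[OF that(2)]] by auto
    ultimately have "v x = v y"
      using res_unique[of "v x" n "int (v y)"] res_unique[of "v y" n "int (v y)"] by auto
    then show False using i that v unfolding inj_on_iff by metis
  qed
  have lt: "F x + 1 \<le> F (Suc x)" if "1 \<le> x" "Suc x \<le> n" for x
    using le[of x "Suc x"] ne[of x "Suc x"] that by (cases "F x = F (Suc x)") auto
  \<comment> \<open>For \<open>n = 1\<close> the two points coincide and no strictness can be
    expected; \<open>Fx\<close> treats that case separately.\<close>
  have lt_n: "F n + 1 \<le> F 1 + int n" if "n \<noteq> 1"
    using le[of 1 n] ne[of n 1] that False by (cases "F n = F 1 + int n") auto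
  have up: "F x + int (y - x) \<le> F y" if "1 \<le> x" "x \<le> y" "y \<le> n" for x y
    using that(2,3,1)
  proof (induction y rule: dec_induct)
    case (step k)
    then show ?case using lt[of k] by auto
  qed simp
  have Fx: "F x = F 1 + int x - 1" if "x \<in> {1..n}" for x
    using up[of 1 x] up[of x n] lt_n that False by (cases "n = 1") auto
  have "\<alpha> = aff n 1 (F 1 - 1)"
  proof
    fix x
    show "\<alpha> x = aff n 1 (F 1 - 1) x"
    proof (cases "x \<in> {1..n}")
      case True
      have "int (v x) - (1 * int x + (F 1 - 1)) = int (v x) - F x" using Fx[OF True] by simp
      then have "int (v x) - (1 * int x + (F 1 - 1)) = - int n * m x" by (simp add: F_def)
      then have "aff n 1 (F 1 - 1) x = Some (v x)"
        unfolding aff_Some using pt_val[OF pt v[OF True]] True by auto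
      then show ?thesis using v[OF True] by simp
    next
      case False
      then show ?thesis using d by (auto simp: aff_def dom_def)
    qed
  qed
  then show ?thesis by blast
qed

lemma flip_aff: "flip n = aff n (-1) 1"
  by (rule ext) (auto simp: flip_def aff_def of_nat_diff intro!: res_unique[symmetric])

lemma aff_mod: "aff n a (t mod int n) = aff n a t"
proof (cases "n \<ge> 1")
  case True
  have "int n dvd t mod int n - t" by (metis dvd_minus_mod dvd_diff_commute)
  then show ?thesis using aff_eq_iff[OF True] by auto
qed (auto simp: aff_def)

lemma PORX_unit:
  assumes "\<alpha> \<in> PORX b n" "dom \<alpha> = {1..n}" "inj_on \<alpha> (dom \<alpha>)"
  shows "\<exists>a t. (a = 1 \<or> a = -1) \<and> \<alpha> = aff n a t"
proof -
  have pt: "partial_transformation n \<alpha>" and "oriented \<alpha>" using assms by (auto simp: PORX_def)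
  then consider "opres n \<alpha>" | "opres n (mirror n \<alpha>)" using oriented_iff by blast
  then show ?thesis
  proof cases
    case 1
    then show ?thesis using opres_full_inj[OF pt _ assms(2,3)] by blast
  next
    case 2
    have "inj_on (mirror n \<alpha>) (dom (mirror n \<alpha>))" "dom (mirror n \<alpha>) = {1..n}"
      using assms(2,3) pt_val[OF pt] unfolding inj_on_iff by (auto simp: mirror_def dom_def) (metis Suc_diff_le diff_diff_cancel diff_Suc_Suc le_SucI)+
    then obtain t where t: "mirror n \<alpha> = aff n 1 t" using opres_full_inj[OF pt_mirror[OF pt] 2] by blast
    have "\<alpha> = flip n \<circ>\<^sub>m mirror n \<alpha>" using flip_flip[OF pt] mirror_flip[OF pt] by simp
    then have "\<alpha> = aff n (-1) (- t + 1)" unfolding t flip_aff aff_comp by simp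
    then show ?thesis by blast
  qed
qed

section \<open>Inverses of oriented partial injections\<close>

definition minv :: "(nat \<rightharpoonup> nat) \<Rightarrow> (nat \<rightharpoonup> nat)" where
  "minv \<alpha> = (\<lambda>y. if y \<in> ran \<alpha> then Some (THE x. \<alpha> x = Some y) else None)"

lemma minv_Some: "inj_on \<alpha> (dom \<alpha>) \<Longrightarrow> minv \<alpha> y = Some x \<longleftrightarrow> \<alpha> x = Some y"
  unfolding inj_on_iff minv_def ran_def by (auto intro!: the_equality) (metis (mono_tags, lifting) theI)

lemma opres_minv:
  assumes pt: "partial_transformation n \<alpha>" and "opres n \<alpha>" and i: "inj_on \<alpha> (dom \<alpha>)"
  shows "opres n (minv \<alpha>)"
proof -
  obtain m where m: "lift_of n \<alpha> m" using assms by (auto simp: opres_def)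
  \<comment> \<open>The inverse of a lift takes the value on sheet \<open>m x\<close> back to
    \<open>x\<close> on sheet 0; shifting by periods puts \<open>x\<close> on sheet
    \<open>- m x\<close> over the value itself.\<close>
  have "lift_of n (minv \<alpha>) (\<lambda>y. - m (the (minv \<alpha> y)))"
    unfolding lift_of_def
  proof (intro allI impI)
    fix u v x y assume h: "minv \<alpha> u = Some x" "minv \<alpha> v = Some y" "u \<le> v"
    then have a: "\<alpha> x = Some u" "\<alpha> y = Some v" using minv_Some[OF i] by auto
    note vx = pt_val[OF pt a(1)] and vy = pt_val[OF pt a(2)]
    have e: "u = v \<Longrightarrow> x = y" using i a unfolding inj_on_iff by blast
    have "int x + int n * - m x \<le> int y + int n * - m y \<and>
       int y + int n * - m y \<le> int x + int n * - m x + int n"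
    proof (cases "x \<le> y")
      case True
      note s = lift_of_sheets[OF pt m a True]
      have "m x = m y" using s(4) h(3) e by (cases "m y = m x") auto
      then show ?thesis using True vx vy by auto
    next
      case False
      then have yx: "y \<le> x" by auto
      note s = lift_of_sheets[OF pt m a(2,1) yx]
      have "m x \<noteq> m y" using s(3) h(3) e False by auto
      then have "m x = m y + 1" using s by auto
      then show ?thesis using yx vx vy by (auto simp: algebra_simps)
    qed
    then show "int x + int n * - m (the (minv \<alpha> u)) \<le> int y + int n * - m (the (minv \<alpha> v)) \<and>
       int y + int n * - m (the (minv \<alpha> v)) \<le> int x + int n * - m (the (minv \<alpha> u)) + int n"
      using h by simp
  qed
  then show ?thesis by (auto simp: opres_def)
qed

lemma minv_PORX:
  assumes "\<alpha> \<in> PORX b n" and i: "inj_on \<alpha> (dom \<alpha>)"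
  shows "minv \<alpha> \<in> PORX True n"
proof -
  have pt: "partial_transformation n \<alpha>" and "oriented \<alpha>" using assms by (auto simp: PORX_def)
  have pti: "partial_transformation n (minv \<alpha>)"
    using pt_val[OF pt] unfolding partial_transformation_def by (auto simp: dom_def ran_def minv_Some[OF i])
  have inji: "inj_on (minv \<alpha>) (dom (minv \<alpha>))" unfolding inj_on_iff by (auto simp: minv_Some[OF i])
  consider "opres n \<alpha>" | "opres n (mirror n \<alpha>)" using oriented_iff[OF pt] \<open>oriented \<alpha>\<close> by blast
  then have "oriented (minv \<alpha>)"
  proof cases
    case 1
    then show ?thesis using opres_minv[OF pt _ i] opres_imp_oriented[OF pti] by blast
  next
    case 2
    have ir: "inj_on (mirror n \<alpha>) (dom (mirror n \<alpha>))"
      using i pt_val[OF pt] unfolding inj_on_iff mirror_eq_Some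
      by (auto) (metis Suc_diff_le diff_diff_cancel diff_Suc_Suc le_SucI)
    have pr: "partial_transformation n (minv (mirror n \<alpha>))"
      using pt_val[OF pt_mirror[OF pt]] unfolding partial_transformation_def by (auto simp: dom_def ran_def minv_Some[OF ir])
    have "oriented (minv (mirror n \<alpha>))"
      using opres_minv[OF pt_mirror[OF pt] 2 ir] opres_imp_oriented[OF pr] by blast
    moreover have "minv \<alpha> = minv (mirror n \<alpha>) \<circ>\<^sub>m flip n"
    proof -
      have "minv \<alpha> y = Some x \<longleftrightarrow> (minv (mirror n \<alpha>) \<circ>\<^sub>m flip n) y = Some x" for x y
        unfolding map_comp_Some_iff minv_Some[OF i] minv_Some[OF ir] mirror_eq_Some flip_def
        using pt_val[OF pt] by (auto split: if_splits)
      then show ?thesis by (metis not_Some_eq ext)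
    qed
    moreover have "oriented (flip n)" using aff_PORX[of "-1" n 1 True] by (simp add: flip_aff PORX_def)
    ultimately show ?thesis using oriented_comp[OF pt_flip pr] by simp
  qed
  then show ?thesis using pti inji by (simp add: PORX_def)
qed

text \<open>Between two values ascents and descents alternate around the cycle, so they are equally
  many and an anti-cyclic sequence is also cyclic.\<close>

lemma opres_of_two_values:
  assumes pt: "partial_transformation n \<alpha>" and "oriented \<alpha>" and "p < q" "ran \<alpha> \<subseteq> {p, q}"
  shows "opres n \<alpha>"
proof (cases "opres n \<alpha>")
  case False
  then obtain m where m: "lift_of n (mirror n \<alpha>) m" using assms oriented_iff[OF pt] by (auto simp: opres_def)
  \<comment> \<open>In the mirrored order \<open>q\<close> precedes \<open>p\<close> on each sheet.
    Moving \<open>p\<close> up by one sheet restores exactly this order on the cover for the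
    original values.\<close>
  have "lift_of n \<alpha> (\<lambda>x. m x + (if \<alpha> x = Some p then 1 else 0))"
    unfolding lift_of_def
  proof (intro allI impI)
    fix x y a b assume h: "\<alpha> x = Some a" "\<alpha> y = Some b" "x \<le> y"
    then have ab: "a \<in> {p,q}" "b \<in> {p,q}" using assms(4) by (auto simp: ran_def)
    note v = pt_val[OF pt h(1)] pt_val[OF pt h(2)]
    have r: "mirror n \<alpha> x = Some (n+1-a)" "mirror n \<alpha> y = Some (n+1-b)" using h by (auto simp: mirror_def)
    have l: "int n + 1 - int a + int n * m x \<le> int n + 1 - int b + int n * m y"
      "int n + 1 - int b + int n * m y \<le> int n + 1 - int a + int n * m x + int n"
      using lift_ofD[OF m r h(3)] v by (auto simp: of_nat_diff)
    have s: "m x \<le> m y" "m y \<le> m x + 1" "m x = m y \<Longrightarrow> n+1-a \<le> n+1-b" "m y \<noteq> m x \<Longrightarrow> n+1-b \<le> n+1-a"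
      using lift_of_sheets[OF pt_mirror[OF pt] m r h(3)] by auto
    consider "m y = m x" | "m y = m x + 1" using s by fastforce
    then show "int a + int n * (m x + (if \<alpha> x = Some p then 1 else 0)) \<le> int b + int n * (m y + (if \<alpha> y = Some p then 1 else 0)) \<and>
       int b + int n * (m y + (if \<alpha> y = Some p then 1 else 0)) \<le> int a + int n * (m x + (if \<alpha> x = Some p then 1 else 0)) + int n"
      using ab v s(3,4) h l \<open>p < q\<close> by cases (auto simp: algebra_simps)
  qed
  then show ?thesis by (auto simp: opres_def)
qed

section \<open>Rank dichotomy for endomorphisms\<close>

definition Endo :: "bool \<Rightarrow> nat \<Rightarrow> ((nat \<rightharpoonup> nat) \<Rightarrow> (nat \<rightharpoonup> nat)) set" where
  "Endo b n = {\<phi>. (\<forall>\<alpha>\<in>PORX b n. \<phi> \<alpha> \<in> PORX b n) \<and>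
     (\<forall>\<alpha>\<in>PORX b n. \<forall>\<beta>\<in>PORX b n. \<phi> (\<beta> \<circ>\<^sub>m \<alpha>) = \<phi> \<beta> \<circ>\<^sub>m \<phi> \<alpha>) \<and> \<phi> \<in> extensional (PORX b n)}"

lemma semigroup_End_eq: "semigroup_End (POR n) = Endo False n" "semigroup_End (PORI n) = Endo True n"
  unfolding semigroup_End_def Endo_def hom_def carrier_POR by (auto simp: POR_def PORI_def)

lemma enum_iso:
  assumes "finite (B :: nat set)"
  shows "\<exists>g. bij_betw g {1..card B} B \<and> strict_mono_on {1..card B} g"
proof -
  obtain h where h: "bij_betw h {..<card B} B" "strict_mono_on {..<card B} h"
    using ex_bij_betw_strict_mono_card[OF assms] by blast
  have "bij_betw (\<lambda>x. x - 1) {1..card B} {..<card B}"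
    by (rule bij_betwI[where g=Suc]) auto
  then have "bij_betw (h \<circ> (\<lambda>x. x - 1)) {1..card B} B" using h(1) bij_betw_trans by blast
  moreover have "strict_mono_on {1..card B} (h \<circ> (\<lambda>x. x - 1))"
  proof (rule strict_mono_onI)
    fix r s assume "r \<in> {1..card B}" "s \<in> {1..card B}" "r < s"
    then show "(h \<circ> (\<lambda>x. x - 1)) r < (h \<circ> (\<lambda>x. x - 1)) s"
      using strict_mono_onD[OF h(2), of "r - 1" "s - 1"] by auto
  qed
  ultimately show ?thesis by blast
qed

definition img :: "(nat \<rightharpoonup> nat) \<Rightarrow> nat set \<Rightarrow> nat set" where "img \<alpha> A = {y. \<exists>x\<in>A. \<alpha> x = Some y}"

lemma img_comp: "img (\<beta> \<circ>\<^sub>m \<alpha>) A = img \<beta> (img \<alpha> A)"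
  by (auto simp: img_def map_comp_Some_iff)

lemma img_pid [simp]: "img (pid A) B = A \<inter> B"
  by (auto simp: img_def)

lemma img_image: "img \<alpha> A = (\<lambda>x. the (\<alpha> x)) ` (A \<inter> dom \<alpha>)"
  by (force simp: img_def)

lemma card_img: "finite A \<Longrightarrow> card (img \<alpha> A) \<le> card A"
  unfolding img_image by (meson Int_lower1 card_image_le card_mono finite_Int le_trans)

lemma img_full_rank:
  assumes "finite A" "card (img \<alpha> A) \<ge> card A"
  shows "A \<subseteq> dom \<alpha>" "inj_on \<alpha> A"
proof -
  let ?v = "\<lambda>x. the (\<alpha> x)"
  have le: "card (img \<alpha> A) \<le> card (A \<inter> dom \<alpha>)" unfolding img_image using assms(1) by (simp add: card_image_le)
  then have "A \<inter> dom \<alpha> = A" using assms by (meson Int_lower1 card_seteq le_trans)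
  then show s: "A \<subseteq> dom \<alpha>" by auto
  then have "card (?v ` A) = card A"
    using assms card_image_le[OF assms(1), of ?v] unfolding img_image by (simp add: Int_absorb2)
  then have "inj_on ?v A" using assms(1) eq_card_imp_inj_on by blast
  then show "inj_on \<alpha> A" unfolding inj_on_def by metis
qed

lemma idem_fix:
  assumes "\<alpha> \<circ>\<^sub>m \<alpha> = \<alpha>" "y \<in> ran \<alpha>" shows "\<alpha> y = Some y"
proof -
  obtain x where x: "\<alpha> x = Some y" using assms(2) by (auto simp: ran_def)
  then have "(\<alpha> \<circ>\<^sub>m \<alpha>) x = Some y" using assms(1) by simp
  then show ?thesis using x by (simp add: map_comp_simps)
qed

text \<open>Excludes the middle ranks: there are more \<open>k\<close>-subsets than points that
  could be assigned to them injectively.\<close>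

lemma choose_gt:
  assumes "2 \<le> k" "k + 2 \<le> n" shows "n < n choose k"
proof -
  have two: "n < n choose 2" if "4 \<le> n"
  proof -
    have "n * 3 \<le> n * (n - 1)" using that by (intro mult_le_mono) auto
    then have "n + 1 \<le> n * (n - 1) div 2" using that by linarith
    then show ?thesis by (simp add: choose_two)
  qed
  have "n choose 2 \<le> n choose k"
  proof (cases "2 * k \<le> n")
    case True
    then show ?thesis using binomial_mono[of 2 k n] assms by simp
  next
    case False
    then have "n choose 2 \<le> n choose (n - k)" using binomial_mono[of 2 "n - k" n] assms by simp
    then show ?thesis using binomial_symmetric[of k n] assms by simp
  qed
  moreover have "n < n choose 2" by (rule two) (use assms in linarith)
  ultimately show ?thesis by linarith
qed

text \<open>The two families of \<open>n\<close> equally large subsets that can survive an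
  endomorphism. Both are indexed by points, so that either kind of endomorphism is described by a
  permutation of \<open>{1..n}\<close>.\<close>

definition cell :: "bool \<Rightarrow> nat \<Rightarrow> nat \<Rightarrow> nat set" where
  "cell c n l = (if c then {1..n} - {l} else {l})"

definition crank :: "bool \<Rightarrow> nat \<Rightarrow> nat" where "crank c n = (if c then n - 1 else 1)"

lemma cell_basic:
  assumes "l \<in> {1..n}"
  shows "cell c n l \<subseteq> {1..n}" "card (cell c n l) = crank c n" "finite (cell c n l)"
  using assms by (auto simp: cell_def crank_def)

lemma cell_inj:
  assumes "l \<in> {1..n}" "j \<in> {1..n}" shows "cell c n l = cell c n j \<longleftrightarrow> l = j"
proof -
  have "l \<in> cell c n j \<longleftrightarrow> (l \<in> cell c n l \<longleftrightarrow> l = j)" using assms by (simp add: cell_def)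
  then show ?thesis by auto
qed

lemma cell_surj:
  assumes "A \<subseteq> {1..n}" "card A = crank c n" "3 \<le> n"
  shows "\<exists>l\<in>{1..n}. A = cell c n l"
proof (cases c)
  case True
  then have "card ({1..n} - A) = 1"
    using assms card_Diff_subset[of A "{1..n}"] finite_subset[OF assms(1)] by (auto simp: crank_def)
  then obtain l where l: "{1..n} - A = {l}" by (auto simp: card_1_singleton_iff)
  then have "l \<in> {1..n}" by blast
  moreover have "A = {1..n} - ({1..n} - A)" using assms(1) by blast
  then have "A = cell c n l" using True unfolding l by (simp add: cell_def)
  ultimately show ?thesis by blast
next
  case False
  then show ?thesis using assms by (auto simp: cell_def crank_def card_1_singleton_iff)
qed

text \<open>Comprises the endomorphisms with least uncollapsed rank \<open>n\<close> as well as the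
  constant ones.\<close>

definition typeC :: "bool \<Rightarrow> nat \<Rightarrow> ((nat \<rightharpoonup> nat) \<Rightarrow> (nat \<rightharpoonup> nat)) set" where
  "typeC b n = {\<phi>\<in>Endo b n. \<forall>A. A \<subset> {1..n} \<longrightarrow> \<phi> (pid A) = \<phi> (pid {})}"

text \<open>\<open>cell_map c n \<alpha>\<close> is the action of \<open>\<alpha>\<close> on the indices of the cells; for \<open>c = True\<close> it moves
  the missing points.\<close>

definition cell_map :: "bool \<Rightarrow> nat \<Rightarrow> (nat \<rightharpoonup> nat) \<Rightarrow> (nat \<rightharpoonup> nat)" where
  "cell_map c n \<alpha> = (\<lambda>l. if l \<in> {1..n} \<and> (\<exists>j\<in>{1..n}. img \<alpha> (cell c n l) = cell c n j)
      then Some (THE j. j \<in> {1..n} \<and> img \<alpha> (cell c n l) = cell c n j) else None)"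

lemma cell_map_Some:
  "cell_map c n \<alpha> l = Some j \<longleftrightarrow> l \<in> {1..n} \<and> j \<in> {1..n} \<and> img \<alpha> (cell c n l) = cell c n j"
proof -
  have "(THE j. j \<in> {1..n} \<and> img \<alpha> (cell c n l) = cell c n j) = j"
    if "j \<in> {1..n}" "img \<alpha> (cell c n l) = cell c n j" for j
    using that cell_inj by (intro the_equality) auto
  then show ?thesis by (auto simp: cell_map_def)
qed

definition perms_of :: "nat \<Rightarrow> (nat \<rightharpoonup> nat) set" where
  "perms_of n = {s. dom s = {1..n} \<and> ran s = {1..n} \<and> inj_on s (dom s)}"

lemma perms_minv:
  assumes "s \<in> perms_of n"
  shows "minv s \<circ>\<^sub>m s = pid {1..n}" "s \<circ>\<^sub>m minv s = pid {1..n}" "minv s \<in> perms_of n" "minv (minv s) = s"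
    "partial_transformation n s" "minv s y = Some x \<longleftrightarrow> s x = Some y"
proof -
  have i: "inj_on s (dom s)" and d: "dom s = {1..n}" "ran s = {1..n}" using assms by (auto simp: perms_of_def)
  note m = minv_Some[OF i]
  show "minv s y = Some x \<longleftrightarrow> s x = Some y" by (rule m)
  have ii: "inj_on (minv s) (dom (minv s))" unfolding inj_on_iff m by auto
  have "dom (minv s) = ran s" "ran (minv s) = dom s" by (auto simp: dom_def ran_def m)
  then show "minv s \<in> perms_of n" using d ii by (simp add: perms_of_def)
  show "partial_transformation n s" using d by (simp add: partial_transformation_def)
  have eqI: "\<alpha> = \<beta>" if "\<And>x y. \<alpha> x = Some y \<longleftrightarrow> \<beta> x = Some y" for \<alpha> \<beta> :: "nat \<rightharpoonup> nat"
    using that by (metis not_Some_eq ext)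
  show "minv (minv s) = s" by (rule eqI) (simp add: minv_Some[OF ii] m)
  have i': "\<And>x y a. s x = Some a \<Longrightarrow> s y = Some a \<Longrightarrow> x = y" using i unfolding inj_on_iff by blast
  have dd: "x \<in> {1..n} \<longleftrightarrow> (\<exists>a. s x = Some a)" for x
    unfolding d(1)[symmetric] by auto
  have rr: "y \<in> {1..n} \<longleftrightarrow> (\<exists>x. s x = Some y)" for y
    unfolding d(2)[symmetric] by (auto simp: ran_def)
  show "minv s \<circ>\<^sub>m s = pid {1..n}"
    by (rule eqI) (unfold map_comp_Some_iff m pid_Some dd, use i' in blast)
  show "s \<circ>\<^sub>m minv s = pid {1..n}"
    by (rule eqI) (unfold map_comp_Some_iff m pid_Some rr, use i' in force)
qed

definition cell_conj :: "bool \<Rightarrow> bool \<Rightarrow> nat \<Rightarrow> (nat \<rightharpoonup> nat) \<Rightarrow> (nat \<rightharpoonup> nat) \<Rightarrow> (nat \<rightharpoonup> nat)" where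
  "cell_conj c b n s = (\<lambda>\<alpha>\<in>PORX b n. s \<circ>\<^sub>m (cell_map c n \<alpha> \<circ>\<^sub>m minv s))"

lemma minv_comp:
  assumes "inj_on \<alpha> (dom \<alpha>)" shows "minv \<alpha> \<circ>\<^sub>m \<alpha> = pid (dom \<alpha>)"
proof
  fix x
  show "(minv \<alpha> \<circ>\<^sub>m \<alpha>) x = pid (dom \<alpha>) x"
  proof (cases "\<alpha> x")
    case (Some y)
    then have "minv \<alpha> y = Some x" using minv_Some[OF assms] by blast
    then show ?thesis using Some by (auto simp: restrict_map_def)
  qed (auto simp: restrict_map_def)
qed

section \<open>Structure of a single endomorphism\<close>

locale endo =
  fixes b :: bool and n :: nat and \<phi>
  assumes n3: "3 \<le> n" and \<phi>: "\<phi> \<in> Endo b n"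
begin

lemma closed: "\<alpha> \<in> PORX b n \<Longrightarrow> \<phi> \<alpha> \<in> PORX b n"
  and hom: "\<alpha> \<in> PORX b n \<Longrightarrow> \<beta> \<in> PORX b n \<Longrightarrow> \<phi> (\<beta> \<circ>\<^sub>m \<alpha>) = \<phi> \<beta> \<circ>\<^sub>m \<phi> \<alpha>"
  using \<phi> by (auto simp: Endo_def)

abbreviation f where "f \<equiv> \<phi> (pid {})"

lemma pidS: "A \<subseteq> {1..n} \<Longrightarrow> pid A \<in> PORX b n" by (rule pid_PORX)

lemma zero: assumes "\<alpha> \<in> PORX b n" shows "\<phi> \<alpha> \<circ>\<^sub>m f = f" "f \<circ>\<^sub>m \<phi> \<alpha> = f"
proof -
  have "\<alpha> \<circ>\<^sub>m pid {} = pid {}" "pid {} \<circ>\<^sub>m \<alpha> = pid {}" by (auto simp: map_comp_def split: option.splits)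
  then show "\<phi> \<alpha> \<circ>\<^sub>m f = f" "f \<circ>\<^sub>m \<phi> \<alpha> = f" using hom[OF pidS assms, of "{}"] hom[OF assms pidS, of "{}"] by auto
qed

lemma meet: "A \<subseteq> {1..n} \<Longrightarrow> B \<subseteq> {1..n} \<Longrightarrow> \<phi> (pid A) \<circ>\<^sub>m \<phi> (pid B) = \<phi> (pid (A \<inter> B))"
  using hom[of "pid B" "pid A"] pidS by (simp add: pid_comp_pid)

lemma idem: "A \<subseteq> {1..n} \<Longrightarrow> \<phi> (pid A) \<circ>\<^sub>m \<phi> (pid A) = \<phi> (pid A)"
  using meet[of A A] by simp

lemma ran_meet:
  assumes "A \<subseteq> {1..n}" "B \<subseteq> {1..n}" "x \<in> ran (\<phi> (pid A))" "x \<in> ran (\<phi> (pid B))"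
  shows "x \<in> ran (\<phi> (pid (A \<inter> B)))"
proof -
  have "\<phi> (pid A) x = Some x" "\<phi> (pid B) x = Some x" 
    using idem_fix[OF idem[OF assms(1)] assms(3)] idem_fix[OF idem[OF assms(2)] assms(4)] by auto
  then have "(\<phi> (pid A) \<circ>\<^sub>m \<phi> (pid B)) x = Some x" by (simp add: map_comp_Some_iff)
  then show ?thesis using meet[OF assms(1,2)] by (auto simp: ran_def)
qed

text \<open>If the range of the idempotent lay inside that of \<open>f\<close>, then
  \<open>f\<close> would fix this range pointwise and absorb the idempotent from the left without
  changing it; but that product equals \<open>f\<close>.\<close>

lemma new_point:
  assumes "A \<subseteq> {1..n}" "\<phi> (pid A) \<noteq> f" shows "\<exists>x. x \<in> ran (\<phi> (pid A)) - ran f"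
proof (rule ccontr)
  let ?e = "\<phi> (pid A)"
  assume "\<not> ?thesis"
  then have "ran ?e \<subseteq> ran f" by auto
  have ff: "f \<circ>\<^sub>m f = f" using zero(1)[of "pid {}"] pidS[of "{}"] by simp
  have "f \<circ>\<^sub>m ?e = ?e"
  proof
    fix x
    show "(f \<circ>\<^sub>m ?e) x = ?e x"
    proof (cases "?e x")
      case (Some y)
      then have "f y = Some y" using \<open>ran ?e \<subseteq> ran f\<close> idem_fix[OF ff, of y] by (auto simp: ran_def)
      then show ?thesis using Some by (simp add: map_comp_Some_iff)
    qed simp
  qed
  then show False using zero(2)[OF pidS[OF assms(1)]] assms(2) by simp
qed

text \<open>With \<open>u\<close> the increasing bijection from \<open>B\<close> to
  \<open>A\<close>, \<open>pid B\<close> is \<open>pid A\<close> multiplied by \<open>u\<close> and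
  its inverse. Hence its image contains the factor \<open>f\<close>, which is absorbing.\<close>

lemma same_card:
  assumes "A \<subseteq> {1..n}" "B \<subseteq> {1..n}" "card A = card B" "\<phi> (pid A) = f"
  shows "\<phi> (pid B) = f"
proof -
  have fin: "finite A" "finite B" using assms finite_subset by auto
  obtain g h where g: "bij_betw g {1..card A} A" "strict_mono_on {1..card A} g"
    and h: "bij_betw h {1..card A} B" "strict_mono_on {1..card A} h"
    using enum_iso[OF fin(1)] enum_iso[OF fin(2)] assms(3) by auto
  define u where "u = (\<lambda>x. if x \<in> B then Some (g (inv_into {1..card A} h x)) else None)"
  have u: "u x = Some y \<longleftrightarrow> (\<exists>i\<in>{1..card A}. x = h i \<and> y = g i)" for x y
    using h(1) by (auto simp: u_def bij_betw_def inv_into_f_f)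
  have gh: "g i \<in> A" "h i \<in> B" if "i \<in> {1..card A}" for i using g h that by (auto simp: bij_betw_def)
  have gm: "g i \<le> g j \<longleftrightarrow> i \<le> j" "h i \<le> h j \<longleftrightarrow> i \<le> j" if "i \<in> {1..card A}" "j \<in> {1..card A}" for i j
    using that g(2) h(2) by (simp_all add: strict_mono_on_less_eq)
  have pt: "partial_transformation n u"
  proof -
    have "dom u \<subseteq> B" "ran u \<subseteq> A" using gh by (auto simp: dom_def ran_def u)
    then show ?thesis using assms(1,2) unfolding partial_transformation_def by (meson subset_trans)
  qed
  have inj: "inj_on u (dom u)" unfolding inj_on_iff u using gm by (metis order_antisym order_refl)
  have "oriented u" by (rule mono_oriented[OF pt]) (use gm in \<open>auto simp: u\<close>)
  then have uS: "u \<in> PORX b n" using pt inj by (simp add: PORX_def)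
  have vS: "minv u \<in> PORX b n" by (rule PORX_True[OF minv_PORX[OF uS inj]])
  have "minv u \<circ>\<^sub>m (pid A \<circ>\<^sub>m u) = pid B"
  proof -
    have "(minv u \<circ>\<^sub>m (pid A \<circ>\<^sub>m u)) x = Some y \<longleftrightarrow> pid B x = Some y" for x y
    proof
      assume "(minv u \<circ>\<^sub>m (pid A \<circ>\<^sub>m u)) x = Some y"
      then obtain w where w: "u x = Some w" "u y = Some w" by (auto simp: map_comp_Some_iff minv_Some[OF inj])
      then have "x = y" using inj unfolding inj_on_iff by blast
      then show "pid B x = Some y" using w(1) gh(2) by (auto simp: u)
    next
      assume "pid B x = Some y"
      then have "x = y" "x \<in> B" by auto
      then obtain i where "i \<in> {1..card A}" "x = h i" using h(1) by (auto simp: bij_betw_def)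
      then have "u x = Some (g i)" "g i \<in> A" using gh by (auto simp: u)
      then show "(minv u \<circ>\<^sub>m (pid A \<circ>\<^sub>m u)) x = Some y"
        using \<open>x = y\<close> by (simp add: map_comp_Some_iff minv_Some[OF inj])
    qed
    then show ?thesis by (metis not_Some_eq ext)
  qed
  then have "\<phi> (pid B) = \<phi> (minv u) \<circ>\<^sub>m (\<phi> (pid A) \<circ>\<^sub>m \<phi> u)"
    using hom[OF uS pidS[OF assms(1)]] hom[OF PORX_comp[OF uS pidS[OF assms(1)]] vS] by simp
  also have "\<dots> = f" using assms(4) zero[OF uS] zero[OF vS] by simp
  finally show ?thesis .
qed

lemma dichotomy:
  assumes "\<phi> \<notin> typeC b n"
  shows "\<exists>c. (\<forall>l\<in>{1..n}. \<phi> (pid (cell c n l)) \<noteq> f) \<and> (\<forall>A. A \<subseteq> {1..n} \<longrightarrow> card A < crank c n \<longrightarrow> \<phi> (pid A) = f)"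
proof -
  let ?P = "\<lambda>k. \<exists>A. A \<subseteq> {1..n} \<and> card A = k \<and> \<phi> (pid A) \<noteq> f"
  obtain A0 where A0: "A0 \<subset> {1..n}" "\<phi> (pid A0) \<noteq> f" using assms \<phi> by (auto simp: typeC_def)
  define k where "k = (LEAST k. ?P k)"
  have Pk: "?P k" unfolding k_def by (rule LeastI[of ?P "card A0"]) (use A0 in auto)
  have low: "\<phi> (pid A) = f" if "A \<subseteq> {1..n}" "card A < k" for A
    using not_less_Least[of "card A" ?P] that unfolding k_def by blast
  have "k \<le> card A0" unfolding k_def by (rule Least_le) (use A0 in auto)
  moreover have "card A0 < n" using psubset_card_mono[OF _ A0(1)] by simp
  ultimately have kn: "k < n" by simp
  obtain A1 where A1: "A1 \<subseteq> {1..n}" "card A1 = k" "\<phi> (pid A1) \<noteq> f" using Pk by blast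
  have k0: "k \<noteq> 0"
  proof
    assume "k = 0"
    then have "A1 = {}" using A1 finite_subset by fastforce
    then show False using A1 by simp
  qed
  have all: "\<phi> (pid A) \<noteq> f" if "A \<subseteq> {1..n}" "card A = k" for A using same_card[OF that(1) A1(1)] that A1 by auto
  define F where "F = {A. A \<subseteq> {1..n} \<and> card A = k}"
  define p where "p A = (SOME x. x \<in> ran (\<phi> (pid A)) - ran f)" for A
  have p: "p A \<in> ran (\<phi> (pid A)) - ran f" if "A \<in> F" for A
    unfolding p_def by (rule someI_ex) (use new_point all that in \<open>auto simp: F_def\<close>)
  \<comment> \<open>Distinct \<open>k\<close>-sets meet in fewer than \<open>k\<close> points, so by
    minimality the product of their images is \<open>f\<close>; a common fixed point would therefore
    lie in \<open>ran f\<close>.\<close>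
  have "inj_on p F"
  proof
    fix A B assume AB: "A \<in> F" "B \<in> F" "p A = p B"
    show "A = B"
    proof (rule ccontr)
      assume "A \<noteq> B"
      have fin: "finite A" "finite B" using AB finite_subset by (auto simp: F_def)
      have "card (A \<inter> B) < k"
      proof -
        have "A \<inter> B \<subset> A" using \<open>A \<noteq> B\<close> AB fin card_subset_eq[of B A] by (auto simp: F_def)
        then show ?thesis using psubset_card_mono[OF fin(1)] AB by (auto simp: F_def)
      qed
      moreover have "A \<inter> B \<subseteq> {1..n}" using AB by (auto simp: F_def)
      ultimately have "\<phi> (pid (A \<inter> B)) = f" using low by blast
      then show False using ran_meet[of A B "p A"] p[OF AB(1)] p[OF AB(2)] AB by (auto simp: F_def)
    qed
  qed
  moreover have "p ` F \<subseteq> {1..n}"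
  proof -
    have "ran (\<phi> (pid A)) \<subseteq> {1..n}" if "A \<in> F" for A
      using closed[OF pidS, of A] that by (auto simp: F_def PORX_def partial_transformation_def)
    then show ?thesis using p by blast
  qed
  ultimately have "card F \<le> card {1..n}" by (intro card_inj_on_le) auto
  moreover have "card F = n choose k" unfolding F_def using n_subsets[of "{1..n}" k] by simp
  ultimately have "n choose k \<le> n" by simp
  then have "k = 1 \<or> k = n - 1" using choose_gt[of k n] k0 kn by linarith
  then obtain c where c: "crank c n = k" unfolding crank_def by (metis (full_types))
  show ?thesis
  proof (intro exI[of _ c] conjI ballI allI impI)
    fix l assume "l \<in> {1..n}"
    then show "\<phi> (pid (cell c n l)) \<noteq> f" using all[of "cell c n l"] cell_basic[of l n c] c by auto
  qed (use low c in auto)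
qed

text \<open>The new points of the \<open>n\<close> cells form a permutation \<sigma>, so nothing is
  left for the range of \<open>f\<close>, and the images of the cells are the identities on single
  points. Sandwiching \<open>\<phi> \<alpha>\<close> between two of these reads off its values: it
  takes \<open>\<sigma> l\<close> to \<open>\<sigma> j\<close> exactly when \<alpha> maps cell
  \<open>l\<close> onto cell \<open>j\<close>.\<close>

lemma eq_cell_conj:
  assumes "\<phi> \<notin> typeC b n"
  shows "\<exists>c s. s \<in> perms_of n \<and> \<phi> = cell_conj c b n s"
proof -
  obtain c where c: "\<And>l. l \<in> {1..n} \<Longrightarrow> \<phi> (pid (cell c n l)) \<noteq> f"
    and low: "\<And>A. A \<subseteq> {1..n} \<Longrightarrow> card A < crank c n \<Longrightarrow> \<phi> (pid A) = f"
    using dichotomy[OF assms] by blast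
  define e where "e l = \<phi> (pid (cell c n l))" for l
  note cb = cell_basic[of _ n c]
  have eS: "e l \<in> PORX b n" if "l \<in> {1..n}" for l unfolding e_def using closed pidS cb that by auto
  have ee: "e l \<circ>\<^sub>m e j = f" if "l \<in> {1..n}" "j \<in> {1..n}" "l \<noteq> j" for l j
  proof -
    have "cell c n l \<inter> cell c n j \<subset> cell c n l"
      using cell_inj[OF that(1,2), of c] that(3) cb[OF that(1)] cb[OF that(2)] card_subset_eq[of "cell c n j" "cell c n l"] by auto
    then have "card (cell c n l \<inter> cell c n j) < crank c n"
      using psubset_card_mono cb that by metis
    moreover have "cell c n l \<inter> cell c n j \<subseteq> {1..n}" using cb[OF that(1)] by auto
    ultimately have "\<phi> (pid (cell c n l \<inter> cell c n j)) = f" using low by blast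
    then show ?thesis unfolding e_def using meet[of "cell c n l" "cell c n j"] cb that by auto
  qed
  define \<sigma> where "\<sigma> l = (SOME x. x \<in> ran (e l) - ran f)" for l
  have \<sigma>: "\<sigma> l \<in> ran (e l) - ran f" if "l \<in> {1..n}" for l
    unfolding \<sigma>_def e_def by (rule someI_ex) (use new_point[of "cell c n l"] c cb that in auto)
  have fixe: "e l x = Some x" if "l \<in> {1..n}" "x \<in> ran (e l)" for l x
    using idem_fix[OF idem] cb that unfolding e_def by blast
  have disj: "l = j" if "l \<in> {1..n}" "j \<in> {1..n}" "x \<in> ran (e l)" "x \<in> ran (e j)" "x \<notin> ran f" for l j x
  proof (rule ccontr)
    assume "l \<noteq> j"
    then have "f = e l \<circ>\<^sub>m e j" using ee that by simp
    moreover have "(e l \<circ>\<^sub>m e j) x = Some x" using fixe that by (simp add: map_comp_Some_iff)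
    ultimately show False using that(5) by (auto simp: ran_def)
  qed
  have "inj_on \<sigma> {1..n}"
  proof (rule inj_onI)
    fix l j assume "l \<in> {1..n}" "j \<in> {1..n}" "\<sigma> l = \<sigma> j"
    then show "l = j" using disj[of l j "\<sigma> l"] \<sigma>[of l] \<sigma>[of j] by simp
  qed
  moreover have "\<sigma> ` {1..n} \<subseteq> {1..n}"
  proof -
    have "ran (e l) \<subseteq> {1..n}" if "l \<in> {1..n}" for l using eS[OF that] by (auto simp: PORX_def partial_transformation_def)
    then show ?thesis using \<sigma> by blast
  qed
  ultimately have bij: "bij_betw \<sigma> {1..n} {1..n}" by (simp add: bij_betw_def card_image card_subset_eq endo_inj_surj)
  have "ran f \<subseteq> {1..n}" using closed[OF pidS, of "{}"] by (auto simp: PORX_def partial_transformation_def)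
  moreover have "x \<notin> ran f" if "x \<in> {1..n}" for x
  proof -
    obtain l where "l \<in> {1..n}" "x = \<sigma> l" using bij \<open>x \<in> {1..n}\<close> unfolding bij_betw_def by blast
    then show ?thesis using \<sigma>[of l] by simp
  qed
  ultimately have "ran f = {}" by blast
  then have "f x = None" for x by (metis empty_iff not_None_eq ranI)
  then have f0: "f = pid {}" by (intro ext) simp
  have surj: "\<exists>l\<in>{1..n}. x = \<sigma> l" if "x \<in> {1..n}" for x using bij that by (auto simp: bij_betw_def)
  have \<sigma>e: "\<sigma> l \<in> ran (e l)" if "l \<in> {1..n}" for l using \<sigma>[OF that] by auto
  \<comment> \<open>A further point in the domain would be some \<open>\<sigma> i\<close>, and the
    product of the two different cells would then be nonempty although it equals
    \<open>f\<close>.\<close>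
  have e: "e l = pid {\<sigma> l}" if l: "l \<in> {1..n}" for l
  proof -
    have "e l x = Some y \<longleftrightarrow> x = \<sigma> l \<and> y = \<sigma> l" for x y
    proof
      assume a: "e l x = Some y"
      then have xy: "x \<in> {1..n}" "y \<in> {1..n}" using eS[OF l] pt_val[OF PORX_pt] by auto
      then obtain i j where ij: "i \<in> {1..n}" "j \<in> {1..n}" "x = \<sigma> i" "y = \<sigma> j" using surj by metis
      have "y \<in> ran (e l)" using a by (auto simp: ran_def)
      then have "j = l" using disj[OF ij(2) l] \<sigma>e[OF ij(2)] ij(4) \<open>ran f = {}\<close> by auto
      moreover have "i = l"
      proof (rule ccontr)
        assume "i \<noteq> l"
        then have "e l \<circ>\<^sub>m e i = f" using ee l ij by auto
        moreover have "(e l \<circ>\<^sub>m e i) x = Some y"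
          using fixe[OF ij(1) \<sigma>e[OF ij(1)]] a ij(3) by (simp add: map_comp_Some_iff)
        ultimately show False using f0 by simp
      qed
      ultimately show "x = \<sigma> l \<and> y = \<sigma> l" using ij by simp
    next
      assume "x = \<sigma> l \<and> y = \<sigma> l"
      then show "e l x = Some y" using fixe[OF l \<sigma>e[OF l]] by simp
    qed
    then show ?thesis by (intro ext) (metis not_Some_eq pid_Some singleton_iff)
  qed
  define s where "s = (\<lambda>l. if l \<in> {1..n} then Some (\<sigma> l) else None)"
  have s: "s l = Some y \<longleftrightarrow> l \<in> {1..n} \<and> y = \<sigma> l" for l y by (auto simp: s_def)
  have sp: "s \<in> perms_of n"
  proof -
    have "dom s = {1..n}" by (auto simp: s_def dom_def)
    moreover have "ran s = \<sigma> ` {1..n}" by (auto simp: ran_def s simp del: atLeastAtMost_iff)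
    moreover have "\<sigma> x = \<sigma> y \<Longrightarrow> x = y" if "x \<in> {1..n}" "y \<in> {1..n}" for x y
      using bij that unfolding bij_betw_def inj_on_def by blast
    then have "inj_on s (dom s)" unfolding inj_on_iff s by blast
    ultimately show ?thesis using bij by (simp add: perms_of_def bij_betw_def)
  qed
  have key: "\<phi> \<alpha> (\<sigma> l) = Some (\<sigma> j) \<longleftrightarrow> cell_map c n \<alpha> l = Some j"
    if \<alpha>: "\<alpha> \<in> PORX b n" and l: "l \<in> {1..n}" and j: "j \<in> {1..n}" for \<alpha> l j
  proof
    assume a: "\<phi> \<alpha> (\<sigma> l) = Some (\<sigma> j)"
    \<comment> \<open>Compression of \<alpha> to the two cells. A range smaller than a cell would
      make it factor through a collapsed partial identity, so its image would be empty, contrary to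
      the assumed value.\<close>
    let ?\<beta> = "pid (cell c n j) \<circ>\<^sub>m (\<alpha> \<circ>\<^sub>m pid (cell c n l))"
    have pl: "pid (cell c n l) \<in> PORX b n" and pj: "pid (cell c n j) \<in> PORX b n" using pidS cb l j by auto
    have \<beta>S: "?\<beta> \<in> PORX b n" using PORX_comp pl pj \<alpha> by blast
    have "\<phi> ?\<beta> = e j \<circ>\<^sub>m (\<phi> \<alpha> \<circ>\<^sub>m e l)"
      using hom[OF PORX_comp[OF pl \<alpha>] pj] hom[OF pl \<alpha>] by (simp add: e_def)
    then have ne: "\<phi> ?\<beta> \<noteq> f" using a e[OF l] e[OF j] f0
      by (metis (no_types, lifting) empty_iff map_comp_simps(2) pid_Some singleton_iff)
    let ?R = "img \<alpha> (cell c n l) \<inter> cell c n j"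
    have R: "ran ?\<beta> = ?R" by (auto simp: ran_def img_def map_comp_Some_iff)
    have "\<not> card ?R < crank c n"
    proof
      assume "card ?R < crank c n"
      moreover have Rn: "?R \<subseteq> {1..n}" using cb[OF j] by auto
      ultimately have "\<phi> (pid ?R) = f" using low by blast
      moreover have "pid ?R \<circ>\<^sub>m ?\<beta> = ?\<beta>" by (rule pid_comp_id) (simp only: R subset_refl)
      then have "\<phi> ?\<beta> = \<phi> (pid ?R) \<circ>\<^sub>m \<phi> ?\<beta>" using hom[OF \<beta>S pidS[OF Rn]] by simp
      ultimately show False using ne zero(2)[OF \<beta>S] by simp
    qed
    moreover have "card (img \<alpha> (cell c n l)) \<le> crank c n" "finite (img \<alpha> (cell c n l))"
      using card_img[OF cb(3)[OF l]] cb[OF l] by (auto simp: img_image)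
    moreover have "card (cell c n j) = crank c n" "finite (cell c n j)" using cb[OF j] by auto
    ultimately have "card (img \<alpha> (cell c n l)) \<le> card ?R" "card (cell c n j) \<le> card ?R"
      "finite (img \<alpha> (cell c n l))" "finite (cell c n j)" by linarith+
    then have "?R = img \<alpha> (cell c n l)" "?R = cell c n j"
      using card_seteq[of "img \<alpha> (cell c n l)" ?R] card_seteq[of "cell c n j" ?R] by blast+
    then show "cell_map c n \<alpha> l = Some j" using l j by (simp add: cell_map_Some)
  next
    assume "cell_map c n \<alpha> l = Some j"
    then have imj: "img \<alpha> (cell c n l) = cell c n j" by (simp add: cell_map_Some)
    \<comment> \<open>On the cell \<alpha> is injective, so this restriction has an inverse in the
      monoid and its image cannot lose the point \<open>\<sigma> l\<close>.\<close>
    let ?\<beta> = "\<alpha> \<circ>\<^sub>m pid (cell c n l)"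
    have pl: "pid (cell c n l) \<in> PORX b n" and pj: "pid (cell c n j) \<in> PORX b n" using pidS cb l j by auto
    have \<beta>S: "?\<beta> \<in> PORX b n" using PORX_comp pl \<alpha> by blast
    have fr: "cell c n l \<subseteq> dom \<alpha>" "inj_on \<alpha> (cell c n l)"
      using img_full_rank[OF cb(3)[OF l], of \<alpha>] imj cb(2)[OF l] cb(2)[OF j] by auto
    have dom\<beta>: "dom ?\<beta> = cell c n l" using fr by (auto simp: comp_pid)
    then have inj: "inj_on ?\<beta> (dom ?\<beta>)" using fr by (auto simp: comp_pid inj_on_def)
    have vS: "minv ?\<beta> \<in> PORX b n" by (rule PORX_True[OF minv_PORX[OF \<beta>S inj]])
    have "minv ?\<beta> \<circ>\<^sub>m ?\<beta> = pid (cell c n l)"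
      using minv_comp[OF inj] dom\<beta> by simp
    then have "\<phi> (minv ?\<beta>) \<circ>\<^sub>m \<phi> ?\<beta> = pid {\<sigma> l}" using hom[OF \<beta>S vS] e[OF l] by (simp add: e_def)
    then have "(\<phi> (minv ?\<beta>) \<circ>\<^sub>m \<phi> ?\<beta>) (\<sigma> l) = Some (\<sigma> l)" by simp
    then obtain y where y: "\<phi> ?\<beta> (\<sigma> l) = Some y" by (auto simp: map_comp_Some_iff)
    have "pid (cell c n j) \<circ>\<^sub>m ?\<beta> = ?\<beta>"
      by (rule pid_comp_id) (use imj in \<open>auto simp: ran_def img_def map_comp_Some_iff\<close>)
    then have "pid {\<sigma> j} \<circ>\<^sub>m \<phi> ?\<beta> = \<phi> ?\<beta>" using hom[OF \<beta>S pj] e[OF j] by (simp add: e_def)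
    then have "(pid {\<sigma> j} \<circ>\<^sub>m \<phi> ?\<beta>) (\<sigma> l) = Some y" using y by simp
    then have "y = \<sigma> j" using y by (auto simp: map_comp_Some_iff)
    moreover have "\<phi> ?\<beta> = \<phi> \<alpha> \<circ>\<^sub>m pid {\<sigma> l}" using hom[OF pl \<alpha>] e[OF l] by (simp add: e_def)
    ultimately show "\<phi> \<alpha> (\<sigma> l) = Some (\<sigma> j)" using y by (simp add: comp_pid)
  qed
  have "\<phi> \<alpha> = cell_conj c b n s \<alpha>" for \<alpha>
  proof (cases "\<alpha> \<in> PORX b n")
    case True
    have "\<phi> \<alpha> x = Some y \<longleftrightarrow> (s \<circ>\<^sub>m (cell_map c n \<alpha> \<circ>\<^sub>m minv s)) x = Some y" for x y
    proof
      assume a: "\<phi> \<alpha> x = Some y"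
      then have "x \<in> {1..n}" "y \<in> {1..n}" using pt_val[OF PORX_pt[OF closed[OF True]]] by auto
      then obtain l j where lj: "l \<in> {1..n}" "j \<in> {1..n}" "x = \<sigma> l" "y = \<sigma> j" using surj by metis
      then show "(s \<circ>\<^sub>m (cell_map c n \<alpha> \<circ>\<^sub>m minv s)) x = Some y"
        using key[OF True lj(1,2)] a by (auto simp: map_comp_Some_iff perms_minv(6)[OF sp] s)
    next
      assume "(s \<circ>\<^sub>m (cell_map c n \<alpha> \<circ>\<^sub>m minv s)) x = Some y"
      then obtain l j where "l \<in> {1..n}" "j \<in> {1..n}" "x = \<sigma> l" "y = \<sigma> j" "cell_map c n \<alpha> l = Some j"
        by (auto simp: map_comp_Some_iff perms_minv(6)[OF sp] s)
      then show "\<phi> \<alpha> x = Some y" using key[OF True] by auto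
    qed
    then have "\<phi> \<alpha> = s \<circ>\<^sub>m (cell_map c n \<alpha> \<circ>\<^sub>m minv s)" by (metis not_Some_eq ext)
    then show ?thesis using True by (simp add: cell_conj_def)
  next
    case False
    then show ?thesis using \<phi> by (auto simp: cell_conj_def Endo_def extensional_def)
  qed
  then show ?thesis using sp by blast
qed

end

section \<open>Endomorphisms induced by affine permutations\<close>

text \<open>The holomorph of the cyclic group of order \<open>n\<close>, that is, the normalizer of
  the group of rotations among all permutations. This is why it occurs as the set of admissible
  conjugators.\<close>

definition Hol :: "nat \<Rightarrow> (nat \<rightharpoonup> nat) set" where
  "Hol n = {aff n u v | u v. coprime u (int n)}"

definition Dih :: "nat \<Rightarrow> (nat \<rightharpoonup> nat) set" where
  "Dih n = {aff n a t | a t. a = 1 \<or> a = -1}"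

lemma map_eqI: "(\<And>x y. \<alpha> x = Some y \<longleftrightarrow> \<beta> x = Some y) \<Longrightarrow> \<alpha> = \<beta>"
  by (metis not_Some_eq ext)

lemma coprime_inverse:
  assumes "coprime u (int n)" shows "\<exists>u'. int n dvd u * u' - 1"
proof -
  obtain u' where "[u * u' = 1] (mod int n)" using cong_solve_coprime_int[OF assms] by blast
  then show ?thesis by (auto simp: cong_iff_dvd_diff)
qed

lemma perms_ofI:
  assumes "dom s = {1..n}" "ran s \<subseteq> {1..n}" "inj_on s (dom s)" shows "s \<in> perms_of n"
proof -
  have "ran s = (\<lambda>x. the (s x)) ` dom s" by (force simp: ran_def)
  moreover have "inj_on (\<lambda>x. the (s x)) (dom s)" using assms(3) unfolding inj_on_def dom_def by force
  ultimately have "card (ran s) = n" using assms(1) by (simp add: card_image)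
  then have "ran s = {1..n}" using assms(2) by (simp add: card_subset_eq)
  then show ?thesis using assms by (simp add: perms_of_def)
qed

lemma aff_perms: "int n dvd u * u' - 1 \<Longrightarrow> aff n u v \<in> perms_of n"
  using pt_aff[of n u v] aff_inj[of n u u' v] by (intro perms_ofI) (simp_all add: partial_transformation_def)

lemma Hol_perms: "s \<in> Hol n \<Longrightarrow> s \<in> perms_of n"
  using aff_perms coprime_inverse unfolding Hol_def by blast

lemma Dih_Hol: "s \<in> Dih n \<Longrightarrow> s \<in> Hol n"
  unfolding Dih_def Hol_def by auto

lemma Dih_PORX: "s \<in> Dih n \<Longrightarrow> s \<in> PORX b n"
  unfolding Dih_def using aff_PORX by blast

lemma PORX_perms_Dih: "\<alpha> \<in> PORX b n \<Longrightarrow> \<alpha> \<in> perms_of n \<Longrightarrow> \<alpha> \<in> Dih n"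
  using PORX_unit[of \<alpha> b n] unfolding Dih_def perms_of_def by blast

lemma minv_aff:
  assumes "n \<ge> 1" "int n dvd u * u' - 1"
  shows "minv (aff n u v) = aff n u' (- (u' * v))"
proof -
  let ?s = "aff n u v" and ?r = "aff n u' (- (u' * v))"
  have p: "?s \<in> perms_of n" by (rule aff_perms[OF assms(2)])
  have "?r \<circ>\<^sub>m ?s = aff n (u' * u) 0" by (simp add: aff_comp)
  also have "\<dots> = pid {1..n}"
    unfolding aff_1_0[symmetric] aff_eq_iff[OF assms(1)] using assms(2) by (simp add: mult.commute)
  finally have "(?r \<circ>\<^sub>m ?s) \<circ>\<^sub>m minv ?s = pid {1..n} \<circ>\<^sub>m minv ?s" by simp
  moreover have "pid {1..n} \<circ>\<^sub>m minv ?s = minv ?s"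
    using perms_minv(3)[OF p] by (intro pid_comp_id) (simp add: perms_of_def)
  moreover have "?r \<circ>\<^sub>m pid {1..n} = ?r" by (rule comp_pid_id) simp
  ultimately show ?thesis using perms_minv(2)[OF p] by (simp add: map_comp_assoc)
qed

text \<open>If the composite maps a cell onto a cell, the intermediate image cannot have fewer
  points than a cell, nor can it have more. Sets of that size are cells, so the intermediate index
  exists.\<close>

lemma cell_map_comp:
  assumes n: "3 \<le> n" and pt: "partial_transformation n \<alpha>"
  shows "cell_map c n (\<beta> \<circ>\<^sub>m \<alpha>) = cell_map c n \<beta> \<circ>\<^sub>m cell_map c n \<alpha>"
proof (rule map_eqI)
  fix l j
  show "cell_map c n (\<beta> \<circ>\<^sub>m \<alpha>) l = Some j \<longleftrightarrow> (cell_map c n \<beta> \<circ>\<^sub>m cell_map c n \<alpha>) l = Some j"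
  proof
    assume "cell_map c n (\<beta> \<circ>\<^sub>m \<alpha>) l = Some j"
    then have h: "l \<in> {1..n}" "j \<in> {1..n}" "img \<beta> (img \<alpha> (cell c n l)) = cell c n j" by (auto simp: cell_map_Some img_comp)
    let ?I = "img \<alpha> (cell c n l)"
    have "finite ?I" using cell_basic(3)[OF h(1), of c] by (simp add: img_image)
    then have "card (cell c n j) \<le> card ?I" using card_img[of ?I \<beta>] h(3) by simp
    moreover have "card ?I \<le> card (cell c n l)" using card_img cell_basic(3)[OF h(1)] by blast
    ultimately have "card ?I = crank c n" using cell_basic(2) h(1,2) by simp
    moreover have "?I \<subseteq> {1..n}" using pt by (auto simp: img_def partial_transformation_def ran_def)
    ultimately obtain i where i: "i \<in> {1..n}" "?I = cell c n i" using cell_surj n by blast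
    then show "(cell_map c n \<beta> \<circ>\<^sub>m cell_map c n \<alpha>) l = Some j" using h by (auto simp: map_comp_Some_iff cell_map_Some)
  next
    assume "(cell_map c n \<beta> \<circ>\<^sub>m cell_map c n \<alpha>) l = Some j"
    then show "cell_map c n (\<beta> \<circ>\<^sub>m \<alpha>) l = Some j" by (auto simp: map_comp_Some_iff cell_map_Some img_comp)
  qed
qed

lemma pt_cell_map: "partial_transformation n (cell_map c n \<alpha>)"
  unfolding partial_transformation_def by (auto simp: dom_def ran_def cell_map_Some)

lemma cell_map_False: "partial_transformation n \<alpha> \<Longrightarrow> cell_map False n \<alpha> = \<alpha>"
  using pt_val[of n \<alpha>] by (intro map_eqI) (auto simp: cell_map_Some cell_def img_def)

lemma cell_map_perm:
  assumes "s \<in> perms_of n" shows "cell_map c n s = s"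
proof (cases c)
  case True
  have i: "\<And>x y a. s x = Some a \<Longrightarrow> s y = Some a \<Longrightarrow> x = y" using assms unfolding perms_of_def inj_on_iff by blast
  have d: "x \<in> {1..n} \<longleftrightarrow> (\<exists>y. s x = Some y)" for x
    using assms unfolding perms_of_def by (metis (mono_tags, lifting) domD domI mem_Collect_eq)
  have r: "y \<in> {1..n} \<longleftrightarrow> (\<exists>x. s x = Some y)" for y
    using assms unfolding perms_of_def ran_def by blast
  have *: "img s ({1..n} - {l}) = {1..n} - {j}" if "s l = Some j" for l j
  proof (rule equalityI; rule subsetI)
    fix y assume "y \<in> img s ({1..n} - {l})"
    then obtain x where "s x = Some y" "x \<noteq> l" by (auto simp: img_def)
    then show "y \<in> {1..n} - {j}" using i[of x y l] r that by blast
  next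
    fix y assume "y \<in> {1..n} - {j}"
    then obtain x where "s x = Some y" "y \<noteq> j" using r by blast
    then have "x \<in> {1..n} - {l}" using d that by auto
    then show "y \<in> img s ({1..n} - {l})" using \<open>s x = Some y\<close> by (auto simp: img_def)
  qed
  show ?thesis
  proof (rule map_eqI)
    fix l j
    show "cell_map c n s l = Some j \<longleftrightarrow> s l = Some j"
    proof
      assume a: "cell_map c n s l = Some j"
      then have "l \<in> {1..n}" by (simp add: cell_map_Some)
      then obtain j' where j': "s l = Some j'" using d by blast
      then have "j' \<in> {1..n}" using r by blast
      then have "cell_map c n s l = Some j'" using *[OF j'] True \<open>l \<in> {1..n}\<close> by (simp add: cell_map_Some cell_def)
      then show "s l = Some j" using a j' by simp
    next
      assume a: "s l = Some j"
      then have "l \<in> {1..n}" "j \<in> {1..n}" using d r by blast+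
      then show "cell_map c n s l = Some j" using *[OF a] True by (simp add: cell_map_Some cell_def)
    qed
  qed
next
  case False
  then show ?thesis using cell_map_False perms_minv(5)[OF assms] by simp
qed

text \<open>Two different missing points would together make the image all of \<open>{1..n}\<close>.
  This is what frees rank \<open>n - 1\<close> from any condition on non-units.\<close>

lemma cell_map_const:
  assumes pt: "partial_transformation n \<alpha>" and "\<alpha> \<notin> perms_of n"
    and "cell_map True n \<alpha> l = Some j" "cell_map True n \<alpha> l' = Some j'"
  shows "j = j'"
proof (rule ccontr)
  assume "j \<noteq> j'"
  have "img \<alpha> ({1..n} - {l}) = {1..n} - {j}" "img \<alpha> ({1..n} - {l'}) = {1..n} - {j'}"
    using assms(3,4) by (simp_all add: cell_map_Some cell_def)
  moreover have "img \<alpha> ({1..n} - {x}) \<subseteq> img \<alpha> {1..n}" for x by (auto simp: img_def)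
  ultimately have "{1..n} - {j} \<subseteq> img \<alpha> {1..n}" "{1..n} - {j'} \<subseteq> img \<alpha> {1..n}" by metis+
  then have "{1..n} \<subseteq> img \<alpha> {1..n}" using \<open>j \<noteq> j'\<close> by auto
  moreover have "finite (img \<alpha> {1..n})" by (simp add: img_image)
  ultimately have c: "card (img \<alpha> {1..n}) \<ge> card {1..n}" by (rule card_mono[rotated])
  have "dom \<alpha> = {1..n}" "ran \<alpha> \<subseteq> {1..n}"
    using img_full_rank(1)[OF _ c] pt by (auto simp: partial_transformation_def)
  then have "\<alpha> \<in> perms_of n" using img_full_rank(2)[OF _ c] by (intro perms_ofI) auto
  then show False using assms by simp
qed

lemma cell_map_inj:
  assumes i: "inj_on \<alpha> (dom \<alpha>)" and pt: "partial_transformation n \<alpha>"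
  shows "inj_on (cell_map c n \<alpha>) (dom (cell_map c n \<alpha>))"
proof (cases c)
  case True
  show ?thesis
    unfolding inj_on_iff
  proof (intro allI impI, rule ccontr)
    fix l l' j assume h: "cell_map c n \<alpha> l = Some j" "cell_map c n \<alpha> l' = Some j" "l \<noteq> l'"
    then have e: "l \<in> {1..n}" "l' \<in> {1..n}" "j \<in> {1..n}" "img \<alpha> ({1..n} - {l}) = {1..n} - {j}" "img \<alpha> ({1..n} - {l'}) = {1..n} - {j}"
      using True by (auto simp: cell_map_Some cell_def)
    have "{1..n} - {l} \<subseteq> dom \<alpha>" using img_full_rank(1)[of "{1..n} - {l}" \<alpha>] e by simp
    then obtain y where y: "\<alpha> l' = Some y" using h(3) e(2) by (metis Diff_iff domD singletonD subsetD)
    then have "y \<in> img \<alpha> ({1..n} - {l})" using e(2) h(3) by (auto simp: img_def)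
    then have "y \<in> img \<alpha> ({1..n} - {l'})" using e by simp
    then obtain x where "x \<noteq> l'" "\<alpha> x = Some y" by (auto simp: img_def)
    then show False using i y unfolding inj_on_iff by blast
  qed
qed (use cell_map_False[OF pt] i in simp)

lemma cell_conj_Endo:
  assumes n: "3 \<le> n" and s: "s \<in> perms_of n"
    and cl: "\<And>\<alpha>. \<alpha> \<in> PORX b n \<Longrightarrow> s \<circ>\<^sub>m (cell_map c n \<alpha> \<circ>\<^sub>m minv s) \<in> PORX b n"
  shows "cell_conj c b n s \<in> Endo b n"
proof -
  have "s \<circ>\<^sub>m (cell_map c n (\<beta> \<circ>\<^sub>m \<alpha>) \<circ>\<^sub>m minv s) = (s \<circ>\<^sub>m (cell_map c n \<beta> \<circ>\<^sub>m minv s)) \<circ>\<^sub>m (s \<circ>\<^sub>m (cell_map c n \<alpha> \<circ>\<^sub>m minv s))"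
    if "\<alpha> \<in> PORX b n" "\<beta> \<in> PORX b n" for \<alpha> \<beta>
  proof -
    have "minv s \<circ>\<^sub>m (s \<circ>\<^sub>m (cell_map c n \<alpha> \<circ>\<^sub>m minv s)) = (minv s \<circ>\<^sub>m s) \<circ>\<^sub>m (cell_map c n \<alpha> \<circ>\<^sub>m minv s)"
      by (simp only: map_comp_assoc)
    also have "\<dots> = cell_map c n \<alpha> \<circ>\<^sub>m minv s"
      unfolding perms_minv(1)[OF s] by (rule pid_comp_id) (auto simp: ran_def map_comp_Some_iff cell_map_Some)
    finally show ?thesis using cell_map_comp[OF n PORX_pt[OF that(1)], of c \<beta>] by (simp add: map_comp_assoc)
  qed
  then show ?thesis using cl PORX_comp by (auto simp: Endo_def cell_conj_def)
qed

lemma Dih_minv: "n \<ge> 1 \<Longrightarrow> s \<in> Dih n \<Longrightarrow> minv s \<in> Dih n"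
proof -
  assume n: "n \<ge> 1" and "s \<in> Dih n"
  then obtain a t where "a = 1 \<or> a = -1" "s = aff n a t" by (auto simp: Dih_def)
  then have "minv s = aff n a (- (a * t))" using minv_aff[OF n, of a a t] by auto
  then show "minv s \<in> Dih n" using \<open>a = 1 \<or> a = -1\<close> unfolding Dih_def by blast
qed

lemma cell_conj_Dih: "3 \<le> n \<Longrightarrow> s \<in> Dih n \<Longrightarrow> cell_conj False b n s \<in> Endo b n"
proof (rule cell_conj_Endo)
  fix \<alpha> assume "3 \<le> n" "s \<in> Dih n" "\<alpha> \<in> PORX b n"
  then show "s \<circ>\<^sub>m (cell_map False n \<alpha> \<circ>\<^sub>m minv s) \<in> PORX b n"
    using PORX_comp Dih_PORX Dih_minv[of n s] by (simp add: cell_map_False PORX_pt)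
qed (auto intro: Hol_perms Dih_Hol)

lemma conj_aff:
  assumes "n \<ge> 1" "int n dvd u * u' - 1"
  shows "aff n u v \<circ>\<^sub>m (aff n a t \<circ>\<^sub>m minv (aff n u v)) = aff n a (u * t + v - a * v)"
  unfolding minv_aff[OF assms] aff_comp aff_eq_iff[OF assms(1)]
proof
  have "int n dvd a * (u * u' - 1)" using assms(2) by simp
  then show "int n dvd u * (a * u') - a" by (simp add: algebra_simps)
  have "int n dvd - (a * v) * (u * u' - 1)" using assms(2) by simp
  then show "int n dvd u * (a * - (u' * v) + t) + v - (u * t + v - a * v)" by (simp add: algebra_simps)
qed

text \<open>A unit is conjugated to an affine map with the same multiplier, hence again to a
  dihedral element. A non-unit acts on missing points with at most one value, and any partial map
  with at most one value is oriented; injectivity is inherited separately.\<close>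

lemma cell_conj_Hol:
  assumes n: "3 \<le> n" and s: "s \<in> Hol n" shows "cell_conj True b n s \<in> Endo b n"
proof (rule cell_conj_Endo[OF n Hol_perms[OF s]])
  fix \<alpha> assume \<alpha>: "\<alpha> \<in> PORX b n"
  let ?r = "s \<circ>\<^sub>m (cell_map True n \<alpha> \<circ>\<^sub>m minv s)"
  note sp = Hol_perms[OF s]
  show "?r \<in> PORX b n"
  proof (cases "\<alpha> \<in> perms_of n")
    case True
    obtain a t where a: "a = 1 \<or> a = -1" "\<alpha> = aff n a t" using PORX_perms_Dih[OF \<alpha> True] by (auto simp: Dih_def)
    obtain u v where u: "coprime u (int n)" "s = aff n u v" using s by (auto simp: Hol_def)
    obtain u' where "int n dvd u * u' - 1" using coprime_inverse[OF u(1)] by blast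
    then have "?r = aff n a (u * t + v - a * v)"
      using cell_map_perm[OF True] conj_aff[of n u u'] n a(2) u(2) by simp
    then show ?thesis using aff_PORX a(1) by simp
  next
    case False
    have val: "\<exists>l j. cell_map True n \<alpha> l = Some j \<and> s l = Some x \<and> s j = Some y" if "?r x = Some y" for x y
      using that by (auto simp: map_comp_Some_iff perms_minv(6)[OF sp])
    have i: "\<And>x y a. s x = Some a \<Longrightarrow> s y = Some a \<Longrightarrow> x = y" using sp unfolding perms_of_def inj_on_iff by blast
    show ?thesis
    proof (rule const_PORX)
      show "partial_transformation n ?r"
        using pt_comp pt_cell_map perms_minv(5)[OF sp] perms_minv(5)[OF perms_minv(3)[OF sp]] by blast
      show "a = c" if "?r x = Some a" "?r y = Some c" for x y a c
        using val[OF that(1)] val[OF that(2)] cell_map_const[OF PORX_pt[OF \<alpha>] False] by (metis option.inject)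
      assume b
      then have mi: "inj_on (cell_map True n \<alpha>) (dom (cell_map True n \<alpha>))" using cell_map_inj \<alpha> by (auto simp: PORX_def)
      show "inj_on ?r (dom ?r)"
        unfolding inj_on_iff
      proof (intro allI impI)
        fix x y a assume xa: "?r x = Some a" and ya: "?r y = Some a"
        obtain l j where 1: "cell_map True n \<alpha> l = Some j" "s l = Some x" "s j = Some a" using val[OF xa] by blast
        obtain l' j' where 2: "cell_map True n \<alpha> l' = Some j'" "s l' = Some y" "s j' = Some a" using val[OF ya] by blast
        have "j = j'" using i 1 2 by blast
        then have "l = l'" using mi 1 2 unfolding inj_on_iff by blast
        then show "x = y" using 1 2 by simp
      qed
    qed
  qed
qed

section \<open>Telling the induced endomorphisms apart\<close>

lemma cell_conj_pid_cell:
  assumes s: "s \<in> perms_of n" and l: "l \<in> {1..n}" "s l = Some y"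
  shows "cell_conj c b n s (pid (cell c n l)) = pid {y}"
proof -
  have "cell_map c n (pid (cell c n l)) = pid {l}"
  proof (rule map_eqI)
    fix i j
    have "cell c n l \<inter> cell c n i = cell c n j \<longleftrightarrow> i = l \<and> j = l" if "i \<in> {1..n}" "j \<in> {1..n}"
    proof
      assume e: "cell c n l \<inter> cell c n i = cell c n j"
      have "cell c n j \<subseteq> cell c n l" "cell c n j \<subseteq> cell c n i" using e by auto
      then have "cell c n j = cell c n l" "cell c n j = cell c n i"
        using cell_basic[of _ n c] that l card_subset_eq by metis+
      then show "i = l \<and> j = l" using cell_inj that l by metis
    qed auto
    then show "cell_map c n (pid (cell c n l)) i = Some j \<longleftrightarrow> pid {l} i = Some j"
      using l by (auto simp: cell_map_Some)
  qed
  moreover have "s \<circ>\<^sub>m (pid {l} \<circ>\<^sub>m minv s) = pid {y}"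
  proof (rule map_eqI)
    fix i j
    have "\<And>x y a. s x = Some a \<Longrightarrow> s y = Some a \<Longrightarrow> x = y" using s unfolding perms_of_def inj_on_iff by blast
    then show "(s \<circ>\<^sub>m (pid {l} \<circ>\<^sub>m minv s)) i = Some j \<longleftrightarrow> pid {y} i = Some j"
      using l by (auto simp: map_comp_Some_iff perms_minv(6)[OF s])
  qed
  moreover have "pid (cell c n l) \<in> PORX b n" using pid_PORX cell_basic(1)[OF l(1)] by blast
  ultimately show ?thesis by (simp add: cell_conj_def)
qed

lemma cell_conj_pid_empty:
  assumes n: "3 \<le> n" shows "cell_conj c b n s (pid {}) = pid {}"
proof -
  have "cell c n j \<noteq> {}" if "j \<in> {1..n}" for j
    using cell_basic(2)[OF that, of c] n by (auto simp: crank_def split: if_splits)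
  then have "cell_map c n (pid {}) = pid {}" by (intro map_eqI) (auto simp: cell_map_Some img_def)
  then have "cell_map c n (pid {}) x = None" for x by simp
  then have "s \<circ>\<^sub>m (cell_map c n (pid {}) \<circ>\<^sub>m minv s) = pid {}"
    by (intro map_eqI) (simp add: map_comp_Some_iff)
  then show ?thesis using pid_PORX[of "{}" n b] by (simp add: cell_conj_def)
qed

text \<open>Separates the two families: a cell of size \<open>n - 1\<close>, at least 2 here, is not
  contained in a singleton, whereas the other family keeps singletons nonempty.\<close>

lemma cell_conj_pid_singleton:
  assumes n: "3 \<le> n" and l: "l \<in> {1..n}" shows "cell_conj True b n s (pid {l}) = pid {}"
proof -
  have "\<not> img (pid {l}) (cell True n i) = cell True n j" if "j \<in> {1..n}" for i j
  proof
    assume "img (pid {l}) (cell True n i) = cell True n j"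
    then have "card (cell True n j) \<le> card {l}" by (metis card_mono finite.emptyI finite_insert img_pid inf_le1)
    then show False using cell_basic(2)[OF that, of True] n by (simp add: crank_def)
  qed
  then have "cell_map True n (pid {l}) = pid {}" by (intro map_eqI) (auto simp: cell_map_Some)
  then have "cell_map True n (pid {l}) x = None" for x by simp
  then have "s \<circ>\<^sub>m (cell_map True n (pid {l}) \<circ>\<^sub>m minv s) = pid {}"
    by (intro map_eqI) (simp add: map_comp_Some_iff)
  then show ?thesis using pid_PORX[of "{l}" n b] l by (simp add: cell_conj_def)
qed

lemma perms_apply: "s \<in> perms_of n \<Longrightarrow> l \<in> {1..n} \<Longrightarrow> \<exists>y. s l = Some y"
  by (metis (mono_tags, lifting) domD mem_Collect_eq perms_of_def)

text \<open>The value at the partial identity of cell \<open>l\<close> is the identity on the single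
  point \<open>s l\<close>, which recovers \<open>s\<close>.\<close>

lemma cell_conj_inj:
  assumes "s \<in> perms_of n" "s' \<in> perms_of n" "cell_conj c b n s = cell_conj c b n s'" shows "s = s'"
proof
  fix l
  show "s l = s' l"
  proof (cases "l \<in> {1..n}")
    case True
    obtain y y' where y: "s l = Some y" "s' l = Some y'" using perms_apply True assms by metis
    have "pid {y} = pid {y'}"
      using cell_conj_pid_cell[OF assms(1) True y(1), of c b] cell_conj_pid_cell[OF assms(2) True y(2), of c b] assms(3) by simp
    then have "y = y'" by (metis ran_pid singleton_inject)
    then show ?thesis using y by simp
  next
    case False
    then show ?thesis using assms(1,2) unfolding perms_of_def by (metis (mono_tags, lifting) domIff mem_Collect_eq)
  qed
qed

lemma cell_conj_not_typeC:
  assumes n: "3 \<le> n" and s: "s \<in> perms_of n" shows "cell_conj c b n s \<notin> typeC b n"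
proof
  assume t: "cell_conj c b n s \<in> typeC b n"
  have l: "1 \<in> {1..n}" using n by auto
  obtain y where y: "s 1 = Some y" using perms_apply[OF s l] by blast
  have "cell c n 1 \<subset> {1..n}"
    using cell_basic[OF l, of c] n by (metis card_atLeastAtMost crank_def diff_Suc_1 diff_less less_irrefl not_less_eq_eq numeral_3_eq_3 psubsetI zero_less_one add_diff_cancel_right' Suc_eq_plus1 One_nat_def le_eq_less_or_eq less_le_trans zero_less_Suc)
  then have "cell_conj c b n s (pid (cell c n 1)) = cell_conj c b n s (pid {})" using t unfolding typeC_def by blast
  then have "pid {y} = pid {}" using cell_conj_pid_cell[OF s l y] cell_conj_pid_empty[OF n] by metis
  then show False by (metis ran_pid empty_not_insert)
qed

lemma cell_conj_disjoint:
  assumes n: "3 \<le> n" and s: "s \<in> perms_of n" "s' \<in> perms_of n" shows "cell_conj False b n s \<noteq> cell_conj True b n s'"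
proof
  assume e: "cell_conj False b n s = cell_conj True b n s'"
  have l: "1 \<in> {1..n}" using n by auto
  obtain y where y: "s 1 = Some y" using perms_apply[OF s(1) l] by blast
  have "pid {y} = pid {}"
    using cell_conj_pid_cell[OF s(1) l y, of False b] cell_conj_pid_singleton[OF n l, of b s'] e by (simp add: cell_def)
  then show False by (metis ran_pid empty_not_insert)
qed

text \<open>The conjugate of the unit rotation is a dihedral element, and its order rules out a
  reflection. So it is a rotation by some \<open>t\<close>, which says that \<open>s\<close>
  increases by \<open>t\<close> at every step.\<close>

lemma conj_Dih_imp_Hol:
  assumes n: "3 \<le> n" and s: "s \<in> perms_of n" and c: "s \<circ>\<^sub>m (aff n 1 1 \<circ>\<^sub>m minv s) \<in> PORX b n"
  shows "s \<in> Hol n"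
proof -
  have n1: "n \<ge> 1" using n by simp
  let ?x = "aff n 1 1" and ?y = "s \<circ>\<^sub>m (aff n 1 1 \<circ>\<^sub>m minv s)"
  have yx: "?y \<circ>\<^sub>m s = s \<circ>\<^sub>m ?x"
    by (simp add: map_comp_assoc perms_minv(1)[OF s]) (simp add: comp_pid_id)
  have p1: "1 \<in> {1..n}" "n \<in> {1..n}" using n by auto
  have "inj_on ?y (dom ?y)"
    unfolding inj_on_iff
  proof (intro allI impI)
    fix p q r assume h: "?y p = Some r" "?y q = Some r"
    obtain i j where i: "s i = Some p" "?x i = Some j" "s j = Some r" using h(1) by (auto simp: map_comp_Some_iff perms_minv(6)[OF s])
    obtain i' j' where i': "s i' = Some q" "?x i' = Some j'" "s j' = Some r" using h(2) by (auto simp: map_comp_Some_iff perms_minv(6)[OF s])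
    have "j = j'" using s i(3) i'(3) unfolding perms_of_def inj_on_iff by blast
    then have "i = i'" using i(2) i'(2) aff_inj[of n 1 1 1] unfolding inj_on_iff by auto
    then show "p = q" using i i' by simp
  qed
  moreover have "dom ?y = {1..n}"
  proof -
    have "\<exists>r. ?y p = Some r" if p: "p \<in> {1..n}" for p
    proof -
      obtain i where i: "minv s p = Some i" using perms_apply[OF perms_minv(3)[OF s] p] by blast
      then have "i \<in> {1..n}" using pt_val[OF perms_minv(5)[OF perms_minv(3)[OF s]]] by auto
      then obtain j where j: "?x i = Some j" by (auto simp: aff_def)
      then have "j \<in> {1..n}" by (simp add: aff_Some)
      then obtain r where "s j = Some r" using perms_apply[OF s] by blast
      then show ?thesis using i j by (auto simp: map_comp_Some_iff)
    qed
    then show ?thesis using PORX_pt[OF c] by (auto simp: partial_transformation_def)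
  qed
  ultimately obtain a t where a: "a = 1 \<or> a = -1" "?y = aff n a t" using PORX_unit[OF c] by blast
  \<comment> \<open>A reflection is its own inverse, so conjugating back would make the rotation by
    2 trivial.\<close>
  have "a = 1"
  proof (rule ccontr)
    assume "a \<noteq> 1"
    then have "?y \<circ>\<^sub>m ?y = pid {1..n}" using a by (simp add: aff_comp aff_1_0)
    then have "s = ?y \<circ>\<^sub>m (?y \<circ>\<^sub>m s)"
      using pid_comp_id[of s "{1..n}"] s by (simp add: map_comp_assoc[symmetric] perms_of_def)
    also have "\<dots> = s \<circ>\<^sub>m (?x \<circ>\<^sub>m ?x)" using yx by (metis map_comp_assoc)
    finally have e: "s = s \<circ>\<^sub>m aff n 1 2" by (simp add: aff_comp)
    have "minv s \<circ>\<^sub>m s = (minv s \<circ>\<^sub>m s) \<circ>\<^sub>m aff n 1 2" using e by (metis map_comp_assoc)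
    then have "aff n 1 0 = aff n 1 2"
      unfolding perms_minv(1)[OF s] using pid_comp_id[of "aff n 1 2" "{1..n}"] pt_aff[of n 1 2]
      by (simp add: aff_1_0 partial_transformation_def)
    then have "int n dvd 2" using aff_eq_iff[OF n1] by auto
    then show False using n by (auto dest: zdvd_imp_le)
  qed
  then have step: "aff n 1 t \<circ>\<^sub>m s = s \<circ>\<^sub>m ?x" using a yx by simp
  obtain v where v: "s n = Some v" using perms_apply[OF s p1(2)] by blast
  have sx: "\<exists>w. s x = Some w \<and> int n dvd int w - (t * int x + int v)" if "1 \<le> x" "x \<le> n" for x
    using that
  proof (induction x rule: nat_induct_at_least)
    case base
    have "?x n = Some 1" using n by (auto simp: aff_Some)
    then have "(s \<circ>\<^sub>m ?x) n = s 1" by (simp add: map_comp_def)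
    then have "s 1 = aff n 1 t v" using step v by (metis map_comp_simps(2))
    moreover obtain w where "s 1 = Some w" using perms_apply[OF s p1(1)] by blast
    ultimately show ?case by (auto simp: aff_Some algebra_simps)
  next
    case (Suc x)
    then obtain w where w: "s x = Some w" "int n dvd int w - (t * int x + int v)" by auto
    have "?x x = Some (Suc x)" using Suc by (auto simp: aff_Some)
    then have "s (Suc x) = aff n 1 t w" using step w(1) by (metis map_comp_simps(2))
    moreover obtain w' where w': "s (Suc x) = Some w'" using perms_apply[OF s] Suc by fastforce
    ultimately have "aff n 1 t w = Some w'" by simp
    then have "int n dvd int w' - (int w + t)" by (simp add: aff_Some)
    then have "int n dvd (int w' - (int w + t)) + (int w - (t * int x + int v))" using w(2) by (rule dvd_add)
    then show ?case using w' by (auto simp: algebra_simps)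
  qed
  have "s = aff n t (int v)"
  proof
    fix x
    show "s x = aff n t (int v) x"
    proof (cases "x \<in> {1..n}")
      case True
      then obtain w where w: "s x = Some w" "int n dvd int w - (t * int x + int v)" using sx by auto
      then have "w \<in> {1..n}" using pt_val[OF perms_minv(5)[OF s]] by auto
      then have "aff n t (int v) x = Some w" using w True unfolding aff_Some by blast
      then show ?thesis using w by simp
    next
      case False
      have "dom s = {1..n}" using s by (simp add: perms_of_def)
      then show ?thesis using False by (metis dom_aff domIff)
    qed
  qed
  moreover have "coprime t (int n)"
  proof -
    \<comment> \<open>The residue next to \<open>v\<close> is attained by surjectivity, and its
      preimage is an inverse of \<open>t\<close> modulo \<open>n\<close>.\<close>
    have "res n (int v + 1) \<in> ran s" using s res_bounds[OF n1] by (auto simp: perms_of_def)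
    then obtain x where "s x = Some (res n (int v + 1))" by (auto simp: ran_def)
    then have x: "int n dvd int (res n (int v + 1)) - (t * int x + int v)" unfolding \<open>s = _\<close> aff_Some by blast
    have "int n dvd (int (res n (int v + 1)) - (t * int x + int v)) - (int (res n (int v + 1)) - (int v + 1))"
      using x res_dvd[OF n1] by (rule dvd_diff)
    then have "int n dvd 1 - t * int x" by (simp add: algebra_simps)
    then obtain k where "1 - t * int x = int n * k" by (elim dvdE)
    then have k: "1 = t * int x + int n * k" by simp
    show ?thesis
    proof (rule coprimeI)
      fix d assume "d dvd t" "d dvd int n"
      then have "d dvd t * int x + int n * k" by simp
      then show "is_unit d" using k by simp
    qed
  qed
  ultimately show ?thesis by (auto simp: Hol_def)
qed

text \<open>The lift of the mirrored map would have to change sheets between \<open>x\<close> and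
  \<open>y\<close> and again between \<open>y\<close> and \<open>z\<close>, but it may rise only
  once.\<close>

lemma three_fixed_opres:
  assumes pt: "partial_transformation n \<alpha>" and "\<alpha> x = Some x" "\<alpha> y = Some y" "\<alpha> z = Some z" "x < y" "y < z" "oriented \<alpha>"
  shows "opres n \<alpha>"
proof (rule ccontr)
  assume "\<not> opres n \<alpha>"
  then obtain m where m: "lift_of n (mirror n \<alpha>) m" using assms oriented_iff[OF pt] by (auto simp: opres_def)
  have r: "mirror n \<alpha> x = Some (n+1-x)" "mirror n \<alpha> y = Some (n+1-y)" "mirror n \<alpha> z = Some (n+1-z)"
    using assms by (auto simp: mirror_def)
  note s = lift_of_sheets[OF pt_mirror[OF pt] m]
  have l: "1 \<le> x" "z \<le> n" using pt_val[OF pt] assms by auto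
  have "m x \<noteq> m y" using s(3)[OF r(1,2)] assms l by auto
  then have 1: "m x < m y" using s(1)[OF r(1,2)] assms by auto
  have "m y \<noteq> m z" using s(3)[OF r(2,3)] assms l by auto
  then have "m y < m z" using s(1)[OF r(2,3)] assms by auto
  then show False using 1 s(2)[OF r(1,3)] assms by auto
qed

text \<open>Tested on one partial injection that moves a single point to its neighbour and fixes the
  rest of its domain. A multiplier \<open>w\<close> other than 1 and -1 modulo \<open>n\<close>
  carries that point away from its neighbour and past fixed points, which orientation
  forbids.\<close>

lemma Hol_conj_imp_Dih:
  assumes n: "3 \<le> n" and s: "s \<in> Hol n"
    and cl: "\<And>\<alpha>. \<alpha> \<in> PORX True n \<Longrightarrow> s \<circ>\<^sub>m (\<alpha> \<circ>\<^sub>m minv s) \<in> PORX b n"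
  shows "s \<in> Dih n"
proof -
  have n1: "n \<ge> 1" using n by simp
  obtain u v where u: "coprime u (int n)" "s = aff n u v" using s by (auto simp: Hol_def)
  obtain u' where u': "int n dvd u * u' - 1" using coprime_inverse[OF u(1)] by blast
  define w where "w = res n u"
  have w: "1 \<le> w" "w \<le> n" "int n dvd int w - u" using res_bounds[OF n1] res_dvd[OF n1] by (auto simp: w_def)
  have "w = 1 \<or> w = n - 1"
  proof (rule ccontr)
    assume nw: "\<not> ?thesis"
    have "w \<noteq> n"
    proof
      assume "w = n"
      then have "int n dvd u" using w(3) by (metis dvd_diff_right_iff dvd_refl)
      then have "is_unit (int n)" using u(1) by (metis coprime_absorb_right)
      then show False using n by auto
    qed
    then have w2: "2 \<le> w" "w \<le> n - 2" using nw w by linarith+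
    \<comment> \<open>Below 5 the only candidate is multiplier 2 modulo 4, which is not coprime to
      4.\<close>
    have n5: "n \<ge> 5"
    proof (rule ccontr)
      assume "\<not> n \<ge> 5"
      then have "n = 4" "w = 2" using w2 by linarith+
      then have "2 dvd u" using w(3) by presburger
      moreover have "(2::int) dvd int n" using \<open>n = 4\<close> by simp
      ultimately have "is_unit (2::int)" using u(1) coprime_common_divisor by blast
      then show False by simp
    qed
    \<comment> \<open>Undefined at 1, which makes room for sending \<open>n\<close> to its cyclic
      successor 1 injectively.\<close>
    define \<alpha> where "\<alpha> = (\<lambda>x. if x = n then Some 1 else if x \<in> {2..n} then Some x else None)"
    have \<alpha>: "\<alpha> x = Some y \<longleftrightarrow> (x = n \<and> y = 1) \<or> (x \<in> {2..n-1} \<and> y = x)" for x y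
      using n by (auto simp: \<alpha>_def)
    have pt: "partial_transformation n \<alpha>"
      using n by (auto simp: partial_transformation_def dom_def ran_def \<alpha>)
    have "lift_of n \<alpha> (\<lambda>x. if x = n then 1 else 0)"
      unfolding lift_of_def \<alpha> using n by auto
    then have "oriented \<alpha>" using opres_imp_oriented[OF pt] unfolding opres_def by blast
    moreover have "inj_on \<alpha> (dom \<alpha>)" unfolding inj_on_iff \<alpha> using n by auto
    ultimately have "\<alpha> \<in> PORX True n" using pt by (simp add: PORX_def)
    \<comment> \<open>Conjugating by a rotation removes the translation part, so that only the
      multiplier remains.\<close>
    then have "aff n 1 (- v) \<circ>\<^sub>m ((s \<circ>\<^sub>m (\<alpha> \<circ>\<^sub>m minv s)) \<circ>\<^sub>m aff n 1 v) \<in> PORX b n"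
      using cl PORX_comp aff_PORX by metis
    moreover define \<beta> where "\<beta> = aff n 1 (- v) \<circ>\<^sub>m ((s \<circ>\<^sub>m (\<alpha> \<circ>\<^sub>m minv s)) \<circ>\<^sub>m aff n 1 v)"
    ultimately have \<beta>S: "\<beta> \<in> PORX b n" by simp
    have "\<beta> = (aff n 1 (- v) \<circ>\<^sub>m s) \<circ>\<^sub>m (\<alpha> \<circ>\<^sub>m (minv s \<circ>\<^sub>m aff n 1 v))"
      unfolding \<beta>_def by (simp only: map_comp_assoc)
    also have "aff n 1 (- v) \<circ>\<^sub>m s = aff n u 0" unfolding u(2) by (simp add: aff_comp)
    also have "minv s \<circ>\<^sub>m aff n 1 v = aff n u' 0" unfolding u(2) minv_aff[OF n1 u'] by (simp add: aff_comp)
    finally have \<beta>: "\<beta> = aff n u 0 \<circ>\<^sub>m (\<alpha> \<circ>\<^sub>m aff n u' 0)" .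
    have inv1: "aff n u 0 \<circ>\<^sub>m aff n u' 0 = aff n 1 0" using u' by (simp add: aff_comp aff_eq_iff[OF n1])
    have u0n: "aff n u 0 n = Some n" "aff n u' 0 n = Some n" using n1 by (auto simp: aff_Some)
    have u01: "aff n u 0 1 = Some w" using w n1 by (auto simp: aff_Some)
    have fixy: "\<beta> y = Some y" if y: "y \<in> {1..n}" "y \<noteq> n" "y \<noteq> w" for y
    proof -
      have "(aff n u 0 \<circ>\<^sub>m aff n u' 0) y = Some y" using y unfolding inv1 aff_1_0 by simp
      then obtain x where x: "aff n u' 0 y = Some x" "aff n u 0 x = Some y" by (auto simp: map_comp_Some_iff)
      then have "x \<in> {1..n}" by (simp add: aff_Some)
      moreover have "x \<noteq> n" "x \<noteq> 1" using x u0n u01 y by auto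
      ultimately have "\<alpha> x = Some x" unfolding \<alpha> by auto
      then show ?thesis unfolding \<beta> using x by (simp add: map_comp_Some_iff)
    qed
    have \<beta>n: "\<beta> n = Some w" unfolding \<beta> using u0n u01 \<alpha>[of n 1] by (auto simp: map_comp_Some_iff)
    note pt\<beta> = PORX_pt[OF \<beta>S]
    have "\<exists>y. 1 < y \<and> y < n - 1 \<and> y \<noteq> w"
      by (rule exI[of _ "if w = 2 then 3 else 2"]) (use n5 in auto)
    then obtain y where y: "1 < y" "y < n - 1" "y \<noteq> w" by blast
    have f1: "\<beta> 1 = Some 1" and fy: "\<beta> y = Some y" and fn: "\<beta> (n - 1) = Some (n - 1)"
      using fixy[of 1] fixy[of y] fixy[of "n - 1"] y w2 n5 by auto
    \<comment> \<open>With 1, \<open>y\<close> and \<open>n - 1\<close> fixed the map is preserving.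
      Between \<open>n - 1\<close> and \<open>n\<close> its value drops to \<open>w\<close>,
      requiring a new sheet, while \<open>w > 1\<close> forbids a sheet change between 1 and
      \<open>n\<close>.\<close>
    have "opres n \<beta>" using three_fixed_opres[OF pt\<beta> f1 fy fn] y \<beta>S by (auto simp: PORX_def)
    then obtain m where m: "lift_of n \<beta> m" by (auto simp: opres_def)
    note sh = lift_of_sheets[OF pt\<beta> m]
    have "m 1 = m (n - 1)" using sh(4)[OF f1 fn] n5 by fastforce
    moreover have "m (n - 1) \<noteq> m n" using sh(3)[OF fn \<beta>n] w2 by fastforce
    moreover have "m 1 = m n" using sh(4)[OF f1 \<beta>n] w2 n1 by fastforce
    ultimately show False by simp
  qed
  then have "int n dvd int w - 1 \<or> int n dvd int w - (-1)" using n1 by (auto simp: of_nat_diff)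
  then have "int n dvd u - 1 \<or> int n dvd u - (-1)"
  proof
    assume "int n dvd int w - 1"
    then have "int n dvd (int w - 1) - (int w - u)" using w(3) by (rule dvd_diff)
    then show ?thesis by simp
  next
    assume "int n dvd int w - (-1)"
    then have "int n dvd (int w - (-1)) - (int w - u)" using w(3) by (rule dvd_diff)
    then show ?thesis by (simp add: algebra_simps)
  qed
  then have "s = aff n 1 v \<or> s = aff n (-1) v" unfolding u(2) aff_eq_iff[OF n1] by simp
  then show ?thesis by (auto simp: Dih_def)
qed

lemma Endo_decomp:
  assumes n: "3 \<le> n"
  shows "Endo b n = typeC b n \<union> cell_conj False b n ` Dih n \<union> cell_conj True b n ` Hol n" (is "_ = ?R")
proof
  show "?R \<subseteq> Endo b n" using cell_conj_Dih[OF n] cell_conj_Hol[OF n] by (auto simp: typeC_def)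
  show "Endo b n \<subseteq> ?R"
  proof
    fix \<phi> assume \<phi>: "\<phi> \<in> Endo b n"
    interpret endo b n \<phi> using n \<phi> by unfold_locales
    show "\<phi> \<in> ?R"
    proof (cases "\<phi> \<in> typeC b n")
      case False
      then obtain c s where s: "s \<in> perms_of n" "\<phi> = cell_conj c b n s" using eq_cell_conj by blast
      have cl: "s \<circ>\<^sub>m (cell_map c n \<alpha> \<circ>\<^sub>m minv s) \<in> PORX b n" if "\<alpha> \<in> PORX b n" for \<alpha>
        using closed[OF that] that s(2) by (simp add: cell_conj_def)
      have "cell_map c n (aff n 1 1) = aff n 1 1" using cell_map_perm aff_perms[of n 1 1] by simp
      then have H: "s \<in> Hol n" using conj_Dih_imp_Hol[OF n s(1)] cl[OF aff_PORX] by metis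
      show ?thesis
      proof (cases c)
        case True
        then show ?thesis using H s by auto
      next
        case False
        have "s \<in> Dih n"
        proof (rule Hol_conj_imp_Dih[OF n H])
          fix \<alpha> assume "\<alpha> \<in> PORX True n"
          then show "s \<circ>\<^sub>m (\<alpha> \<circ>\<^sub>m minv s) \<in> PORX b n" using cl[OF PORX_True] False cell_map_False PORX_pt by metis
        qed
        then show ?thesis using False s by auto
      qed
    qed auto
  qed
qed

section \<open>Sizes of the two affine groups and the resulting count\<close>

lemma aff_inj_param:
  assumes "n \<ge> 1" "0 \<le> t" "t < int n" "0 \<le> t'" "t' < int n" "0 < u" "u \<le> int n" "0 < u'" "u' \<le> int n" "aff n u t = aff n u' t'"
  shows "u = u'" "t = t'"
proof -
  have d: "int n dvd u - u'" "int n dvd t - t'" using assms aff_eq_iff by blast+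
  show "u = u'"
  proof (rule ccontr)
    assume "u \<noteq> u'"
    then have "\<bar>int n\<bar> \<le> \<bar>u - u'\<bar>" using d(1) by (intro dvd_imp_le_int) auto
    then show False using assms by linarith
  qed
  show "t = t'"
  proof (rule ccontr)
    assume "t \<noteq> t'"
    then have "\<bar>int n\<bar> \<le> \<bar>t - t'\<bar>" using d(2) by (intro dvd_imp_le_int) auto
    then show False using assms by linarith
  qed
qed

lemma card_Hol:
  assumes n: "3 \<le> n" shows "finite (Hol n)" "card (Hol n) = n * totient n"
proof -
  have n1: "n \<ge> 1" using n by simp
  let ?f = "\<lambda>(u, t). aff n (int u) (int t)"
  have "inj_on ?f (totatives n \<times> {0..<n})"
  proof (rule inj_onI, clarify)
    fix u t u' t' assume h: "u \<in> totatives n" "t \<in> {0..<n}" "u' \<in> totatives n" "t' \<in> {0..<n}" "aff n (int u) (int t) = aff n (int u') (int t')"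
    then show "u = u' \<and> t = t'" using aff_inj_param[OF n1, of "int t" "int t'" "int u" "int u'"] by (auto simp: totatives_def)
  qed
  moreover have "Hol n = ?f ` (totatives n \<times> {0..<n})"
  proof
    show "?f ` (totatives n \<times> {0..<n}) \<subseteq> Hol n" by (auto simp: Hol_def totatives_def)
    show "Hol n \<subseteq> ?f ` (totatives n \<times> {0..<n})"
    proof
      fix s assume "s \<in> Hol n"
      then obtain u t where u: "coprime u (int n)" "s = aff n u t" by (auto simp: Hol_def)
      have r: "1 \<le> res n u" "res n u \<le> n" "int n dvd int (res n u) - u" using res_bounds[OF n1] res_dvd[OF n1] by auto
      have "coprime (int (res n u)) (int n)"
      proof -
        have "int (res n u) mod int n = u mod int n" using r(3) by (simp add: mod_eq_dvd_iff)
        then show ?thesis using u(1) by (metis coprime_mod_left_iff n1 of_nat_0_eq_iff not_one_le_zero)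
      qed
      then have "res n u \<in> totatives n" using r by (auto simp: totatives_def)
      moreover have "nat (t mod int n) \<in> {0..<n}" using n1 by (auto simp: nat_less_iff)
      moreover have "s = aff n (int (res n u)) (int (nat (t mod int n)))"
      proof -
        have "int n dvd u - int (res n u)" using r(3) dvd_diff_commute by blast
        then have "s = aff n (int (res n u)) t" unfolding u(2) aff_eq_iff[OF n1] by simp
        then show ?thesis using aff_mod[of n _ t] n1 by simp
      qed
      ultimately show "s \<in> ?f ` (totatives n \<times> {0..<n})" by force
    qed
  qed
  ultimately show "finite (Hol n)" "card (Hol n) = n * totient n"
    by (simp_all add: card_image totient_def mult.commute)
qed

lemma Dih_param:
  assumes "n \<ge> 1" shows "Dih n = (\<lambda>(a, t). aff n a t) ` ({1, -1} \<times> {0..<int n})"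
proof
  show "Dih n \<subseteq> (\<lambda>(a, t). aff n a t) ` ({1, -1} \<times> {0..<int n})"
  proof
    fix s assume "s \<in> Dih n"
    then obtain a t where "a = 1 \<or> a = -1" "s = aff n a t" by (auto simp: Dih_def)
    then have "s = (\<lambda>(a, t). aff n a t) (a, t mod int n)" "(a, t mod int n) \<in> {1, -1} \<times> {0..<int n}"
      using aff_mod[of n a t] assms by auto
    then show "s \<in> (\<lambda>(a, t). aff n a t) ` ({1, -1} \<times> {0..<int n})" by blast
  qed
qed (auto simp: Dih_def)

text \<open>The multipliers 1 and -1 differ by 2, so they are distinct modulo \<open>n\<close> once
  \<open>n\<close> exceeds 2.\<close>

lemma Dih_inj_param:
  assumes "n \<ge> 3" shows "inj_on (\<lambda>(a, t). aff n a t) ({1, -1} \<times> {0..<int n})"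
proof (rule inj_onI, clarify)
  fix a t a' t' assume h: "a \<in> {1, - 1 :: int}" "t \<in> {0..<int n}" "a' \<in> {1, - 1 :: int}" "t' \<in> {0..<int n}" "aff n a t = aff n a' t'"
  have d: "int n dvd a - a'" "int n dvd t - t'" using h(5) assms by (simp_all add: aff_eq_iff)
  have "\<bar>a - a'\<bar> < int n" "\<bar>t - t'\<bar> < int n" using h assms by auto
  then show "a = a' \<and> t = t'" using d by (metis dvd_imp_le_int eq_iff_diff_eq_0 not_le abs_of_nat)
qed

lemma card_Dih:
  assumes n: "3 \<le> n" shows "finite (Dih n)" "card (Dih n) = 2 * n"
  using Dih_param[of n] Dih_inj_param[OF n] n by (simp_all add: card_image)

lemma finite_Endo: "finite (Endo b n)"
proof (rule finite_subset)
  show "Endo b n \<subseteq> PORX b n \<rightarrow>\<^sub>E PORX b n" by (auto simp: Endo_def PiE_def)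
qed (simp add: finite_PiE finite_PORX)

lemma card_Endo:
  assumes n: "3 \<le> n" shows "card (Endo b n) = 2 * n + n * totient n + card (typeC b n)"
proof -
  have fin: "finite (typeC b n)" using finite_Endo by (auto simp: typeC_def)
  have DP: "s \<in> perms_of n" if "s \<in> Dih n" for s using Hol_perms Dih_Hol that by blast
  have c1: "card (cell_conj False b n ` Dih n) = 2 * n"
    using card_Dih(2)[OF n] cell_conj_inj[of _ n] DP by (subst card_image) (auto intro!: inj_onI)
  have c2: "card (cell_conj True b n ` Hol n) = n * totient n"
    using card_Hol(2)[OF n] cell_conj_inj[of _ n] Hol_perms by (subst card_image) (auto intro!: inj_onI)
  have "typeC b n \<inter> cell_conj False b n ` Dih n = {}" using cell_conj_not_typeC[OF n] DP by auto
  moreover have "(typeC b n \<union> cell_conj False b n ` Dih n) \<inter> cell_conj True b n ` Hol n = {}"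
    using cell_conj_not_typeC[OF n] cell_conj_disjoint[OF n] DP Hol_perms by blast
  ultimately show ?thesis
    unfolding Endo_decomp[OF n] using fin card_Hol(1)[OF n] card_Dih(1)[OF n] c1 c2
    by (simp add: card_Un_disjoint)
qed

section \<open>Endomorphisms that collapse all non-units\<close>

text \<open>A power in the local monoid at \<open>e\<close>: the zeroth power is \<open>e\<close>
  and not the identity map.\<close>

definition pow_at :: "(nat \<rightharpoonup> nat) \<Rightarrow> (nat \<rightharpoonup> nat) \<Rightarrow> nat \<Rightarrow> (nat \<rightharpoonup> nat)" where
  "pow_at e X i = ((\<lambda>Z. X \<circ>\<^sub>m Z) ^^ i) e"

definition idems :: "bool \<Rightarrow> nat \<Rightarrow> (nat \<rightharpoonup> nat) set" where
  "idems b k = {e \<in> PORX b k. e \<circ>\<^sub>m e = e}"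

text \<open>Triples \<open>(f, X, Y)\<close>: images of the zero, the rotation and the reflection under a homomorphism
  from the dihedral group of order \<open>2 * N\<close> with a zero adjoined, whose identity goes to \<open>e\<close>.\<close>

definition rep_triples :: "bool \<Rightarrow> nat \<Rightarrow> nat \<Rightarrow> (nat \<rightharpoonup> nat)
    \<Rightarrow> ((nat \<rightharpoonup> nat) \<times> (nat \<rightharpoonup> nat) \<times> (nat \<rightharpoonup> nat)) set" where
  "rep_triples b k N e = {(f, X, Y). f \<in> PORX b k \<and> X \<in> PORX b k \<and> Y \<in> PORX b k \<and> f \<circ>\<^sub>m f = f \<and>
     e \<circ>\<^sub>m X = X \<and> X \<circ>\<^sub>m e = X \<and> e \<circ>\<^sub>m Y = Y \<and> Y \<circ>\<^sub>m e = Y \<and>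
     pow_at e X N = e \<and> Y \<circ>\<^sub>m Y = e \<and> X \<circ>\<^sub>m (Y \<circ>\<^sub>m X) = Y \<and>
     f \<circ>\<^sub>m X = f \<and> X \<circ>\<^sub>m f = f \<and> f \<circ>\<^sub>m Y = f \<and> Y \<circ>\<^sub>m f = f}"

lemma pow_at_0 [simp]: "pow_at e X 0 = e" and pow_at_Suc: "pow_at e X (Suc i) = X \<circ>\<^sub>m pow_at e X i"
  by (simp_all add: pow_at_def)

text \<open>A dihedral presentation inside the local monoid at \<open>e\<close>. The relation
  between \<open>X\<close> and \<open>Y\<close> is written without inverses, as these are available
  only through powers of \<open>X\<close>.\<close>

locale dihedral_rel =
  fixes N :: nat and e X Y :: "nat \<rightharpoonup> nat"
  assumes N: "N \<ge> 1" and ee: "e \<circ>\<^sub>m e = e" and eX: "e \<circ>\<^sub>m X = X" and Xe: "X \<circ>\<^sub>m e = X"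
    and eY: "e \<circ>\<^sub>m Y = Y" and Ye: "Y \<circ>\<^sub>m e = Y"
    and XN: "pow_at e X N = e" and YY: "Y \<circ>\<^sub>m Y = e" and XYX: "X \<circ>\<^sub>m (Y \<circ>\<^sub>m X) = Y"
begin

lemma e_pow_at: "e \<circ>\<^sub>m pow_at e X i = pow_at e X i"
  by (cases i) (simp_all add: ee pow_at_Suc map_comp_assoc[symmetric] eX)

lemma pow_at_e: "pow_at e X i \<circ>\<^sub>m e = pow_at e X i"
  by (induction i) (simp_all add: ee pow_at_Suc map_comp_assoc)

lemma pow_at_add: "pow_at e X i \<circ>\<^sub>m pow_at e X j = pow_at e X (i + j)"
  by (induction i) (simp_all add: e_pow_at pow_at_Suc map_comp_assoc)

lemma pow_at_X: "pow_at e X i \<circ>\<^sub>m X = pow_at e X (Suc i)"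
  using pow_at_add[of i 1] by (simp add: pow_at_Suc Xe)

lemma pow_at_mod: "pow_at e X (i mod N) = pow_at e X i"
proof (induction i rule: less_induct)
  case (less i)
  show ?case
  proof (cases "i < N")
    case False
    then have "pow_at e X i = pow_at e X (i - N) \<circ>\<^sub>m pow_at e X N" by (simp add: pow_at_add)
    then have "pow_at e X i = pow_at e X (i - N)" by (simp add: XN pow_at_e)
    moreover have "i mod N = (i - N) mod N" using False by (simp add: le_mod_geq)
    ultimately show ?thesis using less[of "i - N"] False N by simp
  qed simp
qed

lemma pow_at_Y_pow_at: "pow_at e X i \<circ>\<^sub>m (Y \<circ>\<^sub>m pow_at e X i) = Y"
proof (induction i)
  case (Suc i)
  have "pow_at e X (Suc i) \<circ>\<^sub>m (Y \<circ>\<^sub>m pow_at e X (Suc i)) = X \<circ>\<^sub>m ((pow_at e X i \<circ>\<^sub>m (Y \<circ>\<^sub>m pow_at e X i)) \<circ>\<^sub>m X)"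
    by (subst (2) pow_at_X[symmetric]) (simp add: pow_at_Suc map_comp_assoc)
  then show ?case by (simp add: Suc XYX)
qed (simp add: ee eY Ye)

text \<open>Powers of \<open>X\<close> with integer exponents, meaningful because the exponents
  count modulo \<open>N\<close>.\<close>

definition P :: "int \<Rightarrow> (nat \<rightharpoonup> nat)" where "P t = pow_at e X (nat (t mod int N))"

lemma P_add: "P s \<circ>\<^sub>m P t = P (s + t)"
proof -
  have "nat ((s + t) mod int N) = (nat (s mod int N) + nat (t mod int N)) mod N"
    using N by (simp add: nat_add_distrib[symmetric] nat_mod_as_int mod_add_eq)
  then show ?thesis by (simp add: P_def pow_at_add pow_at_mod)
qed

lemma P_0: "P 0 = e" by (simp add: P_def)

lemma P_mod: "int N dvd s - t \<Longrightarrow> P s = P t"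
  by (simp add: P_def mod_eq_dvd_iff[symmetric])

lemma P_e: "P t \<circ>\<^sub>m e = P t"
  by (simp add: P_def pow_at_e)

lemma Y_P: "Y \<circ>\<^sub>m P t = P (- t) \<circ>\<^sub>m Y"
proof -
  have "Y \<circ>\<^sub>m P t = (P (- t) \<circ>\<^sub>m P t) \<circ>\<^sub>m (Y \<circ>\<^sub>m P t)" 
    by (simp add: P_add P_0 map_comp_assoc[symmetric] eY)
  also have "\<dots> = P (- t) \<circ>\<^sub>m (P t \<circ>\<^sub>m (Y \<circ>\<^sub>m P t))" by (simp only: map_comp_assoc)
  also have "P t \<circ>\<^sub>m (Y \<circ>\<^sub>m P t) = Y" by (simp add: P_def pow_at_Y_pow_at)
  finally show ?thesis .
qed

text \<open>The dihedral multiplication table, with \<open>aff n 1 t\<close> and \<open>aff n (-1) t\<close> sent to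
  \<open>P t\<close> and \<open>P t \<circ>\<^sub>m Y\<close>.\<close>

lemma table:
  "P s \<circ>\<^sub>m (P t \<circ>\<^sub>m Y) = P (s + t) \<circ>\<^sub>m Y"
  "(P s \<circ>\<^sub>m Y) \<circ>\<^sub>m P t = P (s - t) \<circ>\<^sub>m Y"
  "(P s \<circ>\<^sub>m Y) \<circ>\<^sub>m (P t \<circ>\<^sub>m Y) = P (s - t)"
proof -
  show "P s \<circ>\<^sub>m (P t \<circ>\<^sub>m Y) = P (s + t) \<circ>\<^sub>m Y" by (simp add: P_add map_comp_assoc[symmetric])
  show 1: "(P s \<circ>\<^sub>m Y) \<circ>\<^sub>m P t = P (s - t) \<circ>\<^sub>m Y"
    by (simp add: map_comp_assoc Y_P) (simp add: P_add map_comp_assoc[symmetric])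
  have "(P s \<circ>\<^sub>m Y) \<circ>\<^sub>m (P t \<circ>\<^sub>m Y) = ((P s \<circ>\<^sub>m Y) \<circ>\<^sub>m P t) \<circ>\<^sub>m Y" by (simp only: map_comp_assoc)
  also have "\<dots> = P (s - t) \<circ>\<^sub>m (Y \<circ>\<^sub>m Y)" unfolding 1 by (simp only: map_comp_assoc)
  finally show "(P s \<circ>\<^sub>m Y) \<circ>\<^sub>m (P t \<circ>\<^sub>m Y) = P (s - t)" by (simp add: YY P_e)
qed

end

section \<open>Units, non-units and the data determining an endomorphism\<close>

lemma perms_surjI:
  assumes pt: "partial_transformation n \<alpha>" and r: "ran \<alpha> = {1..n}" shows "\<alpha> \<in> perms_of n"
proof -
  have "img \<alpha> {1..n} = ran \<alpha>"
    using pt_val(3,4)[OF pt] unfolding img_def ran_def by (meson atLeastAtMost_iff)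
  then have "img \<alpha> {1..n} = {1..n}" using r by simp
  then have c: "card (img \<alpha> {1..n}) \<ge> card {1..n}" by simp
  have "dom \<alpha> = {1..n}" using img_full_rank(1)[OF _ c] pt by (auto simp: partial_transformation_def)
  then show ?thesis using img_full_rank(2)[OF _ c] r by (simp add: perms_of_def)
qed

text \<open>The non-units form a two-sided ideal with the units as complement. This permits gluing a
  group homomorphism on the units with a constant value on the ideal.\<close>

lemma perms_comp_iff:
  assumes pa: "partial_transformation n \<alpha>" and pb: "partial_transformation n \<beta>"
  shows "\<beta> \<circ>\<^sub>m \<alpha> \<in> perms_of n \<longleftrightarrow> \<beta> \<in> perms_of n \<and> \<alpha> \<in> perms_of n"
proof
  assume h: "\<beta> \<circ>\<^sub>m \<alpha> \<in> perms_of n"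
  have "dom (\<beta> \<circ>\<^sub>m \<alpha>) \<subseteq> dom \<alpha>" by (auto simp: map_comp_Some_iff dom_def)
  then have "dom \<alpha> = {1..n}" using h pa unfolding perms_of_def partial_transformation_def by auto
  moreover have "inj_on \<alpha> (dom \<alpha>)"
    unfolding inj_on_iff
  proof (intro allI impI)
    fix x y a assume a: "\<alpha> x = Some a" "\<alpha> y = Some a"
    then have "x \<in> dom (\<beta> \<circ>\<^sub>m \<alpha>)" using h pt_val[OF pa a(1)] by (simp add: perms_of_def)
    then obtain c where "(\<beta> \<circ>\<^sub>m \<alpha>) x = Some c" by blast
    moreover then have "(\<beta> \<circ>\<^sub>m \<alpha>) y = Some c" using a by (simp add: map_comp_def)
    ultimately show "x = y" using h unfolding perms_of_def inj_on_iff by blast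
  qed
  ultimately have "\<alpha> \<in> perms_of n" using pa by (intro perms_ofI) (simp_all add: partial_transformation_def)
  moreover have "ran (\<beta> \<circ>\<^sub>m \<alpha>) \<subseteq> ran \<beta>" by (auto simp: map_comp_Some_iff ran_def)
  then have "ran \<beta> = {1..n}" using h pb unfolding perms_of_def partial_transformation_def by auto
  ultimately show "\<beta> \<in> perms_of n \<and> \<alpha> \<in> perms_of n" using perms_surjI[OF pb] by simp
next
  assume h: "\<beta> \<in> perms_of n \<and> \<alpha> \<in> perms_of n"
  have "y \<in> ran (\<beta> \<circ>\<^sub>m \<alpha>)" if "y \<in> {1..n}" for y
  proof -
    have "y \<in> ran \<beta>" using h that by (simp add: perms_of_def)
    then obtain z where z: "\<beta> z = Some y" by (auto simp: ran_def)
    then have "z \<in> {1..n}" using pt_val[OF pb z] by simp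
    then have "z \<in> ran \<alpha>" using h by (simp add: perms_of_def)
    then obtain x where "\<alpha> x = Some z" by (auto simp: ran_def)
    then show ?thesis using z by (auto simp: ran_def map_comp_Some_iff)
  qed
  then have "ran (\<beta> \<circ>\<^sub>m \<alpha>) = {1..n}" using pt_comp[OF pa pb] by (auto simp: partial_transformation_def)
  then show "\<beta> \<circ>\<^sub>m \<alpha> \<in> perms_of n" using perms_surjI[OF pt_comp[OF pa pb]] by simp
qed

definition gen_data :: "nat \<Rightarrow> ((nat \<rightharpoonup> nat) \<Rightarrow> (nat \<rightharpoonup> nat)) \<Rightarrow>
    (nat \<rightharpoonup> nat) \<times> (nat \<rightharpoonup> nat) \<times> (nat \<rightharpoonup> nat) \<times> (nat \<rightharpoonup> nat)" where
  "gen_data n \<phi> = (\<phi> (pid {1..n}), \<phi> (pid {}), \<phi> (aff n 1 1), \<phi> (aff n (-1) 0))"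

context endo begin

lemma affS: "aff n 1 t \<in> PORX b n" "aff n (-1) t \<in> PORX b n"
  by (simp_all add: aff_PORX)

lemma \<phi>_rot: "\<phi> (aff n 1 (int i)) = pow_at (\<phi> (pid {1..n})) (\<phi> (aff n 1 1)) i"
proof (induction i)
  case (Suc i)
  have "aff n 1 (int (Suc i)) = aff n 1 1 \<circ>\<^sub>m aff n 1 (int i)" by (simp add: aff_comp add.commute)
  then show ?case using hom[OF affS(1) affS(1)] Suc by (simp add: pow_at_Suc)
qed (simp add: aff_1_0)

lemma \<phi>_refl: "\<phi> (aff n (-1) t) = \<phi> (aff n 1 t) \<circ>\<^sub>m \<phi> (aff n (-1) 0)"
  using hom[OF affS(2)[of 0] affS(1)[of t]] by (simp add: aff_comp)

text \<open>A non-unit misses a point of the range, so it has a left factor that is a proper partial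
  identity.\<close>

lemma typeC_nonunit:
  assumes "\<phi> \<in> typeC b n" "\<alpha> \<in> PORX b n" "\<alpha> \<notin> perms_of n" shows "\<phi> \<alpha> = f"
proof -
  have r: "ran \<alpha> \<subset> {1..n}"
    using perms_surjI[OF PORX_pt[OF assms(2)]] assms(3) PORX_pt[OF assms(2)] unfolding partial_transformation_def by auto
  then have "pid (ran \<alpha>) \<in> PORX b n" using pidS by auto
  moreover have "pid (ran \<alpha>) \<circ>\<^sub>m \<alpha> = \<alpha>" by (rule pid_comp_id) simp
  ultimately have "\<phi> \<alpha> = \<phi> (pid (ran \<alpha>)) \<circ>\<^sub>m \<phi> \<alpha>" using hom[OF assms(2)] by metis
  also have "\<phi> (pid (ran \<alpha>)) = f" using assms(1) r by (auto simp: typeC_def)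
  finally show ?thesis using zero(2)[OF assms(2)] by simp
qed

lemma gen_data_in: "gen_data n \<phi> \<in> (SIGMA e:idems b n. rep_triples b n n e)"
proof -
  let ?e = "\<phi> (pid {1..n})" and ?X = "\<phi> (aff n 1 1)" and ?Y = "\<phi> (aff n (-1) 0)"
  have pO: "pid {1..n} \<in> PORX b n" by (rule pidS) simp
  have one: "pid {1..n} \<circ>\<^sub>m aff n a t = aff n a t" "aff n a t \<circ>\<^sub>m pid {1..n} = aff n a t" for a t
    unfolding aff_1_0[symmetric] aff_comp by simp_all
  have "?e \<in> idems b n" using closed[OF pO] idem[of "{1..n}"] by (simp add: idems_def)
  moreover have "?e \<circ>\<^sub>m ?X = ?X" "?X \<circ>\<^sub>m ?e = ?X" "?e \<circ>\<^sub>m ?Y = ?Y" "?Y \<circ>\<^sub>m ?e = ?Y"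
    using hom[OF affS(1) pO] hom[OF pO affS(1)] hom[OF affS(2) pO] hom[OF pO affS(2)] one by metis+
  moreover have "pow_at ?e ?X n = ?e"
  proof -
    have "aff n 1 (int n) = aff n 1 0" using n3 by (simp add: aff_eq_iff)
    then show ?thesis using \<phi>_rot[of n] by (simp add: aff_1_0)
  qed
  moreover have "?Y \<circ>\<^sub>m ?Y = ?e"
    using hom[OF affS(2)[of 0] affS(2)[of 0]] by (simp add: aff_comp aff_1_0)
  moreover have "?X \<circ>\<^sub>m (?Y \<circ>\<^sub>m ?X) = ?Y"
    using hom[OF affS(1)[of 1] affS(2)[of 0]] hom[OF affS(2)[of "-1"] affS(1)[of 1]] by (simp add: aff_comp)
  ultimately show ?thesis
    using closed pidS[of "{}"] affS zero zero[OF pidS[of "{}"]] by (simp add: gen_data_def rep_triples_def)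
qed

end

lemma gen_data_inj: assumes n: "3 \<le> n" shows "inj_on (gen_data n) (typeC b n)"
proof (rule inj_onI)
  fix \<phi> \<psi> assume h: "\<phi> \<in> typeC b n" "\<psi> \<in> typeC b n" "gen_data n \<phi> = gen_data n \<psi>"
  interpret A: endo b n \<phi> using n h by unfold_locales (auto simp: typeC_def)
  interpret B: endo b n \<psi> using n h by unfold_locales (auto simp: typeC_def)
  show "\<phi> = \<psi>"
  proof
    fix \<alpha>
    show "\<phi> \<alpha> = \<psi> \<alpha>"
    proof (cases "\<alpha> \<in> PORX b n")
      case True
      show ?thesis
      proof (cases "\<alpha> \<in> perms_of n")
        case False
        then show ?thesis using A.typeC_nonunit[OF h(1) True] B.typeC_nonunit[OF h(2) True] h(3) by (simp add: gen_data_def)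
      next
        case perm: True
        have "\<alpha> \<in> Dih n" by (rule PORX_perms_Dih[OF True perm])
        then obtain a s where s: "a = 1 \<or> a = -1" "\<alpha> = aff n a s" by (auto simp: Dih_def)
        define t where "t = s mod int n"
        have a: "a = 1 \<or> a = -1" "0 \<le> t" "\<alpha> = aff n a t" using s n by (simp_all add: t_def aff_mod)
        have rot: "\<phi> (aff n 1 t) = \<psi> (aff n 1 t)"
          using A.\<phi>_rot[of "nat t"] B.\<phi>_rot[of "nat t"] h(3) a(2) by (simp add: gen_data_def)
        then show ?thesis using a A.\<phi>_refl[of t] B.\<phi>_refl[of t] h(3) by (auto simp: gen_data_def)
      qed
    next
      case False
      then show ?thesis using A.\<phi> B.\<phi> by (auto simp: Endo_def extensional_def)
    qed
  qed
qed

lemma gen_data_surj: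
  assumes n: "3 \<le> n" and e: "e \<in> idems b n" and T: "(f, X, Y) \<in> rep_triples b n n e"
  shows "\<exists>\<psi>\<in>typeC b n. gen_data n \<psi> = (e, f, X, Y)"
proof -
  have t: "f \<in> PORX b n" "X \<in> PORX b n" "Y \<in> PORX b n" "f \<circ>\<^sub>m f = f" "f \<circ>\<^sub>m X = f" "X \<circ>\<^sub>m f = f" "f \<circ>\<^sub>m Y = f" "Y \<circ>\<^sub>m f = f"
    "Y \<circ>\<^sub>m Y = e"
    using T by (auto simp: rep_triples_def)
  interpret D: dihedral_rel n e X Y using T e n by unfold_locales (auto simp: rep_triples_def idems_def)
  have fe: "f \<circ>\<^sub>m e = f" "e \<circ>\<^sub>m f = f" using t(7,8,9) by (metis map_comp_assoc)+
  have fpw: "f \<circ>\<^sub>m pow_at e X i = f \<and> pow_at e X i \<circ>\<^sub>m f = f" for i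
    by (induction i) (simp_all add: fe pow_at_Suc map_comp_assoc t(6), metis map_comp_assoc t(5))
  have fP: "f \<circ>\<^sub>m D.P s = f" "D.P s \<circ>\<^sub>m f = f" for s using fpw by (simp_all add: D.P_def)
  have "pow_at e X i \<in> PORX b n" for i
    by (induction i) (use e t PORX_comp in \<open>auto simp: idems_def pow_at_Suc\<close>)
  then have PS: "D.P s \<in> PORX b n" for s by (simp add: D.P_def)
  \<comment> \<open>The translation part of an affine map can be read off modulo \<open>n\<close>
    from its value at \<open>n\<close>, the representative of 0.\<close>
  define tv where "tv \<alpha> = int (the (\<alpha> n))" for \<alpha> :: "nat \<rightharpoonup> nat"
  have tv: "D.P (tv (aff n a s)) = D.P s" for a s
  proof -
    obtain v where v: "aff n a s n = Some v" using n by (auto simp: aff_def)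
    then have "int n dvd int v - (a * int n + s)" by (simp add: aff_Some)
    then have "int n dvd (int v - (a * int n + s)) + a * int n" by (rule dvd_add) simp
    then have "int n dvd tv (aff n a s) - s" using v by (simp add: tv_def)
    then show ?thesis by (rule D.P_mod)
  qed
  define \<psi> where "\<psi> = (\<lambda>\<alpha>\<in>PORX b n. if \<alpha> \<notin> perms_of n then f else if \<exists>s. \<alpha> = aff n 1 s then D.P (tv \<alpha>) else D.P (tv \<alpha>) \<circ>\<^sub>m Y)"
  have pm: "aff n 1 s \<in> perms_of n" "aff n (-1) s \<in> perms_of n" for s
    using aff_perms[of n 1 1] aff_perms[of n "-1" "-1"] by simp_all
  \<comment> \<open>Keeps the two unit branches of \<psi> disjoint: no reflection is a rotation when
    \<open>n\<close> exceeds 2.\<close>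
  have ne: "aff n (-1) s \<noteq> aff n 1 s'" for s s'
  proof
    assume "aff n (-1) s = aff n 1 s'"
    then have "int n dvd 2" using n by (auto simp: aff_eq_iff)
    then show False using n by (auto dest: zdvd_imp_le)
  qed
  have \<psi>1: "\<psi> (aff n 1 s) = D.P s" for s using tv pm aff_PORX[of 1 n s b] by (auto simp: \<psi>_def)
  have \<psi>2: "\<psi> (aff n (-1) s) = D.P s \<circ>\<^sub>m Y" for s using tv pm ne aff_PORX[of "-1" n s b] by (auto simp: \<psi>_def)
  have \<psi>0: "\<psi> \<alpha> = f" if "\<alpha> \<in> PORX b n" "\<alpha> \<notin> perms_of n" for \<alpha> using that by (simp add: \<psi>_def)
  have fPY: "f \<circ>\<^sub>m (D.P s \<circ>\<^sub>m Y) = f" "(D.P s \<circ>\<^sub>m Y) \<circ>\<^sub>m f = f" for s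
    using fP t(7,8) by (metis map_comp_assoc)+
  have unit: "\<exists>s. \<alpha> = aff n 1 s \<or> \<alpha> = aff n (-1) s" if "\<alpha> \<in> PORX b n" "\<alpha> \<in> perms_of n" for \<alpha>
    using PORX_perms_Dih[OF that] by (auto simp: Dih_def)
  have zero: "f \<circ>\<^sub>m \<psi> \<alpha> = f \<and> \<psi> \<alpha> \<circ>\<^sub>m f = f \<and> \<psi> \<alpha> \<in> PORX b n" if "\<alpha> \<in> PORX b n" for \<alpha>
  proof (cases "\<alpha> \<in> perms_of n")
    case True
    then show ?thesis using unit[OF that True] \<psi>1 \<psi>2 fP fPY PS PORX_comp[OF t(3) PS] by auto
  qed (use \<psi>0[OF that] t in simp)
  have hom: "\<psi> (\<beta> \<circ>\<^sub>m \<alpha>) = \<psi> \<beta> \<circ>\<^sub>m \<psi> \<alpha>" if S: "\<alpha> \<in> PORX b n" "\<beta> \<in> PORX b n" for \<alpha> \<beta>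
  proof (cases "\<alpha> \<in> perms_of n \<and> \<beta> \<in> perms_of n")
    case True
    obtain s s' where "\<alpha> = aff n 1 s \<or> \<alpha> = aff n (-1) s" "\<beta> = aff n 1 s' \<or> \<beta> = aff n (-1) s'"
      using unit S True by metis
    then show ?thesis by (auto simp: aff_comp \<psi>1 \<psi>2 D.P_add D.table add.commute)
  next
    case False
    then have "\<psi> (\<beta> \<circ>\<^sub>m \<alpha>) = f" using \<psi>0[OF PORX_comp[OF S]] perms_comp_iff[OF PORX_pt[OF S(1)] PORX_pt[OF S(2)]] by blast
    then show ?thesis using False \<psi>0 S zero by metis
  qed
  have "\<psi> \<in> Endo b n" using hom zero by (auto simp: Endo_def) (simp add: \<psi>_def)
  moreover have "\<psi> (pid A) = f" if "A \<subset> {1..n}" for A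
    using \<psi>0[OF pid_PORX] that by (auto simp: perms_of_def)
  moreover have "{} \<subset> {1..n}" using n by auto
  ultimately have p0: "\<psi> (pid {}) = f" and "\<psi> \<in> Endo b n" and "\<And>A. A \<subset> {1..n} \<Longrightarrow> \<psi> (pid A) = f" by blast+
  then have "\<psi> \<in> typeC b n" unfolding typeC_def by simp
  moreover have "gen_data n \<psi> = (e, f, X, Y)"
  proof -
    have "D.P 1 = X" using n by (simp add: D.P_def pow_at_Suc D.Xe)
    then show ?thesis using p0 \<psi>1[of 0] \<psi>1[of 1] \<psi>2[of 0] unfolding gen_data_def aff_1_0[symmetric] by (simp add: D.P_0 D.eY)
  qed
  ultimately show ?thesis by blast
qed

lemma finite_idems: "finite (idems b n)" using finite_PORX by (auto simp: idems_def)

lemma finite_rep_triples: "finite (rep_triples b k N e)"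
  by (rule finite_subset[of _ "PORX b k \<times> PORX b k \<times> PORX b k"]) (auto simp: rep_triples_def finite_PORX)

lemma card_typeC:
  assumes n: "3 \<le> n" shows "card (typeC b n) = (\<Sum>e\<in>idems b n. card (rep_triples b n n e))"
proof -
  have "gen_data n ` typeC b n = (SIGMA e:idems b n. rep_triples b n n e)"
  proof
    show "gen_data n ` typeC b n \<subseteq> (SIGMA e:idems b n. rep_triples b n n e)"
    proof
      fix z assume "z \<in> gen_data n ` typeC b n"
      then obtain \<phi> where p: "\<phi> \<in> typeC b n" "z = gen_data n \<phi>" by blast
      interpret endo b n \<phi> using n p by unfold_locales (auto simp: typeC_def)
      show "z \<in> (SIGMA e:idems b n. rep_triples b n n e)" using gen_data_in p by simp
    qed
    show "(SIGMA e:idems b n. rep_triples b n n e) \<subseteq> gen_data n ` typeC b n"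
    proof (clarify)
      fix e f X Y assume "e \<in> idems b n" "(f, X, Y) \<in> rep_triples b n n e"
      then obtain \<psi> where "\<psi> \<in> typeC b n" "gen_data n \<psi> = (e, f, X, Y)" using gen_data_surj[OF n] by blast
      then show "(e, f, X, Y) \<in> gen_data n ` typeC b n" by (metis imageI)
    qed
  qed
  then have "card (typeC b n) = card (SIGMA e:idems b n. rep_triples b n n e)"
    using card_image[OF gen_data_inj[OF n]] by metis
  also have "\<dots> = (\<Sum>e\<in>idems b n. card (rep_triples b n n e))"
    by (rule card_SigmaI) (auto simp: finite_idems finite_rep_triples)
  finally show ?thesis .
qed

section \<open>Localisation at an idempotent\<close>

lemma cyclic_seq_map:
  assumes "strict_mono_on A g" "set xs \<subseteq> (A :: nat set)"
  shows "cyclic_seq (map g xs) = cyclic_seq xs" "anti_cyclic_seq (map g xs) = anti_cyclic_seq xs"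
proof -
  have lt: "g (xs ! i) < g (xs ! j) \<longleftrightarrow> xs ! i < xs ! j" if "i < length xs" "j < length xs" for i j
  proof -
    have "xs ! i \<in> A" "xs ! j \<in> A" using assms(2) that by auto
    then show ?thesis using strict_mono_on_less[OF assms(1)] by blast
  qed
  have m: "Suc i mod length xs < length xs" if "i < length xs" for i
    using that by (intro mod_less_divisor) auto
  show "cyclic_seq (map g xs) = cyclic_seq xs" "anti_cyclic_seq (map g xs) = anti_cyclic_seq xs"
    unfolding cyclic_seq_def anti_cyclic_seq_def using lt m
    by (simp_all add: nth_map cong: conj_cong)
qed

lemma sorted_list_of_set_strict_mono:
  assumes g: "strict_mono_on A g" and D: "D \<subseteq> (A :: nat set)" "finite D"
  shows "sorted_list_of_set (g ` D) = map g (sorted_list_of_set D)"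
proof -
  let ?L = "sorted_list_of_set D"
  have "inj_on g D" using g D(1) strict_mono_on_imp_inj_on inj_on_subset by blast
  then have d: "distinct (map g ?L)" using D(2) by (simp add: distinct_map)
  have "sorted_wrt (<) ?L" by simp
  then have "sorted_wrt (\<lambda>x y. g x \<le> g y) ?L"
  proof (rule sorted_wrt_mono_rel[rotated])
    fix x y assume "x \<in> set ?L" "y \<in> set ?L" "x < y"
    then have "x \<in> A" "y \<in> A" using D by auto
    then show "g x \<le> g y" using strict_mono_onD[OF g, of x y] \<open>x < y\<close> by auto
  qed
  then have "sorted (map g ?L)" by (simp add: sorted_wrt_map)
  then show ?thesis using d D(2) by (metis list.set_map set_sorted_list_of_set sorted_list_of_set.idem_if_sorted_distinct)
qed

text \<open>Orientation depends only on the relative order of points and values, so the increasing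
  enumeration of \<open>B\<close> transports partial maps between \<open>B\<close> and
  \<open>{1..k}\<close> without changing it.\<close>

locale embed =
  fixes n k :: nat and B :: "nat set" and g :: "nat \<Rightarrow> nat"
  assumes B: "B \<subseteq> {1..n}" and g: "bij_betw g {1..k} B" and gm: "strict_mono_on {1..k} g"
begin

definition G where "G = (\<lambda>i. if i \<in> {1..k} then Some (g i) else None)"

lemma G: "G i = Some y \<longleftrightarrow> i \<in> {1..k} \<and> y = g i" by (auto simp: G_def)

lemma g_eq: "i \<in> {1..k} \<Longrightarrow> j \<in> {1..k} \<Longrightarrow> g i = g j \<longleftrightarrow> i = j"
  using g inj_on_eq_iff[of g "{1..k}"] by (simp add: bij_betw_def)

lemma G_inj: "inj_on G (dom G)"
  unfolding inj_on_iff G using g_eq by blast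

lemma Gi: "minv G y = Some i \<longleftrightarrow> i \<in> {1..k} \<and> y = g i"
  using minv_Some[OF G_inj] G by simp

lemma GiG: "minv G \<circ>\<^sub>m G = pid {1..k}"
proof -
  have "dom G = {1..k}" by (auto simp: G_def dom_def split: if_splits)
  then show ?thesis using minv_comp[OF G_inj] by simp
qed

lemma GGi: "G \<circ>\<^sub>m minv G = pid B"
proof (rule map_eqI)
  fix x y
  have "x \<in> B \<longleftrightarrow> (\<exists>i\<in>{1..k}. x = g i)" using g by (auto simp: bij_betw_def)
  then show "(G \<circ>\<^sub>m minv G) x = Some y \<longleftrightarrow> pid B x = Some y"
    by (auto simp: map_comp_Some_iff G Gi simp del: atLeastAtMost_iff)
qed

lemma gB: "i \<in> {1..k} \<Longrightarrow> g i \<in> B" using g by (auto simp: bij_betw_def)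

lemma conj_pt: "partial_transformation k \<beta> \<Longrightarrow> partial_transformation n (G \<circ>\<^sub>m (\<beta> \<circ>\<^sub>m minv G))"
proof -
  assume "partial_transformation k \<beta>"
  have "\<exists>i\<in>{1..k}. \<exists>j\<in>{1..k}. x = g i \<and> y = g j" if "(G \<circ>\<^sub>m (\<beta> \<circ>\<^sub>m minv G)) x = Some y" for x y
    using that unfolding map_comp_Some_iff G Gi by blast
  then have "x \<in> B \<and> y \<in> B" if "(G \<circ>\<^sub>m (\<beta> \<circ>\<^sub>m minv G)) x = Some y" for x y
    using that gB by blast
  then have "dom (G \<circ>\<^sub>m (\<beta> \<circ>\<^sub>m minv G)) \<subseteq> B" "ran (G \<circ>\<^sub>m (\<beta> \<circ>\<^sub>m minv G)) \<subseteq> B"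
    unfolding dom_def ran_def by blast+
  then show ?thesis using B unfolding partial_transformation_def by (meson subset_trans)
qed

lemma conj_oriented:
  assumes pt: "partial_transformation k \<beta>"
  shows "oriented (G \<circ>\<^sub>m (\<beta> \<circ>\<^sub>m minv G)) \<longleftrightarrow> oriented \<beta>"
proof -
  let ?c = "G \<circ>\<^sub>m (\<beta> \<circ>\<^sub>m minv G)"
  have dk: "dom \<beta> \<subseteq> {1..k}" "finite (dom \<beta>)"
    using pt finite_subset[of "dom \<beta>" "{1..k}"] by (auto simp: partial_transformation_def)
  have c: "?c (g i) = map_option g (\<beta> i)" if "i \<in> {1..k}" for i
  proof -
    have "minv G (g i) = Some i" using Gi that by simp
    then show ?thesis using pt_val[OF pt, of i] by (cases "\<beta> i") (auto simp: map_comp_def G_def)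
  qed
  have "dom ?c = g ` dom \<beta>"
  proof (rule equalityI; rule subsetI)
    fix x assume "x \<in> dom ?c"
    then obtain y where "?c x = Some y" by blast
    then obtain i z where "x = g i" "\<beta> i = Some z" unfolding map_comp_Some_iff Gi by blast
    then show "x \<in> g ` dom \<beta>" by blast
  next
    fix x assume "x \<in> g ` dom \<beta>"
    then obtain i where "x = g i" "i \<in> dom \<beta>" by blast
    then show "x \<in> dom ?c" using c[of i] dk by (auto simp del: map_comp_simps)
  qed
  then have "image_seq ?c = map (\<lambda>i. the (?c (g i))) (sorted_list_of_set (dom \<beta>))"
    unfolding image_seq_def by (simp add: sorted_list_of_set_strict_mono[OF gm dk] comp_def)
  also have "\<dots> = map (\<lambda>i. g (the (\<beta> i))) (sorted_list_of_set (dom \<beta>))"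
  proof (rule map_cong[OF refl])
    fix i assume "i \<in> set (sorted_list_of_set (dom \<beta>))"
    then have i: "i \<in> dom \<beta>" "i \<in> {1..k}" using dk by auto
    then obtain y where "\<beta> i = Some y" by blast
    then show "the (?c (g i)) = g (the (\<beta> i))" using c[OF i(2)] by simp
  qed
  finally have "image_seq ?c = map g (image_seq \<beta>)" by (simp add: image_seq_def comp_def)
  moreover have "set (image_seq \<beta>) \<subseteq> {1..k}"
    using pt_val[OF pt] dk by (auto simp: image_seq_def)
  ultimately show ?thesis unfolding oriented_def using cyclic_seq_map[OF gm] by simp
qed

text \<open>The orientation of the transported map is checked after moving it back up, where it is
  \<alpha> restricted in source and target to \<open>B\<close>.\<close>

lemma down:
  assumes "\<alpha> \<in> PORX b n" shows "minv G \<circ>\<^sub>m (\<alpha> \<circ>\<^sub>m G) \<in> PORX b k"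
proof -
  let ?\<beta> = "minv G \<circ>\<^sub>m (\<alpha> \<circ>\<^sub>m G)"
  have pt: "partial_transformation k ?\<beta>"
    unfolding partial_transformation_def by (auto simp: dom_def ran_def map_comp_Some_iff G Gi)
  have "G \<circ>\<^sub>m (?\<beta> \<circ>\<^sub>m minv G) = (G \<circ>\<^sub>m minv G) \<circ>\<^sub>m (\<alpha> \<circ>\<^sub>m (G \<circ>\<^sub>m minv G))" by (simp only: map_comp_assoc)
  also have "\<dots> \<in> PORX b n" unfolding GGi using PORX_comp pid_PORX[OF B] assms by blast
  finally have "oriented ?\<beta>" using conj_oriented[OF pt] by (simp add: PORX_def)
  moreover have "inj_on ?\<beta> (dom ?\<beta>)" if "inj_on \<alpha> (dom \<alpha>)"
    using that unfolding inj_on_iff map_comp_Some_iff G Gi by (metis g_eq)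
  ultimately show ?thesis using pt assms by (simp add: PORX_def)
qed

lemma up:
  assumes "\<beta> \<in> PORX b k" shows "G \<circ>\<^sub>m (\<beta> \<circ>\<^sub>m minv G) \<in> PORX b n"
proof -
  let ?c = "G \<circ>\<^sub>m (\<beta> \<circ>\<^sub>m minv G)"
  have pt: "partial_transformation k \<beta>" using assms by (simp add: PORX_def)
  have "inj_on ?c (dom ?c)" if "inj_on \<beta> (dom \<beta>)"
    using that unfolding inj_on_iff map_comp_Some_iff G Gi by (metis g_eq)
  then show ?thesis using assms conj_oriented[OF pt] conj_pt[OF pt] by (simp add: PORX_def)
qed

end

definition local :: "bool \<Rightarrow> nat \<Rightarrow> (nat \<rightharpoonup> nat) \<Rightarrow> (nat \<rightharpoonup> nat) set" where
  "local b n e = {\<alpha> \<in> PORX b n. e \<circ>\<^sub>m \<alpha> = \<alpha> \<and> \<alpha> \<circ>\<^sub>m e = \<alpha>}"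

lemma local_comp: "\<alpha> \<in> local b n e \<Longrightarrow> \<beta> \<in> local b n e \<Longrightarrow> \<beta> \<circ>\<^sub>m \<alpha> \<in> local b n e"
  unfolding local_def using PORX_comp by auto (metis map_comp_assoc)+

lemma rep_triples_local:
  assumes "(f, X, Y) \<in> rep_triples b n N e" shows "f \<in> local b n e" "X \<in> local b n e" "Y \<in> local b n e"
proof -
  have t: "f \<in> PORX b n" "f \<circ>\<^sub>m Y = f" "Y \<circ>\<^sub>m f = f" "Y \<circ>\<^sub>m Y = e" using assms by (auto simp: rep_triples_def)
  then have "f \<circ>\<^sub>m e = f" "e \<circ>\<^sub>m f = f" by (metis map_comp_assoc)+
  then show "f \<in> local b n e" "X \<in> local b n e" "Y \<in> local b n e" using assms by (auto simp: rep_triples_def local_def)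
qed

lemma rep_triples_map:
  assumes e: "e \<in> idems b n"
    and hL: "\<And>\<alpha>. \<alpha> \<in> local b n e \<Longrightarrow> h \<alpha> \<in> PORX b k"
    and hom: "\<And>\<alpha> \<beta>. \<alpha> \<in> local b n e \<Longrightarrow> \<beta> \<in> local b n e \<Longrightarrow> h (\<beta> \<circ>\<^sub>m \<alpha>) = h \<beta> \<circ>\<^sub>m h \<alpha>"
    and T: "(f, X, Y) \<in> rep_triples b n N e"
  shows "(h f, h X, h Y) \<in> rep_triples b k N (h e)"
proof -
  note l = rep_triples_local[OF T]
  have el: "e \<in> local b n e" using e by (simp add: idems_def local_def)
  have pl: "pow_at e X i \<in> local b n e" for i by (induction i) (simp_all add: el pow_at_Suc local_comp l)
  have pow_at: "h (pow_at e X i) = pow_at (h e) (h X) i" for i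
    by (induction i) (simp_all add: pow_at_Suc hom[OF pl l(2)])
  have *: "h \<beta> \<circ>\<^sub>m h \<alpha> = h \<gamma>" if "\<beta> \<circ>\<^sub>m \<alpha> = \<gamma>" "\<alpha> \<in> local b n e" "\<beta> \<in> local b n e" for \<alpha> \<beta> \<gamma>
    using hom that by metis
  have t: "f \<circ>\<^sub>m f = f" "e \<circ>\<^sub>m X = X" "X \<circ>\<^sub>m e = X" "e \<circ>\<^sub>m Y = Y" "Y \<circ>\<^sub>m e = Y" "pow_at e X N = e" "Y \<circ>\<^sub>m Y = e"
    "X \<circ>\<^sub>m (Y \<circ>\<^sub>m X) = Y" "f \<circ>\<^sub>m X = f" "X \<circ>\<^sub>m f = f" "f \<circ>\<^sub>m Y = f" "Y \<circ>\<^sub>m f = f"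
    using T by (auto simp: rep_triples_def)
  have "h X \<circ>\<^sub>m (h Y \<circ>\<^sub>m h X) = h Y"
    using *[OF refl l(2) l(3)] *[OF t(8) local_comp[OF l(2) l(3)] l(2)] by simp
  moreover have "pow_at (h e) (h X) N = h e" using pow_at[of N] t(6) by simp
  ultimately show ?thesis
    using hL l *[OF t(1) l(1) l(1)] *[OF t(2) l(2) el] *[OF t(3) el l(2)] *[OF t(4) l(3) el] *[OF t(5) el l(3)]
      *[OF t(7) l(3) l(3)] *[OF t(9) l(2) l(1)] *[OF t(10) l(1) l(2)] *[OF t(11) l(3) l(1)] *[OF t(12) l(1) l(3)]
    by (simp add: rep_triples_def)
qed

text \<open>Restricting to the range of \<open>e\<close> identifies the local monoid at
  \<open>e\<close> with the monoid on \<open>k\<close> points: an element absorbed by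
  \<open>e\<close> on both sides is determined by its action on \<open>ran e\<close>.\<close>

lemma card_rep_triples_local:
  assumes e: "e \<in> idems b n" and k: "k = card (ran e)"
  shows "card (rep_triples b n N e) = card (rep_triples b k N (pid {1..k}))"
proof -
  have ee: "e \<circ>\<^sub>m e = e" and eS: "e \<in> PORX b n" using e by (auto simp: idems_def)
  have rB: "ran e \<subseteq> {1..n}" using PORX_pt[OF eS] by (simp add: partial_transformation_def)
  then have "finite (ran e)" using finite_subset by blast
  then obtain g where g: "bij_betw g {1..k} (ran e)" "strict_mono_on {1..k} g" using enum_iso k by blast
  interpret embed n k "ran e" g using rB g by unfold_locales
  let ?Gi = "minv G"
  define h where "h = (\<lambda>\<alpha>. ?Gi \<circ>\<^sub>m (\<alpha> \<circ>\<^sub>m G))"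
  \<comment> \<open>The inner factor \<open>e\<close> extends a map living on \<open>ran e\<close>
    to the whole domain of \<open>e\<close>, making it constant on the fibres of
    \<open>e\<close>.\<close>
  define h' where "h' = (\<lambda>\<beta>. (G \<circ>\<^sub>m (\<beta> \<circ>\<^sub>m ?Gi)) \<circ>\<^sub>m e)"
  have pe: "pid (ran e) \<circ>\<^sub>m e = e" by (rule pid_comp_id) simp
  have ep: "e \<circ>\<^sub>m pid (ran e) = pid (ran e)"
    using idem_fix[OF ee] by (intro map_eqI) (auto simp: map_comp_Some_iff)
  have rG: "pid (ran e) \<circ>\<^sub>m G = G" by (rule pid_comp_id) (use gB in \<open>auto simp: ran_def G\<close>)
  have eG: "e \<circ>\<^sub>m G = G" using ep rG by (metis map_comp_assoc)
  have pid_k: "pid {1..k} \<in> idems b k" by (simp add: idems_def pid_PORX pid_comp_pid)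
  have pl: "pid (ran e) \<circ>\<^sub>m \<alpha> = \<alpha>" if "\<alpha> \<in> local b n e" for \<alpha>
    using that pe unfolding local_def by (metis (mono_tags, lifting) map_comp_assoc mem_Collect_eq)
  have he: "h e = pid {1..k}" using eG GiG by (simp add: h_def)
  have idk: "\<beta> \<circ>\<^sub>m pid {1..k} = \<beta>" "pid {1..k} \<circ>\<^sub>m \<beta> = \<beta>" if "\<beta> \<in> PORX b k" for \<beta>
    using PORX_pt[OF that] by (auto simp: partial_transformation_def intro!: comp_pid_id pid_comp_id)
  have he': "h' (pid {1..k}) = e"
  proof -
    have "pid {1..k} \<circ>\<^sub>m ?Gi = ?Gi" by (rule pid_comp_id) (auto simp: ran_def Gi)
    then show ?thesis using GGi pe by (simp add: h'_def)
  qed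
  have homh: "h (\<beta> \<circ>\<^sub>m \<alpha>) = h \<beta> \<circ>\<^sub>m h \<alpha>" if "\<alpha> \<in> local b n e" "\<beta> \<in> local b n e" for \<alpha> \<beta>
  proof -
    have "h \<beta> \<circ>\<^sub>m h \<alpha> = ?Gi \<circ>\<^sub>m (\<beta> \<circ>\<^sub>m (((G \<circ>\<^sub>m ?Gi) \<circ>\<^sub>m \<alpha>) \<circ>\<^sub>m G))" by (simp only: h_def map_comp_assoc)
    then show ?thesis unfolding GGi pl[OF that(1)] by (simp only: h_def map_comp_assoc)
  qed
  have locE: "\<beta> \<in> PORX b k" if "\<beta> \<in> local b k (pid {1..k})" for \<beta> using that by (simp add: local_def)
  have homh': "h' (\<beta> \<circ>\<^sub>m \<alpha>) = h' \<beta> \<circ>\<^sub>m h' \<alpha>" if "\<alpha> \<in> local b k (pid {1..k})" "\<beta> \<in> local b k (pid {1..k})" for \<alpha> \<beta>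
  proof -
    have "h' \<beta> \<circ>\<^sub>m h' \<alpha> = G \<circ>\<^sub>m (\<beta> \<circ>\<^sub>m ((?Gi \<circ>\<^sub>m (e \<circ>\<^sub>m G)) \<circ>\<^sub>m (\<alpha> \<circ>\<^sub>m (?Gi \<circ>\<^sub>m e))))" by (simp only: h'_def map_comp_assoc)
    also have "\<dots> = G \<circ>\<^sub>m ((\<beta> \<circ>\<^sub>m pid {1..k}) \<circ>\<^sub>m (\<alpha> \<circ>\<^sub>m (?Gi \<circ>\<^sub>m e)))" unfolding eG GiG by (simp only: map_comp_assoc)
    finally show ?thesis unfolding idk(1)[OF locE[OF that(2)]] by (simp only: h'_def map_comp_assoc)
  qed
  have hh': "h (h' \<beta>) = \<beta>" if "\<beta> \<in> PORX b k" for \<beta>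
  proof -
    have "h (h' \<beta>) = (?Gi \<circ>\<^sub>m G) \<circ>\<^sub>m (\<beta> \<circ>\<^sub>m (?Gi \<circ>\<^sub>m (e \<circ>\<^sub>m G)))" by (simp only: h_def h'_def map_comp_assoc)
    then show ?thesis unfolding eG GiG idk(1)[OF that] idk(2)[OF that] .
  qed
  have h'h: "h' (h \<alpha>) = \<alpha>" if "\<alpha> \<in> local b n e" for \<alpha>
  proof -
    have "h' (h \<alpha>) = (G \<circ>\<^sub>m ?Gi) \<circ>\<^sub>m (\<alpha> \<circ>\<^sub>m ((G \<circ>\<^sub>m ?Gi) \<circ>\<^sub>m e))" by (simp only: h_def h'_def map_comp_assoc)
    also have "\<dots> = (pid (ran e) \<circ>\<^sub>m \<alpha>) \<circ>\<^sub>m e" unfolding GGi pe by (simp only: map_comp_assoc)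
    finally show ?thesis using pl[OF that] that by (simp add: local_def)
  qed
  have "bij_betw (\<lambda>(f, X, Y). (h f, h X, h Y)) (rep_triples b n N e) (rep_triples b k N (pid {1..k}))"
  proof (rule bij_betwI[where g="\<lambda>(f, X, Y). (h' f, h' X, h' Y)"])
    show "(\<lambda>(f, X, Y). (h f, h X, h Y)) \<in> rep_triples b n N e \<rightarrow> rep_triples b k N (pid {1..k})"
    proof (clarify)
      fix f X Y assume T: "(f, X, Y) \<in> rep_triples b n N e"
      have hL: "h \<alpha> \<in> PORX b k" if "\<alpha> \<in> local b n e" for \<alpha> using down that by (simp add: h_def local_def)
      show "(h f, h X, h Y) \<in> rep_triples b k N (pid {1..k})" by (rule rep_triples_map[OF e hL homh T, unfolded he])
    qed
    show "(\<lambda>(f, X, Y). (h' f, h' X, h' Y)) \<in> rep_triples b k N (pid {1..k}) \<rightarrow> rep_triples b n N e"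
    proof (clarify)
      fix f X Y assume T: "(f, X, Y) \<in> rep_triples b k N (pid {1..k})"
      have hL: "h' \<beta> \<in> PORX b n" if "\<beta> \<in> local b k (pid {1..k})" for \<beta>
        using PORX_comp[OF eS up[OF locE[OF that]]] by (simp add: h'_def)
      show "(h' f, h' X, h' Y) \<in> rep_triples b n N e" by (rule rep_triples_map[OF pid_k hL homh' T, unfolded he'])
    qed
    show "(\<lambda>(f, X, Y). (h' f, h' X, h' Y)) ((\<lambda>(f, X, Y). (h f, h X, h Y)) z) = z" if "z \<in> rep_triples b n N e" for z
      using that h'h rep_triples_local by (cases z) auto
    show "(\<lambda>(f, X, Y). (h f, h X, h Y)) ((\<lambda>(f, X, Y). (h' f, h' X, h' Y)) z) = z" if "z \<in> rep_triples b k N (pid {1..k})" for z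
      using that hh' by (cases z) (auto simp: rep_triples_def)
  qed
  then show ?thesis by (rule bij_betw_same_card)
qed

section \<open>Counting homomorphisms between dihedral groups\<close>

definition fix_idems :: "bool \<Rightarrow> nat \<Rightarrow> (nat \<rightharpoonup> nat) \<Rightarrow> (nat \<rightharpoonup> nat) \<Rightarrow> (nat \<rightharpoonup> nat) set" where
  "fix_idems b k X Y = {f \<in> idems b k. f \<circ>\<^sub>m X = f \<and> X \<circ>\<^sub>m f = f \<and> f \<circ>\<^sub>m Y = f \<and> Y \<circ>\<^sub>m f = f}"

definition dih_rel :: "nat \<Rightarrow> nat \<Rightarrow> (nat \<rightharpoonup> nat) \<Rightarrow> (nat \<rightharpoonup> nat) \<Rightarrow> bool" where
  "dih_rel k N X Y \<longleftrightarrow> pow_at (pid {1..k}) X N = pid {1..k} \<and> Y \<circ>\<^sub>m Y = pid {1..k} \<and> X \<circ>\<^sub>m (Y \<circ>\<^sub>m X) = Y"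

lemma pid_perms: "pid {1..k} \<in> perms_of k"
  unfolding perms_of_def inj_on_iff by auto

lemma PORX_id:
  assumes "\<alpha> \<in> PORX b k" shows "pid {1..k} \<circ>\<^sub>m \<alpha> = \<alpha>" "\<alpha> \<circ>\<^sub>m pid {1..k} = \<alpha>"
  using PORX_pt[OF assms] by (auto simp: partial_transformation_def intro!: comp_pid_id pid_comp_id)

lemma finite_Dih: "finite (Dih k)"
  by (rule finite_subset[OF _ finite_PORX[of False k]]) (auto intro: Dih_PORX)

text \<open>A power of \<open>X\<close> and the square of \<open>Y\<close> are the identity, so both
  are units and hence dihedral; what remains of \<open>f\<close> is an idempotent absorbed by
  both.\<close>

lemma rep_triples_id:
  assumes N: "N \<ge> 1"
  shows "rep_triples b k N (pid {1..k}) = {(f, X, Y). X \<in> Dih k \<and> Y \<in> Dih k \<and> dih_rel k N X Y \<and> f \<in> fix_idems b k X Y}"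
proof -
  let ?e = "pid {1..k}"
  have dih: "X \<in> Dih k \<and> Y \<in> Dih k" if X: "X \<in> PORX b k" and Y: "Y \<in> PORX b k" and r: "dih_rel k N X Y" for X Y
  proof
    obtain M where M: "N = Suc M" using N by (cases N) auto
    have p: "pow_at ?e X i \<in> PORX b k" for i
      by (induction i) (use X PORX_comp pid_PORX in \<open>auto simp: pow_at_Suc\<close>)
    have "X \<circ>\<^sub>m pow_at ?e X M = ?e" using r by (simp add: dih_rel_def M pow_at_Suc)
    then have "X \<circ>\<^sub>m pow_at ?e X M \<in> perms_of k" using pid_perms by simp
    then show "X \<in> Dih k" using perms_comp_iff[OF PORX_pt[OF p] PORX_pt[OF X]] PORX_perms_Dih[OF X] by blast
    have "Y \<circ>\<^sub>m Y \<in> perms_of k" using r pid_perms by (simp add: dih_rel_def)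
    then show "Y \<in> Dih k" using perms_comp_iff[OF PORX_pt[OF Y] PORX_pt[OF Y]] PORX_perms_Dih[OF Y] by blast
  qed
  have "(f, X, Y) \<in> rep_triples b k N ?e \<longleftrightarrow> X \<in> Dih k \<and> Y \<in> Dih k \<and> dih_rel k N X Y \<and> f \<in> fix_idems b k X Y" for f X Y
  proof
    assume T: "(f, X, Y) \<in> rep_triples b k N ?e"
    then have "X \<in> PORX b k" "Y \<in> PORX b k" and r: "dih_rel k N X Y" unfolding rep_triples_def dih_rel_def by blast+
    then have "X \<in> Dih k \<and> Y \<in> Dih k" using dih by blast
    moreover have "f \<in> fix_idems b k X Y" using T unfolding rep_triples_def fix_idems_def idems_def by blast
    ultimately show "X \<in> Dih k \<and> Y \<in> Dih k \<and> dih_rel k N X Y \<and> f \<in> fix_idems b k X Y" using r by blast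
  next
    assume R: "X \<in> Dih k \<and> Y \<in> Dih k \<and> dih_rel k N X Y \<and> f \<in> fix_idems b k X Y"
    then have XY: "X \<in> PORX b k" "Y \<in> PORX b k" using Dih_PORX by blast+
    show "(f, X, Y) \<in> rep_triples b k N ?e"
      using R XY PORX_id[OF XY(1)] PORX_id[OF XY(2)] unfolding rep_triples_def dih_rel_def fix_idems_def idems_def by blast
  qed
  then show ?thesis by auto
qed

lemma card_rep_triples_sum:
  assumes N: "N \<ge> 1"
  shows "card (rep_triples b k N (pid {1..k})) = (\<Sum>X\<in>Dih k. \<Sum>Y\<in>Dih k. if dih_rel k N X Y then card (fix_idems b k X Y) else 0)"
proof -
  let ?R = "{(X, Y). X \<in> Dih k \<and> Y \<in> Dih k \<and> dih_rel k N X Y}"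
  have fw: "finite (fix_idems b k X Y)" for X Y using finite_idems by (auto simp: fix_idems_def)
  have "bij_betw (\<lambda>(f, p). (p, f)) (rep_triples b k N (pid {1..k})) (SIGMA p:?R. fix_idems b k (fst p) (snd p))"
    unfolding rep_triples_id[OF N] by (rule bij_betwI[where g="\<lambda>(p, f). (f, p)"]) auto
  then have "card (rep_triples b k N (pid {1..k})) = card (SIGMA p:?R. fix_idems b k (fst p) (snd p))" by (rule bij_betw_same_card)
  also have "\<dots> = (\<Sum>p\<in>?R. card (fix_idems b k (fst p) (snd p)))"
    using finite_Dih[of k] by (intro card_SigmaI) (auto simp: fw intro: finite_subset[of _ "Dih k \<times> Dih k"])
  also have "\<dots> = (\<Sum>p\<in>Dih k \<times> Dih k. if dih_rel k N (fst p) (snd p) then card (fix_idems b k (fst p) (snd p)) else 0)"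
    by (rule sum.mono_neutral_cong_left) (use finite_Dih in auto)
  also have "\<dots> = (\<Sum>X\<in>Dih k. \<Sum>Y\<in>Dih k. if dih_rel k N X Y then card (fix_idems b k X Y) else 0)"
    by (simp add: sum.cartesian_product case_prod_beta)
  finally show ?thesis .
qed

text \<open>The range of \<open>f\<close> consists of fixed points of the rotation, and a nontrivial
  rotation has none.\<close>

lemma rot_no_fix:
  assumes "\<not> int k dvd t" "aff k 1 t \<circ>\<^sub>m f = f" shows "f = pid {}"
proof (rule map_eqI)
  fix x y
  have False if "f x = Some y"
  proof -
    have "(aff k 1 t \<circ>\<^sub>m f) x = aff k 1 t y" using that by simp
    then have "aff k 1 t y = Some y" using assms(2) that by simp
    then have "int k dvd int y - (int y + t)" by (simp add: aff_Some)
    then show False using assms(1) by simp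
  qed
  then show "f x = Some y \<longleftrightarrow> pid {} x = Some y" by auto
qed

lemma empty_fix_idems: "pid {} \<in> fix_idems b k X Y"
proof -
  have "pid {} \<circ>\<^sub>m Z = pid {}" "Z \<circ>\<^sub>m pid {} = pid {}" for Z :: "nat \<rightharpoonup> nat"
    by (intro map_eqI; simp add: map_comp_Some_iff)+
  then show ?thesis unfolding fix_idems_def idems_def using pid_PORX[of "{}" k b] by simp
qed

lemma fix_idems_eqI: "(\<And>f. f \<in> fix_idems b k X Y \<Longrightarrow> f = pid {}) \<Longrightarrow> card (fix_idems b k X Y) = 1"
  using empty_fix_idems[of b k X Y] by (metis One_nat_def card_1_singleton_iff is_singletonI' is_singleton_the_elem empty_iff)

lemma fix_idems_rot:
  assumes "\<not> int k dvd t"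
  shows "card (fix_idems b k (aff k 1 t) Y) = 1" "card (fix_idems b k X (aff k 1 t)) = 1"
proof -
  show "card (fix_idems b k (aff k 1 t) Y) = 1"
    by (rule fix_idems_eqI, rule rot_no_fix[OF assms]) (simp add: fix_idems_def)
  show "card (fix_idems b k X (aff k 1 t)) = 1"
    by (rule fix_idems_eqI, rule rot_no_fix[OF assms]) (simp add: fix_idems_def)
qed

text \<open>The product of two different reflections is a nontrivial rotation that also leaves
  \<open>f\<close> unchanged.\<close>

lemma fix_idems_refl2:
  assumes "\<not> int k dvd t - s" shows "card (fix_idems b k (aff k (-1) t) (aff k (-1) s)) = 1"
proof (rule fix_idems_eqI)
  fix f assume f: "f \<in> fix_idems b k (aff k (-1) t) (aff k (-1) s)"
  have "aff k 1 (t - s) \<circ>\<^sub>m f = aff k (-1) t \<circ>\<^sub>m (aff k (-1) s \<circ>\<^sub>m f)"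
    unfolding map_comp_assoc[symmetric] aff_comp by simp
  also have "\<dots> = f" using f by (simp add: fix_idems_def)
  finally show "f = pid {}" using rot_no_fix[OF assms] by simp
qed

abbreviation refl_num :: "bool \<Rightarrow> nat \<Rightarrow> int \<Rightarrow> nat" where
  "refl_num b k t \<equiv> card (fix_idems b k (aff k 1 0) (aff k (-1) t))"

lemma fix_idems_id:
  "fix_idems b k (aff k 1 0) (aff k 1 0) = idems b k"
  "fix_idems b k X (aff k 1 0) = fix_idems b k (aff k 1 0) X"
  "fix_idems b k X X = fix_idems b k (aff k 1 0) X"
  unfolding fix_idems_def aff_1_0 using PORX_id by (auto simp: idems_def)

section \<open>Pairs of dihedral elements satisfying the relations\<close>

lemma pow_at_rot: "pow_at (pid {1..k}) (aff k 1 t) i = aff k 1 (int i * t)"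
  by (induction i) (simp_all add: pow_at_Suc aff_1_0[symmetric] aff_comp algebra_simps del: One_nat_def)

lemma pow_at_refl: "pow_at (pid {1..k}) (aff k (-1) t) i = (if even i then aff k 1 0 else aff k (-1) t)"
  by (induction i) (simp_all add: pow_at_Suc aff_1_0[symmetric] aff_comp del: One_nat_def)

lemma refl_ne_rot: "k \<ge> 3 \<Longrightarrow> aff k (-1) s \<noteq> aff k 1 t"
  using zdvd_imp_le[of "int k" 2] by (auto simp: aff_eq_iff)

text \<open>In the names of this group of lemmas \<open>R\<close> is a rotation and \<open>F\<close>
  a reflection, first for \<open>X\<close> and then for \<open>Y\<close>. A reflection has order
  two, so it can replace the rotation of order \<open>N\<close> only if \<open>N\<close> is
  even.\<close>

lemma dih_rel_RR: "k \<ge> 1 \<Longrightarrow> dih_rel k N (aff k 1 t) (aff k 1 s) \<longleftrightarrow> int k dvd int N * t \<and> int k dvd 2 * s \<and> int k dvd 2 * t"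
  unfolding dih_rel_def pow_at_rot aff_comp by (simp add: aff_1_0[symmetric] aff_eq_iff algebra_simps del: One_nat_def)

lemma dih_rel_RF: "k \<ge> 1 \<Longrightarrow> dih_rel k N (aff k 1 t) (aff k (-1) s) \<longleftrightarrow> int k dvd int N * t"
  unfolding dih_rel_def pow_at_rot aff_comp by (simp add: aff_1_0[symmetric] aff_eq_iff algebra_simps del: One_nat_def)

lemma dih_rel_FR: "k \<ge> 3 \<Longrightarrow> dih_rel k N (aff k (-1) t) (aff k 1 s) \<longleftrightarrow> even N \<and> int k dvd 2 * s"
  unfolding dih_rel_def pow_at_refl aff_comp using refl_ne_rot[of k t 0]
  by (auto simp: aff_1_0[symmetric] aff_eq_iff algebra_simps simp del: One_nat_def)

lemma dih_rel_FF: "k \<ge> 3 \<Longrightarrow> dih_rel k N (aff k (-1) t) (aff k (-1) s) \<longleftrightarrow> even N \<and> int k dvd 2 * (t - s)"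
  unfolding dih_rel_def pow_at_refl aff_comp using refl_ne_rot[of k t 0]
  by (auto simp: aff_1_0[symmetric] aff_eq_iff algebra_simps simp del: One_nat_def)

lemma Dih_sum:
  assumes "k \<ge> 3"
  shows "(\<Sum>X\<in>Dih k. F X) = (\<Sum>t<k. F (aff k 1 (int t))) + (\<Sum>t<k. F (aff k (-1) (int t)) :: nat)"
proof -
  have "(\<Sum>X\<in>Dih k. F X) = (\<Sum>(a, t)\<in>{1, -1} \<times> {0..<int k}. F (aff k a t))"
  proof -
    have "k \<ge> 1" using assms by simp
    then show ?thesis
      unfolding Dih_param[OF \<open>k \<ge> 1\<close>] sum.reindex[OF Dih_inj_param[OF assms]] by (simp add: comp_def case_prod_beta)
  qed
  also have "\<dots> = (\<Sum>t\<in>{0..<int k}. F (aff k 1 t)) + (\<Sum>t\<in>{0..<int k}. F (aff k (-1) t))"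
    by (simp add: sum.cartesian_product[symmetric])
  also have "(\<Sum>t\<in>{0..<int k}. F (aff k 1 t)) = (\<Sum>t<k. F (aff k 1 (int t)))"
    by (rule sum.reindex_bij_witness[of _ int nat]) auto
  also have "(\<Sum>t\<in>{0..<int k}. F (aff k (-1) t)) = (\<Sum>t<k. F (aff k (-1) (int t)))"
    by (rule sum.reindex_bij_witness[of _ int nat]) auto
  finally show ?thesis .
qed

lemma half_dvd:
  assumes "t < k" shows "int k dvd 2 * int t \<longleftrightarrow> t = 0 \<or> 2 * t = k"
proof -
  have "int k dvd 2 * int t \<longleftrightarrow> k dvd 2 * t" by (metis of_nat_dvd_iff of_nat_mult of_nat_numeral)
  also have "\<dots> \<longleftrightarrow> t = 0 \<or> 2 * t = k"
  proof
    assume "k dvd 2 * t"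
    then obtain c where c: "2 * t = k * c" by (elim dvdE)
    then have "k * c < k * 2" using assms by linarith
    then have "c < 2" by simp
    then have "c = 0 \<or> c = 1" by linarith
    then show "t = 0 \<or> 2 * t = k" using c by auto
  qed auto
  finally show ?thesis .
qed

text \<open>\<open>k div gcd t k\<close> is the additive order of \<open>t\<close> modulo
  \<open>k\<close>, so this number counts the nontrivial rotations whose \<open>N\<close>-th power
  is trivial.\<close>

lemma eps_alt: assumes "k \<ge> 1" shows "\<epsilon> N k = card {t. 0 < t \<and> t < k \<and> int k dvd int N * int t}"
proof -
  have "k div gcd t k dvd N \<longleftrightarrow> int k dvd int N * int t" if "t > 0" for t
  proof -
    have g: "gcd t k > 0" using that by simp
    have kd: "k = gcd t k * (k div gcd t k)" by simp
    have td: "t = gcd t k * (t div gcd t k)" by simp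
    have "k dvd N * t \<longleftrightarrow> gcd t k * (k div gcd t k) dvd gcd t k * (N * (t div gcd t k))"
      using kd td by (metis mult.left_commute)
    also have "\<dots> \<longleftrightarrow> k div gcd t k dvd N * (t div gcd t k)"
      by (rule dvd_times_left_cancel_iff) (use g in simp)
    also have "\<dots> \<longleftrightarrow> k div gcd t k dvd N"
      using div_gcd_coprime[of t k] that coprime_dvd_mult_left_iff[of "k div gcd t k" "t div gcd t k" N]
      by (simp add: coprime_commute)
    finally show ?thesis by (metis of_nat_dvd_iff of_nat_mult)
  qed
  then show ?thesis unfolding \<epsilon>_def using assms by (intro arg_cong[where f=card]) auto
qed

text \<open>The factor \<open>if even N then 3 else 1\<close> is the number of subgroups of index two in the
  dihedral group of order \<open>2 * N\<close>.\<close>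

lemma card_rep_triples_dihedral:
  assumes k: "k \<ge> 3" and N: "N \<ge> 1"
  shows "card (rep_triples b k N (pid {1..k})) = card (idems b k) + k * \<epsilon> N k
     + (if even N then 3 else 1) * ((\<Sum>t<k. refl_num b k (int t)) + (if even k then 1 else 0)) + 2 * k * \<delta> N k"
proof -
  have k1: "k \<ge> 1" using k by simp
  let ?W = "\<Sum>t<k. refl_num b k (int t)"
  define F where "F a t a' s = (if dih_rel k N (aff k a (int t)) (aff k a' (int s)) then card (fix_idems b k (aff k a (int t)) (aff k a' (int s))) else 0)" for a a' and t s :: nat
  have nd: "\<not> int k dvd int t" if "t < k" "t \<noteq> 0" for t
    using that by (meson dvd_imp_le int_dvd_int_iff neq0_conv not_le)
  have nd2: "\<not> int k dvd int t - int s" if "t < k" "s < k" "t \<noteq> s" for t s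
  proof
    assume "int k dvd int t - int s"
    then have "\<bar>int k\<bar> \<le> \<bar>int t - int s\<bar>" using that by (intro dvd_imp_le_int) auto
    then show False using that by linarith
  qed
  \<comment> \<open>The rotations whose square is trivial.\<close>
  define B where "B = {t. t < k \<and> int k dvd 2 * int t}"
  have B: "B = (if even k then {0, k div 2} else {0})"
    using k unfolding B_def by (auto simp: half_dvd cong: conj_cong)
  have fB: "finite B" and B0: "0 \<in> B" and cB: "card B = (if even k then 2 else 1)"
    using k by (auto simp: B)
  have t0: "{..<k} = insert 0 {0<..<k}" using k by auto
  \<comment> \<open>The trivial pair admits every idempotent; any other pair contains a nontrivial
    rotation and admits only the empty one.\<close>
  have RR: "(\<Sum>t<k. \<Sum>s<k. F 1 t 1 s) = card (idems b k) + (if even k then (if even N then 3 else 1) else 0)"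
  proof -
    define A where "A = {t\<in>B. int k dvd int N * int t}"
    have "int k dvd int N * int (k div 2) \<longleftrightarrow> even N" if "even k"
    proof -
      obtain h where h: "k = 2 * h" using \<open>even k\<close> by (elim evenE)
      then have "h > 0" using k by simp
      then have "k dvd N * h \<longleftrightarrow> even N" unfolding h by simp
      then show ?thesis using h by (metis nonzero_mult_div_cancel_left of_nat_dvd_iff of_nat_mult zero_neq_numeral)
    qed
    then have A: "A = (if even k \<and> even N then {0, k div 2} else {0})" unfolding A_def B by auto
    have "(\<Sum>t<k. \<Sum>s<k. F 1 t 1 s) = (\<Sum>t<k. \<Sum>s<k. if t \<in> A \<and> s \<in> B then (if t = 0 \<and> s = 0 then card (idems b k) else 1) else 0)"
    proof (intro sum.cong refl)
      fix t s assume "t \<in> {..<k}" "s \<in> {..<k}"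
      then show "F 1 t 1 s = (if t \<in> A \<and> s \<in> B then (if t = 0 \<and> s = 0 then card (idems b k) else 1) else 0)"
        using fix_idems_rot(1)[OF nd, of t b] fix_idems_rot(2)[OF nd, of s b] fix_idems_id(1)[of b k]
        by (auto simp: F_def dih_rel_RR[OF k1] A_def B_def)
    qed
    also have "\<dots> = (\<Sum>t\<in>A. \<Sum>s\<in>B. if t = 0 \<and> s = 0 then card (idems b k) else 1)"
    proof -
      have sub: "A \<subseteq> {..<k}" "B \<subseteq> {..<k}" by (auto simp: A_def B_def)
      have inner: "(\<Sum>s<k. if t \<in> A \<and> s \<in> B then g t s else 0) = (\<Sum>s\<in>B. g t s)" if "t \<in> A" for t and g :: "nat \<Rightarrow> nat \<Rightarrow> nat"
        by (rule sum.mono_neutral_cong_right) (use sub that in auto)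
      have "(\<Sum>t<k. \<Sum>s<k. if t \<in> A \<and> s \<in> B then g t s else 0) = (\<Sum>t\<in>A. \<Sum>s\<in>B. g t s)" for g :: "nat \<Rightarrow> nat \<Rightarrow> nat"
        by (rule sum.mono_neutral_cong_right) (use sub inner in auto)
      then show ?thesis .
    qed
    also have "\<dots> = card (idems b k) + (if even k then (if even N then 3 else 1) else 0)"
      unfolding A B using k by auto
    finally show ?thesis .
  qed
  \<comment> \<open>For \<open>X\<close> trivial this is the total over all reflections. For each
    admissible nontrivial \<open>X\<close> all \<open>k\<close> reflections contribute one, namely
    the empty map.\<close>
  have RF: "(\<Sum>t<k. \<Sum>s<k. F 1 t (-1) s) = ?W + k * \<epsilon> N k"
  proof -
    have "(\<Sum>s<k. F 1 t (-1) s) = (if int k dvd int N * int t then k else 0)" if "t \<in> {0<..<k}" for t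
      using fix_idems_rot(1)[OF nd, of t b] that by (simp add: F_def dih_rel_RF[OF k1])
    then have "(\<Sum>t\<in>{0<..<k}. \<Sum>s<k. F 1 t (-1) s) = (\<Sum>t\<in>{0<..<k}. if int k dvd int N * int t then k else 0)" by simp
    also have "\<dots> = k * card {t. 0 < t \<and> t < k \<and> int k dvd int N * int t}"
      by (simp add: sum.If_cases mult.commute Collect_conj_eq[symmetric] greaterThanLessThan_def greaterThan_def lessThan_def Int_def conj_assoc)
    finally have "(\<Sum>t\<in>{0<..<k}. \<Sum>s<k. F 1 t (-1) s) = k * \<epsilon> N k" unfolding eps_alt[OF k1] .
    moreover have "(\<Sum>s<k. F 1 0 (-1) s) = ?W" by (simp add: F_def dih_rel_RF[OF k1])
    ultimately show ?thesis unfolding t0 by simp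
  qed
  \<comment> \<open>Here \<open>Y\<close> is a rotation with trivial square; only the trivial one
    allows more than the empty idempotent.\<close>
  have FR: "(\<Sum>t<k. \<Sum>s<k. F (-1) t 1 s) = (if even N then ?W + (if even k then k else 0) else 0)"
  proof (cases "even N")
    case True
    have "(\<Sum>s<k. F (-1) t 1 s) = refl_num b k (int t) + (if even k then 1 else 0)" for t
    proof -
      have "(\<Sum>s<k. F (-1) t 1 s) = (\<Sum>s<k. if s \<in> B then (if s = 0 then refl_num b k (int t) else 1) else 0)"
        using fix_idems_rot(2)[OF nd, of _ b] True
        by (intro sum.cong refl) (auto simp: F_def dih_rel_FR[OF k] B_def fix_idems_id(2))
      also have "\<dots> = (\<Sum>s\<in>B. if s = 0 then refl_num b k (int t) else 1)"
        by (rule sum.mono_neutral_cong_right) (auto simp: B_def)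
      also have "\<dots> = refl_num b k (int t) + (if even k then 1 else 0)" unfolding B using k by auto
      finally show ?thesis .
    qed
    then show ?thesis using True by (simp add: sum.distrib)
  qed (simp add: F_def dih_rel_FR[OF k])
  have FF: "(\<Sum>t<k. \<Sum>s<k. F (-1) t (-1) s) = (if even N then ?W + (if even k then k else 0) else 0)"
  proof (cases "even N")
    case True
    have "(\<Sum>s<k. F (-1) t (-1) s) = refl_num b k (int t) + (if even k then 1 else 0)" if t: "t < k" for t
    proof -
      \<comment> \<open>The reflections commuting with the given one: itself and, for even
        \<open>k\<close>, the one whose parameter is shifted by half the cycle.\<close>
      define C where "C = {s. s < k \<and> int k dvd 2 * (int t - int s)}"
      have "C = (if even k then {t, (t + k div 2) mod k} else {t})"
      proof -
        have "int k dvd 2 * (int t - int s) \<longleftrightarrow> s = t \<or> 2 * s = 2 * t + k \<or> 2 * t = 2 * s + k" if "s < k" for s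
        proof (cases "s \<le> t")
          case True
          then have "2 * (int t - int s) = 2 * int (t - s)" by simp
          then show ?thesis using half_dvd[of "t - s" k] True t by auto
        next
          case False
          then have "2 * (int t - int s) = - (2 * int (s - t))" by simp
          then have "int k dvd 2 * (int t - int s) \<longleftrightarrow> int k dvd 2 * int (s - t)" by (metis dvd_minus_iff)
          then show ?thesis using half_dvd[of "s - t" k] False that by auto
        qed
        then have C: "C = {s. s < k \<and> (s = t \<or> 2 * s = 2 * t + k \<or> 2 * t = 2 * s + k)}" unfolding C_def by blast
        show ?thesis
        proof (cases "even k")
          case True
          then obtain h where h: "k = 2 * h" by (elim evenE)
          show ?thesis
          proof (cases "t < h")
            case True
            then have "(t + k div 2) mod k = t + h" using h by simp
            then show ?thesis unfolding C using h t True by auto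
          next
            case False
            then have "(t + k div 2) mod k = t - h" using h t by (simp add: mod_if)
            then show ?thesis unfolding C using h t False by auto
          qed
        next
          case False
          then show ?thesis unfolding C using t by auto presburger+
        qed
      qed
      moreover have "(t + k div 2) mod k \<noteq> t" if "even k" using t k that by (auto simp: mod_if)
      ultimately have C: "t \<in> C" "card (C - {t}) = (if even k then 1 else 0)" "finite C" by auto
      have "(\<Sum>s<k. F (-1) t (-1) s) = (\<Sum>s<k. if s \<in> C then (if s = t then refl_num b k (int t) else 1) else 0)"
        using fix_idems_refl2[OF nd2, of t _ b] True t
        by (intro sum.cong refl) (auto simp: F_def dih_rel_FF[OF k] C_def fix_idems_id(3))
      also have "\<dots> = (\<Sum>s\<in>C. if s = t then refl_num b k (int t) else 1)"
        by (rule sum.mono_neutral_cong_right) (auto simp: C_def)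
      also have "\<dots> = refl_num b k (int t) + (\<Sum>s\<in>C - {t}. if s = t then refl_num b k (int t) else 1)"
        using C by (simp add: sum.remove)
      also have "(\<Sum>s\<in>C - {t}. if s = t then refl_num b k (int t) else 1) = (\<Sum>s\<in>C - {t}. 1)"
        by (rule sum.cong) auto
      finally show ?thesis using C by simp
    qed
    then show ?thesis using True by (simp add: sum.distrib)
  qed (simp add: F_def dih_rel_FF[OF k])
  have "card (rep_triples b k N (pid {1..k})) = (\<Sum>t<k. \<Sum>s<k. F 1 t 1 s) + (\<Sum>t<k. \<Sum>s<k. F 1 t (-1) s)
      + ((\<Sum>t<k. \<Sum>s<k. F (-1) t 1 s) + (\<Sum>t<k. \<Sum>s<k. F (-1) t (-1) s))"
    unfolding card_rep_triples_sum[OF N] Dih_sum[OF k] F_def by (simp add: sum.distrib)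
  then show ?thesis unfolding RR RF FR FF by (simp add: \<delta>_def)
qed

text \<open>Modulo 2 the multipliers 1 and -1 agree, so the unit group has order two. Each
  nontrivial homomorphism into it leaves only the empty idempotent, and these correspond to the
  index-two subgroups.\<close>

lemma card_rep_triples_2:
  assumes N: "N \<ge> 1"
  shows "card (rep_triples b 2 N (pid {1..2})) = card (idems b 2) + (if even N then 3 else 1)"
proof -
  let ?i = "aff 2 1 0" and ?z = "aff 2 1 1"
  have D: "Dih 2 = {?i, ?z}"
  proof -
    have "X \<in> {?i, ?z}" if X: "X \<in> Dih 2" for X
    proof -
      have "aff 2 (-1) t = aff 2 1 t" for t by (simp add: aff_eq_iff)
      moreover obtain a t where "a = 1 \<or> a = -1" "X = aff 2 a t" using X by (auto simp: Dih_def)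
      ultimately have "X = aff 2 1 t" by auto
      then show ?thesis by (simp add: aff_eq_iff)
    qed
    then have "Dih 2 \<subseteq> {?i, ?z}" by blast
    moreover have "?i \<in> Dih 2" "?z \<in> Dih 2" unfolding Dih_def by blast+
    ultimately show ?thesis by blast
  qed
  have ne: "?i \<noteq> ?z" by (simp add: aff_eq_iff)
  have "\<not> int 2 dvd (1::int)" by simp
  note w = fix_idems_rot[OF this, of b]
  show ?thesis
    unfolding card_rep_triples_sum[OF N] D using ne N by (simp add: dih_rel_RR fix_idems_id(1) w)
qed

lemma card_rep_triples_small:
  assumes N: "N \<ge> 1" and k: "k \<le> 1"
  shows "card (rep_triples b k N (pid {1..k})) = card (idems b k)"
proof -
  have "Dih k = {pid {1..k}}"
  proof (cases "k = 0")
    case True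
    then have "aff k a t = pid {1..k}" for a t by (auto simp: aff_def)
    then show ?thesis by (auto simp: Dih_def)
  next
    case False
    then have "k = 1" using k by simp
    then have "aff k a t = aff k 1 0" for a t by (simp add: aff_eq_iff)
    then show ?thesis by (auto simp: Dih_def aff_1_0)
  qed
  moreover have "dih_rel k N (pid {1..k}) (pid {1..k})"
  proof -
    have "pow_at (pid {1..k}) (pid {1..k}) i = pid {1..k}" for i
      by (induction i) (simp_all add: pow_at_Suc pid_comp_pid)
    then show ?thesis by (simp add: dih_rel_def pid_comp_pid)
  qed
  ultimately show ?thesis unfolding card_rep_triples_sum[OF N] using fix_idems_id(1)[of b k] by (simp add: aff_1_0)
qed

text \<open>Conjugation by the rotation by \<open>a\<close> shifts the parameter of a reflection by
  \<open>2 * a\<close> and carries invariant idempotents to invariant idempotents.\<close>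

lemma fix_idems_conj_rot:
  assumes k: "k \<ge> 1" shows "refl_num b k (t + 2 * a) = refl_num b k t"
proof (rule bij_betw_same_card)
  let ?r = "aff k 1 a" and ?q = "aff k 1 (- a)"
  have id: "aff k 1 0 = pid {1..k}" by (rule aff_1_0)
  have inv: "?r \<circ>\<^sub>m ?q = pid {1..k}" "?q \<circ>\<^sub>m ?r = pid {1..k}" by (simp_all add: aff_comp aff_1_0)
  have step: "q' \<circ>\<^sub>m (f \<circ>\<^sub>m r') \<in> fix_idems b k (aff k 1 0) (aff k (-1) s')"
    if f: "f \<in> fix_idems b k (aff k 1 0) (aff k (-1) s)" and q: "q' \<in> PORX b k" "r' \<in> PORX b k"
      and i: "r' \<circ>\<^sub>m q' = pid {1..k}" and c: "r' \<circ>\<^sub>m aff k (-1) s' = aff k (-1) s \<circ>\<^sub>m r'" "aff k (-1) s' \<circ>\<^sub>m q' = q' \<circ>\<^sub>m aff k (-1) s" for f q' r' s s'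
  proof -
    have fS: "f \<in> PORX b k" "f \<circ>\<^sub>m f = f" "f \<circ>\<^sub>m aff k (-1) s = f" "aff k (-1) s \<circ>\<^sub>m f = f" using f by (auto simp: fix_idems_def idems_def)
    let ?g = "q' \<circ>\<^sub>m (f \<circ>\<^sub>m r')"
    have gS: "?g \<in> PORX b k" using PORX_comp fS q by blast
    have "?g \<circ>\<^sub>m ?g = q' \<circ>\<^sub>m (f \<circ>\<^sub>m ((r' \<circ>\<^sub>m q') \<circ>\<^sub>m (f \<circ>\<^sub>m r')))" by (simp only: map_comp_assoc)
    also have "\<dots> = q' \<circ>\<^sub>m ((f \<circ>\<^sub>m f) \<circ>\<^sub>m r')" unfolding i PORX_id(1)[OF PORX_comp[OF q(2) fS(1)]] by (simp only: map_comp_assoc)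
    finally have 1: "?g \<circ>\<^sub>m ?g = ?g" using fS by simp
    have "?g \<circ>\<^sub>m aff k (-1) s' = q' \<circ>\<^sub>m ((f \<circ>\<^sub>m aff k (-1) s) \<circ>\<^sub>m r')" using c(1) by (simp only: map_comp_assoc)
    then have 2: "?g \<circ>\<^sub>m aff k (-1) s' = ?g" using fS by simp
    have "aff k (-1) s' \<circ>\<^sub>m ?g = q' \<circ>\<^sub>m ((aff k (-1) s \<circ>\<^sub>m f) \<circ>\<^sub>m r')"
      by (simp only: map_comp_assoc[symmetric] c(2))
    then have 3: "aff k (-1) s' \<circ>\<^sub>m ?g = ?g" using fS by simp
    show ?thesis using gS 1 2 3 PORX_id[OF gS] by (simp add: fix_idems_def idems_def id)
  qed
  have P: "?r \<in> PORX b k" "?q \<in> PORX b k" by (simp_all add: aff_PORX)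
  have fwd: "?q \<circ>\<^sub>m (f \<circ>\<^sub>m ?r) \<in> fix_idems b k (aff k 1 0) (aff k (-1) t)" if "f \<in> fix_idems b k (aff k 1 0) (aff k (-1) (t + 2 * a))" for f
    by (rule step[OF that P(2,1) inv(1)]) (simp_all add: aff_comp algebra_simps)
  have bwd: "?r \<circ>\<^sub>m (f \<circ>\<^sub>m ?q) \<in> fix_idems b k (aff k 1 0) (aff k (-1) (t + 2 * a))" if "f \<in> fix_idems b k (aff k 1 0) (aff k (-1) t)" for f
    by (rule step[OF that P inv(2)]) (simp_all add: aff_comp algebra_simps)
  have id2: "?r \<circ>\<^sub>m ((?q \<circ>\<^sub>m (f \<circ>\<^sub>m ?r)) \<circ>\<^sub>m ?q) = f" "?q \<circ>\<^sub>m ((?r \<circ>\<^sub>m (f \<circ>\<^sub>m ?q)) \<circ>\<^sub>m ?r) = f" if "f \<in> PORX b k" for f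
  proof -
    have "?r \<circ>\<^sub>m ((?q \<circ>\<^sub>m (f \<circ>\<^sub>m ?r)) \<circ>\<^sub>m ?q) = (?r \<circ>\<^sub>m ?q) \<circ>\<^sub>m (f \<circ>\<^sub>m (?r \<circ>\<^sub>m ?q))" by (simp only: map_comp_assoc)
    then show "?r \<circ>\<^sub>m ((?q \<circ>\<^sub>m (f \<circ>\<^sub>m ?r)) \<circ>\<^sub>m ?q) = f" unfolding inv using PORX_id[OF that] by simp
    have "?q \<circ>\<^sub>m ((?r \<circ>\<^sub>m (f \<circ>\<^sub>m ?q)) \<circ>\<^sub>m ?r) = (?q \<circ>\<^sub>m ?r) \<circ>\<^sub>m (f \<circ>\<^sub>m (?q \<circ>\<^sub>m ?r))" by (simp only: map_comp_assoc)
    then show "?q \<circ>\<^sub>m ((?r \<circ>\<^sub>m (f \<circ>\<^sub>m ?q)) \<circ>\<^sub>m ?r) = f" unfolding inv using PORX_id[OF that] by simp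
  qed
  have wsS: "f \<in> PORX b k" if "f \<in> fix_idems b k X Y" for f X Y using that by (simp add: fix_idems_def idems_def)
  show "bij_betw (\<lambda>f. ?q \<circ>\<^sub>m (f \<circ>\<^sub>m ?r)) (fix_idems b k (aff k 1 0) (aff k (-1) (t + 2 * a))) (fix_idems b k (aff k 1 0) (aff k (-1) t))"
    by (rule bij_betwI[where g="\<lambda>f. ?r \<circ>\<^sub>m (f \<circ>\<^sub>m ?q)"]) (use fwd bwd id2 wsS in auto)
qed

text \<open>A value \<open>y\<close> would satisfy \<open>2 * y = 1\<close> modulo an even number,
  so this reflection has no fixed point.\<close>

lemma refl_num_1: assumes "even k" shows "refl_num b k 1 = 1"
proof (rule fix_idems_eqI)
  fix f assume f: "f \<in> fix_idems b k (aff k 1 0) (aff k (-1) 1)"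
  show "f = pid {}"
  proof (rule map_eqI)
    fix x y
    have False if "f x = Some y"
    proof -
      have "(aff k (-1) 1 \<circ>\<^sub>m f) x = aff k (-1) 1 y" using that by simp
      moreover have "(aff k (-1) 1 \<circ>\<^sub>m f) x = f x" using f by (simp add: fix_idems_def)
      ultimately have "aff k (-1) 1 y = Some y" using that by simp
      then have "int k dvd int y - (- int y + 1)" by (simp add: aff_Some)
      then have "2 dvd int y - (- int y + 1)" using assms by (meson dvd_trans even_of_nat)
      then show False by presburger
    qed
    then show "f x = Some y \<longleftrightarrow> pid {} x = Some y" by auto
  qed
qed

text \<open>For odd \<open>k\<close> all reflections are conjugate under rotations. For even
  \<open>k\<close> there are two classes of equal size, one with two fixed points and one with
  none.\<close>

lemma sum_refl_num:
  assumes k: "k \<ge> 1"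
  shows "(\<Sum>t<k. refl_num b k (int t)) = (if even k then (k div 2) * (refl_num b k 0 + 1) else k * refl_num b k 0)"
proof (cases "even k")
  case True
  then obtain h where h: "k = 2 * h" by (elim evenE)
  have e: "refl_num b k (int t) = (if even t then refl_num b k 0 else 1)" for t
  proof (cases "even t")
    case True
    then obtain a where "t = 2 * a" by (elim evenE)
    then show ?thesis using fix_idems_conj_rot[OF k, of b 0 "int a"] True by simp
  next
    case False
    then obtain a where "t = 2 * a + 1" by (elim oddE)
    then show ?thesis using fix_idems_conj_rot[OF k, of b 1 "int a"] refl_num_1[OF \<open>even k\<close>, of b] False by (simp add: add.commute)
  qed
  have S: "(\<Sum>t<2 * m. if even t then c else 1) = m * (c + 1)" for m c :: nat
    by (induction m) (simp_all add: algebra_simps)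
  have "(\<Sum>t<k. refl_num b k (int t)) = (\<Sum>t<k. if even t then refl_num b k 0 else 1)" by (simp only: e)
  also have "\<dots> = h * (refl_num b k 0 + 1)" using S[of "refl_num b k 0" h] unfolding h[symmetric] .
  finally show ?thesis using True h by simp
next
  case False
  have "refl_num b k (int t) = refl_num b k 0" for t
  proof (cases "even t")
    case True
    then obtain a where "t = 2 * a" by (elim evenE)
    then show ?thesis using fix_idems_conj_rot[OF k, of b 0 "int a"] by simp
  next
    case odd: False
    then have "even (t + k)" using False by simp
    then obtain a where a: "t + k = 2 * a" by (elim evenE)
    \<comment> \<open>Parameters count modulo \<open>k\<close>, so for odd \<open>k\<close> every
      parameter has an even representative.\<close>
    have "aff k (-1) (int t) = aff k (-1) (int (2 * a))" using k by (simp add: aff_eq_iff a[symmetric])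
    then show ?thesis using fix_idems_conj_rot[OF k, of b 0 "int a"] by simp
  qed
  then show ?thesis using False by simp
qed

section \<open>Idempotents invariant under a reflection\<close>

lemma idems_True: "idems True k = pid ` Pow {1..k}"
proof
  show "pid ` Pow {1..k} \<subseteq> idems True k"
    using pid_PORX[of _ k True] by (auto simp: idems_def pid_comp_pid)
  show "idems True k \<subseteq> pid ` Pow {1..k}"
  proof
    fix e assume e: "e \<in> idems True k"
    then have ee: "e \<circ>\<^sub>m e = e" and i: "inj_on e (dom e)" and pt: "partial_transformation k e"
      by (auto simp: idems_def PORX_def)
    have i': "x = y" if "e x = Some a" "e y = Some a" for x y a
      by (rule i[unfolded inj_on_iff, rule_format, OF that])
    have "e x = Some y \<longleftrightarrow> x \<in> dom e \<and> y = x" for x y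
    proof
      assume a: "e x = Some y"
      have "e y = Some y" by (rule idem_fix[OF ee], rule ranI[of e x y], rule a)
      then show "x \<in> dom e \<and> y = x" using i'[OF a] a by blast
    next
      assume a: "x \<in> dom e \<and> y = x"
      then obtain z where z: "e x = Some z" by blast
      have "e z = Some z" by (rule idem_fix[OF ee], rule ranI[of e x z], rule z)
      then have "x = z" using i'[OF z] by simp
      then show "e x = Some y" using z a by simp
    qed
    then have "e = pid (dom e)" by (intro map_eqI) simp
    moreover have "dom e \<in> Pow {1..k}" using pt by (simp add: partial_transformation_def)
    ultimately show "e \<in> pid ` Pow {1..k}" by blast
  qed
qed

lemma pid_inj: "inj_on pid A"
  by (rule inj_onI) (metis dom_pid)

lemma refl_Some: assumes "k \<ge> 1" shows "aff k (-1) 0 x = Some x \<longleftrightarrow> 1 \<le> x \<and> (x = k \<or> 2 * x = k)"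
proof -
  have "int k dvd int x - (- int x) \<longleftrightarrow> x = k \<or> 2 * x = k" if "1 \<le> x" "x \<le> k"
  proof (cases "x = k")
    case False
    then have "int k dvd 2 * int x \<longleftrightarrow> 2 * x = k" using half_dvd[of x k] that by auto
    then show ?thesis using False by simp
  qed simp
  then show ?thesis using assms by (auto simp: aff_Some)
qed

text \<open>The idempotents are partial identities, and such a map is invariant exactly when its
  domain lies in the fixed point set of the reflection, which has one or two elements.\<close>

lemma refl_num_True_0:
  assumes k: "k \<ge> 1" shows "refl_num True k 0 = (if even k then 4 else 2)"
proof -
  let ?s = "aff k (-1) 0"
  define Fx where "Fx = {x. 1 \<le> x \<and> (x = k \<or> 2 * x = k)}"
  have Fx: "Fx = (if even k then {k div 2, k} else {k})" using k by (auto simp: Fx_def)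
  have s: "?s x = Some x \<longleftrightarrow> x \<in> Fx" for x using refl_Some[OF k] by (simp add: Fx_def)
  have "fix_idems True k (aff k 1 0) ?s = pid ` Pow Fx"
  proof
    show "fix_idems True k (aff k 1 0) ?s \<subseteq> pid ` Pow Fx"
    proof
      fix f assume f: "f \<in> fix_idems True k (aff k 1 0) ?s"
      then obtain A where A: "f = pid A" by (auto simp: fix_idems_def idems_True)
      have "A \<subseteq> Fx"
      proof
        fix x assume x: "x \<in> A"
        have "(?s \<circ>\<^sub>m f) x = f x" using f by (simp add: fix_idems_def)
        then show "x \<in> Fx" using x s[of x] by (simp add: A)
      qed
      then show "f \<in> pid ` Pow Fx" using A by blast
    qed
    show "pid ` Pow Fx \<subseteq> fix_idems True k (aff k 1 0) ?s"
    proof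
      fix f assume "f \<in> pid ` Pow Fx"
      then obtain A where A: "A \<subseteq> Fx" "f = pid A" by blast
      have "Fx \<subseteq> {1..k}" by (auto simp: Fx_def)
      then have i: "f \<in> idems True k" using A by (auto simp: idems_True)
      have u: "?s x = Some y \<longleftrightarrow> y = x" if "x \<in> A" for x y using s[of x] that A by auto
      have inj: "?s x = Some y \<and> y \<in> A \<longleftrightarrow> x = y \<and> y \<in> A" for x y
      proof
        assume a: "?s x = Some y \<and> y \<in> A"
        then have "?s y = Some y" using u by blast
        then show "x = y \<and> y \<in> A" using a aff_inj[of k "-1" "-1" 0] unfolding inj_on_iff by auto
      qed (use u in auto)
      have "?s \<circ>\<^sub>m f = f" unfolding A(2) by (rule map_eqI) (use u in \<open>auto simp: map_comp_Some_iff\<close>)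
      moreover have "f \<circ>\<^sub>m ?s = f" unfolding A(2) by (rule map_eqI) (use inj in \<open>auto simp: map_comp_Some_iff\<close>)
      moreover have "f \<in> PORX True k" using i by (simp add: idems_def)
      ultimately show "f \<in> fix_idems True k (aff k 1 0) ?s" using i PORX_id[of f True k] by (simp add: fix_idems_def aff_1_0)
    qed
  qed
  then have "refl_num True k 0 = card (Pow Fx)" using card_image[OF pid_inj] by simp
  also have "\<dots> = 2 ^ card Fx" by (rule card_Pow) (simp add: Fx)
  also have "card Fx = (if even k then 2 else 1)" unfolding Fx using k by auto
  finally show ?thesis by simp
qed

text \<open>An idempotent invariant under the reflection fixing \<open>k\<close> is encoded by the sets of distances
  to \<open>k\<close> at which its value is \<open>k\<close>, respectively \<open>k div 2\<close>.\<close>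

definition fold_pairs :: "nat \<Rightarrow> (nat set \<times> nat set) set" where
  "fold_pairs k = {(P, Q). P \<subseteq> {0..k div 2} \<and> Q \<subseteq> {0..k div 2} \<and> (P \<noteq> {} \<longrightarrow> 0 \<in> P) \<and>
     (Q \<noteq> {} \<longrightarrow> even k \<and> k div 2 \<in> Q) \<and> (\<forall>p\<in>P. \<forall>q\<in>Q. p < q)}"

text \<open>Distance from \<open>k\<close> along the cycle, a complete invariant of the orbits of
  the reflection.\<close>

definition fold_pt :: "nat \<Rightarrow> nat \<Rightarrow> nat" where "fold_pt k x = (if x = k then 0 else min x (k - x))"

definition decode :: "nat \<Rightarrow> nat set \<times> nat set \<Rightarrow> (nat \<rightharpoonup> nat)" where
  "decode k = (\<lambda>(P, Q) x. if x \<in> {1..k} then (if fold_pt k x \<in> P then Some k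
      else if fold_pt k x \<in> Q then Some (k div 2) else None) else None)"

lemma refl_fold:
  assumes "aff k (-1) 0 x = Some y" shows "x \<in> {1..k}" "y \<in> {1..k}" "fold_pt k y = fold_pt k x" "y = (if x = k then k else k - x)"
proof -
  show xy: "x \<in> {1..k}" "y \<in> {1..k}" using assms by (auto simp: aff_Some)
  have d: "int k dvd int y + int x" using assms by (simp add: aff_Some)
  show y: "y = (if x = k then k else k - x)"
  proof (cases "x = k")
    case True
    then have "int k dvd int y" using d by (metis dvd_add_triv_right_iff)
    then show ?thesis using True xy by (metis atLeastAtMost_iff dvd_imp_le int_dvd_int_iff le_antisym not_one_le_zero not_gr_zero)
  next
    case False
    have "aff k (-1) 0 x = Some (k - x)" unfolding aff_Some using False xy by (auto simp: of_nat_diff)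
    then show ?thesis using assms False by simp
  qed
  show "fold_pt k y = fold_pt k x" using xy by (auto simp: y fold_pt_def)
qed

lemma decode_Some:
  assumes "\<forall>p\<in>P. \<forall>q\<in>Q. p < q"
  shows "decode k (P, Q) x = Some y \<longleftrightarrow> x \<in> {1..k} \<and> (fold_pt k x \<in> P \<and> y = k \<or> fold_pt k x \<in> Q \<and> y = k div 2)"
proof -
  have "\<not> (fold_pt k x \<in> P \<and> fold_pt k x \<in> Q)" using assms by (metis less_irrefl)
  then show ?thesis by (auto simp: decode_def)
qed

lemma decode_fix_idems:
  assumes k: "k \<ge> 1" and pq: "(P, Q) \<in> fold_pairs k"
  shows "decode k (P, Q) \<in> fix_idems False k (aff k 1 0) (aff k (-1) 0)"
proof -
  let ?f = "decode k (P, Q)" and ?s = "aff k (-1) 0"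
  have lt: "\<forall>p\<in>P. \<forall>q\<in>Q. p < q" and P0: "P \<noteq> {} \<Longrightarrow> 0 \<in> P" and Qh: "Q \<noteq> {} \<Longrightarrow> even k \<and> k div 2 \<in> Q"
    using pq by (auto simp: fold_pairs_def)
  note S = decode_Some[OF lt]
  have hh: "1 \<le> k div 2 \<and> k div 2 \<le> k" if "Q \<noteq> {}" using Qh[OF that] k by (auto elim!: evenE)
  have pt: "partial_transformation k ?f"
  proof -
    have "x \<in> {1..k} \<and> y \<in> {1..k}" if "?f x = Some y" for x y
      using that k hh unfolding S by auto
    then show ?thesis unfolding partial_transformation_def dom_def ran_def by blast
  qed
  \<comment> \<open>Going around once, the values are \<open>k\<close>, then \<open>k div 2\<close>,
    then \<open>k\<close> again. Placed on sheets 0, 1 and 1 they increase and stay within one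
    period.\<close>
  have "lift_of k ?f (\<lambda>x. if 2 * x < k \<and> fold_pt k x \<in> P then 0 else 1)"
    unfolding lift_of_def
  proof (intro allI impI)
    fix x y a b assume h: "?f x = Some a" "?f y = Some b" "x \<le> y"
    then have x: "1 \<le> x" "x \<le> k" "1 \<le> y" "y \<le> k" and a: "fold_pt k x \<in> P \<and> a = k \<or> fold_pt k x \<in> Q \<and> a = k div 2"
      and b: "fold_pt k y \<in> P \<and> b = k \<or> fold_pt k y \<in> Q \<and> b = k div 2" unfolding S by auto
    have disj: "\<not> (fold_pt k z \<in> P \<and> fold_pt k z \<in> Q)" for z using lt by (metis less_irrefl)
    have no1: False if "fold_pt k x \<in> Q" "fold_pt k y \<in> P" "2 * y < k"
    proof -
      have "fold_pt k y < fold_pt k x" using lt that by blast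
      then show False using that(3) h(3) x by (auto simp: fold_pt_def split: if_splits)
    qed
    have no2: False if "fold_pt k x \<in> P" "fold_pt k y \<in> Q" "\<not> 2 * x < k"
    proof -
      have "fold_pt k x < fold_pt k y" using lt that by blast
      then show False using that(3) h(3) x by (auto simp: fold_pt_def split: if_splits)
    qed
    have kk: "int (k div 2) \<le> int k" by simp
    show "int a + int k * (if 2 * x < k \<and> fold_pt k x \<in> P then 0 else 1) \<le> int b + int k * (if 2 * y < k \<and> fold_pt k y \<in> P then 0 else 1) \<and>
      int b + int k * (if 2 * y < k \<and> fold_pt k y \<in> P then 0 else 1) \<le> int a + int k * (if 2 * x < k \<and> fold_pt k x \<in> P then 0 else 1) + int k"
      using a b disj[of x] disj[of y] no1 no2 kk h(3) by (cases "2 * x < k"; cases "2 * y < k") auto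
  qed
  then have "oriented ?f" using opres_imp_oriented[OF pt] by (auto simp: opres_def)
  then have fS: "?f \<in> PORX False k" using pt by (simp add: PORX_def)
  have fk: "?f k = Some k" if "P \<noteq> {}" using P0[OF that] k unfolding S by (simp add: fold_pt_def)
  have fh: "?f (k div 2) = Some (k div 2)" if "Q \<noteq> {}"
    using Qh[OF that] k unfolding S by (auto simp: fold_pt_def elim!: evenE)
  have fxv: "?f y = Some y" if "?f x = Some y" for x y using that fk fh unfolding S[of _ x] by auto
  have ff: "?f \<circ>\<^sub>m ?f = ?f"
    by (rule map_eqI) (use fxv in \<open>auto simp: map_comp_Some_iff\<close>)
  have sy: "?s y = Some y" if "?f x = Some y" for x y
  proof -
    consider "y = k" | "fold_pt k x \<in> Q" "y = k div 2" using \<open>?f x = Some y\<close> unfolding S by blast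
    then show ?thesis
    proof cases
      case 2
      then have "Q \<noteq> {}" by blast
      then have "1 \<le> y" "2 * y = k" using Qh hh 2(2) by auto
      then show ?thesis using refl_Some[OF k] by simp
    qed (use refl_Some[OF k] k in simp)
  qed
  have "?s \<circ>\<^sub>m ?f = ?f"
    by (rule map_eqI) (use sy in \<open>force simp: map_comp_Some_iff\<close>)
  moreover have "?f \<circ>\<^sub>m ?s = ?f"
  proof
    fix x
    show "(?f \<circ>\<^sub>m ?s) x = ?f x"
    proof (cases "?s x")
      case None
      then have "x \<notin> {1..k}" by (auto simp: aff_def split: if_splits)
      then show ?thesis using None by (auto simp: decode_def)
    next
      case (Some y)
      note r = refl_fold[OF Some]
      then have "?f y = ?f x" by (simp add: decode_def)
      then show ?thesis using Some by simp
    qed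
  qed
  ultimately show ?thesis using fS ff PORX_id[OF fS] by (simp add: fix_idems_def idems_def aff_1_0)
qed

lemma decode_inj: assumes k: "k \<ge> 1" shows "inj_on (decode k) (fold_pairs k)"
proof (rule inj_onI, clarify)
  fix P Q P' Q' assume h: "(P, Q) \<in> fold_pairs k" "(P', Q') \<in> fold_pairs k" "decode k (P, Q) = decode k (P', Q')"
  have lt: "\<forall>p\<in>P. \<forall>q\<in>Q. p < q" "\<forall>p\<in>P'. \<forall>q\<in>Q'. p < q" using h by (auto simp: fold_pairs_def)
  define pt where "pt y = (if y = 0 then k else y)" for y
  have pt: "fold_pt k (pt y) = y" "pt y \<in> {1..k}" if "y \<in> {0..k div 2}" for y
    using that k by (auto simp: pt_def fold_pt_def)
  have ne: "k \<noteq> k div 2" using k by auto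
  have char: "y \<in> A \<longleftrightarrow> y \<in> {0..k div 2} \<and> decode k (A, B) (pt y) = Some k"
    "y \<in> B \<longleftrightarrow> y \<in> {0..k div 2} \<and> decode k (A, B) (pt y) = Some (k div 2)"
    if "(A, B) \<in> fold_pairs k" for y A B
  proof -
    have l: "\<forall>p\<in>A. \<forall>q\<in>B. p < q" and s: "A \<subseteq> {0..k div 2}" "B \<subseteq> {0..k div 2}" using that by (auto simp: fold_pairs_def)
    show "y \<in> A \<longleftrightarrow> y \<in> {0..k div 2} \<and> decode k (A, B) (pt y) = Some k"
      using pt[of y] s ne unfolding decode_Some[OF l] by auto
    show "y \<in> B \<longleftrightarrow> y \<in> {0..k div 2} \<and> decode k (A, B) (pt y) = Some (k div 2)"
      using pt[of y] s ne unfolding decode_Some[OF l] by auto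
  qed
  have "P = P'" using char(1)[OF h(1)] char(1)[OF h(2)] h(3) by auto
  moreover have "Q = Q'" using char(2)[OF h(1)] char(2)[OF h(2)] h(3) by auto
  ultimately show "P = P' \<and> Q = Q'" by simp
qed

lemma decode_surj:
  assumes k: "k \<ge> 1" and f: "f \<in> fix_idems False k (aff k 1 0) (aff k (-1) 0)"
  shows "f \<in> decode k ` fold_pairs k"
proof -
  let ?s = "aff k (-1) 0" and ?h = "k div 2"
  have fS: "f \<in> PORX False k" and ff: "f \<circ>\<^sub>m f = f" and fs: "f \<circ>\<^sub>m ?s = f" and sf: "?s \<circ>\<^sub>m f = f"
    using f by (auto simp: fix_idems_def idems_def)
  note pt = PORX_pt[OF fS]
  have val: "1 \<le> y \<and> (y = k \<or> 2 * y = k)" if "f x = Some y" for x y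
  proof -
    have "(?s \<circ>\<^sub>m f) x = Some y" using sf that by simp
    then have "?s y = Some y" using that by simp
    then show ?thesis using refl_Some[OF k] by simp
  qed
  have fixv: "f y = Some y" if "f x = Some y" for x y using idem_fix[OF ff] that by (auto simp: ran_def)
  \<comment> \<open>Representative of the orbit at distance \<open>y\<close>, with \<open>k\<close>
    itself at distance 0.\<close>
  define pp where "pp y = (if y = 0 then k else y)" for y
  define P where "P = {y \<in> {0..?h}. f (pp y) = Some k}"
  define Q where "Q = {y \<in> {0..?h}. f (pp y) = Some ?h \<and> even k}"
  have sym: "f x = f (pp (fold_pt k x))" if "x \<in> {1..k}" for x
  proof (cases "x = k \<or> 2 * x \<le> k")
    case True
    then show ?thesis using that by (auto simp: pp_def fold_pt_def)
  next
    case False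
    have "?s x \<noteq> None" using that by (simp add: aff_def)
    then obtain y where y: "?s x = Some y" by blast
    have "f x = (f \<circ>\<^sub>m ?s) x" using fs by simp
    also have "\<dots> = f y" using y by simp
    also have "y = pp (fold_pt k x)" using refl_fold(4)[OF y] False that by (auto simp: pp_def fold_pt_def)
    finally show ?thesis .
  qed
  have fld: "fold_pt k x \<in> {0..?h}" if "x \<in> {1..k}" for x using that by (auto simp: fold_pt_def)
  have hk: "?h < k" using k by auto
  have k2: "2 * y = k \<longleftrightarrow> even k \<and> y = ?h" for y by auto
  \<comment> \<open>If some \<open>q\<close> were smaller than \<open>p\<close>, the points
    \<open>q\<close>, \<open>p\<close>, \<open>k div 2\<close>, \<open>k\<close> would carry the
    values \<open>k div 2\<close>, \<open>k\<close>, \<open>k div 2\<close>, \<open>k\<close>: one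
    sheet change in the middle, yet first and last value on the same sheet.\<close>
  have lt: "\<forall>p\<in>P. \<forall>q\<in>Q. p < q"
  proof (intro ballI, rule ccontr)
    fix p q assume p: "p \<in> P" and q: "q \<in> Q" and n: "\<not> p < q"
    have pv: "f (pp p) = Some k" "p \<le> ?h" and qv: "f (pp q) = Some ?h" "even k" using p q by (auto simp: P_def Q_def)
    have "q \<noteq> p" using pv qv hk by auto
    then have qp: "q < p" using n by simp
    have "f k = Some k" "f ?h = Some ?h" using fixv pv qv by blast+
    moreover have "q \<noteq> 0"
    proof
      assume "q = 0"
      then have "f k = Some ?h" using qv(1) by (simp add: pp_def)
      then show False using \<open>f k = Some k\<close> hk by simp
    qed
    moreover have "p \<noteq> ?h" using pv(1) \<open>f ?h = Some ?h\<close> hk qp by (auto simp: pp_def)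
    ultimately have v: "f q = Some ?h" "f p = Some k" "f ?h = Some ?h" "f k = Some k" "q \<le> p" "p \<le> ?h" "?h \<le> k" "q \<le> k"
      using pv qv qp hk by (auto simp: pp_def)
    \<comment> \<open>Only two values occur, so preservation may be assumed even when
      \<open>f\<close> is given as reversing.\<close>
    have "opres k f"
    proof (rule opres_of_two_values[OF pt _ hk])
      show "oriented f" using fS by (simp add: PORX_def)
      show "ran f \<subseteq> {?h, k}" using val k2 by (auto simp: ran_def)
    qed
    then obtain m where m: "lift_of k f m" by (auto simp: opres_def)
    note sh = lift_of_sheets[OF pt m]
    have "m q \<le> m p" by (rule sh(1)[OF v(1,2,5)])
    moreover have "m p \<noteq> m ?h" using sh(3)[OF v(2,3,6)] hk by auto
    moreover have "m p \<le> m ?h" by (rule sh(1)[OF v(2,3,6)])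
    moreover have "m ?h \<le> m k" by (rule sh(1)[OF v(3,4,7)])
    ultimately have "m k \<noteq> m q" by linarith
    then show False using sh(4)[OF v(1,4,8)] hk by simp
  qed
  have "(P, Q) \<in> fold_pairs k"
  proof -
    have "0 \<in> P" if ne: "P \<noteq> {}"
    proof -
      obtain y where "f (pp y) = Some k" using ne by (auto simp: P_def)
      then have "f k = Some k" using fixv by blast
      then show ?thesis by (simp add: P_def pp_def)
    qed
    moreover have "even k \<and> ?h \<in> Q" if ne: "Q \<noteq> {}"
    proof -
      obtain y where y: "f (pp y) = Some ?h" "even k" using ne by (auto simp: Q_def)
      then have "f ?h = Some ?h" using fixv by blast
      moreover have "?h \<noteq> 0" using y(2) k by (auto elim!: evenE)
      ultimately show ?thesis using y by (simp add: Q_def pp_def)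
    qed
    moreover have "P \<subseteq> {0..?h}" "Q \<subseteq> {0..?h}" by (auto simp: P_def Q_def)
    ultimately show ?thesis using lt by (simp add: fold_pairs_def)
  qed
  moreover have "f = decode k (P, Q)"
  proof (rule map_eqI)
    fix x y
    show "f x = Some y \<longleftrightarrow> decode k (P, Q) x = Some y"
    proof
      assume a: "f x = Some y"
      then have x: "x \<in> {1..k}" using pt_val[OF pt] by auto
      then show "decode k (P, Q) x = Some y"
        unfolding decode_Some[OF lt] using sym[OF x] fld[OF x] val[OF a] a k2 by (auto simp: P_def Q_def)
    next
      assume "decode k (P, Q) x = Some y"
      then show "f x = Some y"
        unfolding decode_Some[OF lt] using sym[of x] by (auto simp: P_def Q_def)
    qed
  qed
  ultimately show ?thesis by blast
qed

section \<open>Counting the codes\<close>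

definition sep_pairs :: "nat \<Rightarrow> (nat set \<times> nat set) set" where
  "sep_pairs m = {(P, Q). P \<subseteq> {1..m} \<and> Q \<subseteq> {1..m} \<and> (\<forall>p\<in>P. \<forall>q\<in>Q. p < q)}"

text \<open>The new element \<open>m + 1\<close> lies in \<open>P\<close>, which forces
  \<open>Q\<close> to be empty, or in \<open>Q\<close>, or in neither. So the count \<open>c\<close>
  satisfies \<open>c (m + 1) = 2 * c m + 2 ^ m\<close>; it is doubled here to avoid a
  division.\<close>

lemma card_sep_pairs: "finite (sep_pairs m) \<and> 2 * card (sep_pairs m) = (m + 2) * 2 ^ m"
proof (induction m)
  case 0
  have "sep_pairs 0 = {({}, {})}" by (auto simp: sep_pairs_def)
  then show ?case by simp
next
  case (Suc m)
  have fin: "finite (sep_pairs m)" for m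
    by (rule finite_subset[of _ "Pow {1..m} \<times> Pow {1..m}"]) (auto simp: sep_pairs_def)
  let ?A = "(\<lambda>P. (insert (Suc m) P, {} :: nat set)) ` Pow {1..m}"
  let ?B = "(\<lambda>(P, Q). (P, insert (Suc m) Q)) ` sep_pairs m"
  have eq: "sep_pairs (Suc m) = ?A \<union> (?B \<union> sep_pairs m)"
  proof
    show "sep_pairs (Suc m) \<subseteq> ?A \<union> (?B \<union> sep_pairs m)"
    proof (rule subsetI, rule ccontr)
      fix z assume z: "z \<in> sep_pairs (Suc m)" "z \<notin> ?A \<union> (?B \<union> sep_pairs m)"
      obtain P Q where PQz: "z = (P, Q)" by (cases z)
      have h: "(P, Q) \<in> sep_pairs (Suc m)" and nB: "(P, Q) \<notin> ?B" and nC: "(P, Q) \<notin> sep_pairs m"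
        and nA: "(P, Q) \<notin> ?A"
        using z unfolding PQz by blast+
      have fold_pairs: "P \<subseteq> {1..Suc m}" "Q \<subseteq> {1..Suc m}" "\<forall>p\<in>P. \<forall>q\<in>Q. p < q" using h by (auto simp: sep_pairs_def)
      have sub: "X - {Suc m} \<subseteq> {1..m}" if "X \<subseteq> {1..Suc m}" for X using that by (auto simp: subset_iff le_Suc_eq)
      have "Suc m \<in> P"
      proof (rule ccontr)
        assume nP: "Suc m \<notin> P"
        then have P: "P \<subseteq> {1..m}" using sub[OF fold_pairs(1)] by simp
        then have "(P, Q - {Suc m}) \<in> sep_pairs m" using sub[OF fold_pairs(2)] fold_pairs(3) by (auto simp: sep_pairs_def)
        moreover have "Suc m \<in> Q"
        proof (rule ccontr)
          assume "Suc m \<notin> Q"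
          then have "(P, Q) \<in> sep_pairs m" using \<open>(P, Q - {Suc m}) \<in> sep_pairs m\<close> by simp
          then show False using nC by simp
        qed
        ultimately have "(\<lambda>(P, Q). (P, insert (Suc m) Q)) (P, Q - {Suc m}) \<in> ?B" by (rule_tac imageI)
        then show False using nB \<open>Suc m \<in> Q\<close> by (simp add: insert_absorb)
      qed
      moreover have "Q = {}"
      proof (rule ccontr)
        assume "Q \<noteq> {}"
        then obtain q where "q \<in> Q" by blast
        then have "Suc m < q" "q \<le> Suc m" using fold_pairs calculation by auto
        then show False by simp
      qed
      ultimately have "(P, Q) = (\<lambda>P. (insert (Suc m) P, {})) (P - {Suc m})" by (simp add: insert_absorb)
      then have "(P, Q) \<in> ?A" using sub[OF fold_pairs(1)] by blast
      then show False using nA by simp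
    qed
    show "?A \<union> (?B \<union> sep_pairs m) \<subseteq> sep_pairs (Suc m)"
      by (auto simp: sep_pairs_def subset_iff less_Suc_eq_le le_SucI)
  qed
  have nm: "Suc m \<notin> P" if "P \<subseteq> {1..m}" for P using that by auto
  have "card ?A = 2 ^ m"
  proof -
    have "inj_on (\<lambda>P. (insert (Suc m) P, {} :: nat set)) (Pow {1..m})"
      using nm by (auto intro!: inj_onI) (metis insert_ident)+
    then show ?thesis by (simp add: card_image card_Pow)
  qed
  moreover have "card ?B = card (sep_pairs m)"
  proof (rule card_image, rule inj_onI)
    fix z z' assume z: "z \<in> sep_pairs m" "z' \<in> sep_pairs m"
      "(\<lambda>(P, Q). (P, insert (Suc m) Q)) z = (\<lambda>(P, Q). (P, insert (Suc m) Q)) z'"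
    obtain P Q P' Q' where pq: "z = (P, Q)" "z' = (P', Q')" by (cases z, cases z')
    have "Suc m \<notin> Q" "Suc m \<notin> Q'" using nm z(1,2) by (auto simp: sep_pairs_def pq)
    then show "z = z'" using z(3) by (simp add: pq insert_ident)
  qed
  moreover have "?B \<inter> sep_pairs m = {}" "?A \<inter> (?B \<union> sep_pairs m) = {}" using nm by (auto simp: sep_pairs_def)
  ultimately have "card (sep_pairs (Suc m)) = 2 ^ m + (card (sep_pairs m) + card (sep_pairs m))"
    unfolding eq using fin by (simp add: card_Un_disjoint)
  then show ?case using Suc fin by (simp add: algebra_simps)
qed

text \<open>Split by which of the two sets are empty. When both are nonempty, 0 and
  \<open>k div 2\<close> are forced members and what remains is a separated pair strictly between
  them.\<close>

lemma card_fold_pairs: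
  assumes k: "k \<ge> 1"
  shows "card (fold_pairs k) = 1 + 2 ^ (k div 2) + (if even k then 2 ^ (k div 2) + card (sep_pairs (k div 2 - 1)) else 0)"
proof -
  let ?h = "k div 2"
  let ?A = "(\<lambda>P. (insert 0 P, {} :: nat set)) ` Pow {1..?h}"
  let ?B = "(\<lambda>Q. ({} :: nat set, insert ?h Q)) ` Pow {0..<?h}"
  let ?C = "(\<lambda>(P, Q). (insert 0 P, insert ?h Q)) ` sep_pairs (?h - 1)"
  have e0: "({}, {}) \<in> fold_pairs k" by (auto simp: fold_pairs_def)
  have h1: "?h \<ge> 1" if "even k" using that k by (auto elim!: evenE)
  have cA: "card ?A = 2 ^ ?h"
  proof -
    have "0 \<notin> P" if "P \<subseteq> {1..?h}" for P using that by auto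
    then have "inj_on (\<lambda>P. (insert 0 P, {} :: nat set)) (Pow {1..?h})"
      by (auto intro!: inj_onI) (metis insert_ident)+
    then show ?thesis by (simp add: card_image card_Pow)
  qed
  have cB: "card ?B = 2 ^ ?h"
  proof -
    have "?h \<notin> P" if "P \<subseteq> {0..<?h}" for P using that by auto
    then have "inj_on (\<lambda>Q. ({} :: nat set, insert ?h Q)) (Pow {0..<?h})"
      by (auto intro!: inj_onI) (metis insert_ident)+
    then show ?thesis by (simp add: card_image card_Pow)
  qed
  have cC: "card ?C = card (sep_pairs (?h - 1))"
  proof (rule card_image, rule inj_onI, clarify)
    fix P Q P' Q' assume h: "(P, Q) \<in> sep_pairs (?h - 1)" "(P', Q') \<in> sep_pairs (?h - 1)"
      "insert 0 P = insert 0 P'" "insert ?h Q = insert ?h Q'"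
    have "0 \<notin> P" "0 \<notin> P'" "?h \<notin> Q" "?h \<notin> Q'" using h by (auto simp: sep_pairs_def subset_iff)
    then show "P = P' \<and> Q = Q'" using h(3,4) insert_ident by metis
  qed
  have finC: "finite ?C" using card_sep_pairs by blast
  have split: "fold_pairs k = {({}, {})} \<union> (?A \<union> (if even k then ?B \<union> ?C else {}))" (is "_ = ?R")
  proof
    show "fold_pairs k \<subseteq> ?R"
    proof (rule subsetI, rule ccontr)
      fix z assume z: "z \<in> fold_pairs k" "z \<notin> ?R"
      obtain P Q where PQz: "z = (P, Q)" by (cases z)
      have h: "(P, Q) \<in> fold_pairs k" and nR: "(P, Q) \<notin> ?A \<union> (if even k then ?B \<union> ?C else {})"
        using z unfolding PQz by blast+
      have fold_pairs: "P \<subseteq> {0..?h}" "Q \<subseteq> {0..?h}" "P \<noteq> {} \<Longrightarrow> 0 \<in> P" "Q \<noteq> {} \<Longrightarrow> even k \<and> ?h \<in> Q" "\<forall>p\<in>P. \<forall>q\<in>Q. p < q"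
        using h by (auto simp: fold_pairs_def)
      have Q0: "Q = {}"
      proof (rule ccontr)
        assume Q: "Q \<noteq> {}"
        then have hQ: "even k" "?h \<in> Q" using fold_pairs(4) by auto
        show False
        proof (cases "P = {}")
          case True
          have "Q - {?h} \<in> Pow {0..<?h}" using fold_pairs(2) by (auto simp: subset_iff le_less)
          then have "(\<lambda>Q. ({}, insert ?h Q)) (Q - {?h}) \<in> ?B" by (rule imageI)
          then show False using nR hQ True by (simp add: insert_absorb)
        next
          case False
          then have P0: "0 \<in> P" using fold_pairs(3) by simp
          have p: "p < ?h" if "p \<in> P" for p using fold_pairs(5) hQ that by blast
          have q: "0 < q" if "q \<in> Q" for q using fold_pairs(5) P0 that by blast
          have "(P - {0}, Q - {?h}) \<in> sep_pairs (?h - 1)"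
            unfolding sep_pairs_def using fold_pairs(5)
          proof (clarsimp, intro conjI)
            show "P - {0} \<subseteq> {Suc 0..?h - Suc 0}" using p by fastforce
            show "Q - {?h} \<subseteq> {Suc 0..?h - Suc 0}"
            proof
              fix x assume x: "x \<in> Q - {?h}"
              then have "x \<le> ?h" using fold_pairs(2) by auto
              then show "x \<in> {Suc 0..?h - Suc 0}" using q[of x] x by auto
            qed
          qed
          then have "(\<lambda>(P, Q). (insert 0 P, insert ?h Q)) (P - {0}, Q - {?h}) \<in> ?C" by (rule imageI)
          then show False using nR hQ P0 by (simp add: insert_absorb)
        qed
      qed
      moreover have "P = {}"
      proof (rule ccontr)
        assume "P \<noteq> {}"
        then have P0: "0 \<in> P" using fold_pairs(3) by simp
        have "P - {0} \<in> Pow {1..?h}" using fold_pairs(1) by (auto simp: subset_iff)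
        then have "(\<lambda>P. (insert 0 P, {})) (P - {0}) \<in> ?A" by (rule imageI)
        then show False using nR P0 Q0 by (simp add: insert_absorb)
      qed
      ultimately show False using z(2) PQz by simp
    qed
    have "?A \<subseteq> fold_pairs k" by (auto simp: fold_pairs_def)
    moreover have "?B \<subseteq> fold_pairs k" if "even k" using that by (auto simp: fold_pairs_def)
    moreover have "?C \<subseteq> fold_pairs k" if "even k"
    proof (clarify)
      fix P Q assume h: "(P, Q) \<in> sep_pairs (?h - 1)"
      have "p < ?h" if "p \<in> P" for p using h that h1[OF \<open>even k\<close>] by (fastforce simp: sep_pairs_def)
      moreover have "0 < q" "q < ?h" if "q \<in> Q" for q using h that h1[OF \<open>even k\<close>] by (fastforce simp: sep_pairs_def)+
      ultimately show "(insert 0 P, insert ?h Q) \<in> fold_pairs k"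
        using h h1[OF \<open>even k\<close>] \<open>even k\<close> by (auto simp: fold_pairs_def sep_pairs_def less_imp_le)
    qed
    ultimately show "?R \<subseteq> fold_pairs k" using e0 by auto
  qed
  have d: "{({}, {})} \<inter> (?A \<union> (?B \<union> ?C)) = {}" "?A \<inter> (?B \<union> ?C) = {}" "?B \<inter> ?C = {}" "{({}, {})} \<inter> ?A = {}" by auto
  show ?thesis
  proof (cases "even k")
    case True
    then have "fold_pairs k = {({}, {})} \<union> (?A \<union> (?B \<union> ?C))" using split by simp
    then have "card (fold_pairs k) = 1 + (card ?A + (card ?B + card ?C))"
      using d finC by (simp only: card_Un_disjoint finite_Un finite_imageI finite_Pow_iff finite_atLeastAtMost finite_atLeastLessThan finite.intros card.insert card.empty) simp
    then show ?thesis using True cA cB cC by simp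
  next
    case False
    then have "fold_pairs k = {({}, {})} \<union> ?A" using split by simp
    then have "card (fold_pairs k) = 1 + card ?A"
      using d(4) by (simp add: card_Un_disjoint)
    then show ?thesis using False cA by simp
  qed
qed

lemma refl_num_False_0:
  assumes k: "k \<ge> 1"
  shows "refl_num False k 0 = 1 + 2 ^ (k div 2) + (if even k then 2 ^ (k div 2) + card (sep_pairs (k div 2 - 1)) else 0)"
proof -
  have "fix_idems False k (aff k 1 0) (aff k (-1) 0) = decode k ` fold_pairs k"
    using decode_surj[OF k] decode_fix_idems[OF k] by auto
  then show ?thesis using card_image[OF decode_inj[OF k]] card_fold_pairs[OF k] by simp
qed

section \<open>Counting idempotents by rank\<close>

text \<open>The sum over all compositions of \<open>d\<close> into \<open>r\<close> parts of the
  product of the parts: a gap of length \<open>h\<close> between consecutive fixed points can be cut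
  in \<open>h\<close> places.\<close>

fun arc_num :: "nat \<Rightarrow> nat \<Rightarrow> nat" where
  "arc_num d 0 = (if d = 0 then 1 else 0)"
| "arc_num d (Suc r) = (\<Sum>h\<in>{1..d}. h * arc_num (d - h) r)"

text \<open>The index \<open>r\<close> counts the gaps between consecutive fixed points of the arc,
  hence rank \<open>Suc r\<close>.\<close>

definition arc_idems :: "nat \<Rightarrow> nat \<Rightarrow> nat \<Rightarrow> (nat \<rightharpoonup> nat) set" where
  "arc_idems p q r = {g. dom g = {p..q} \<and> g p = Some p \<and> g q = Some q \<and>
     (\<forall>x y. g x = Some y \<longrightarrow> g y = Some y) \<and>
     (\<forall>x y a b. g x = Some a \<longrightarrow> g y = Some b \<longrightarrow> x \<le> y \<longrightarrow> a \<le> b) \<and> card (ran g) = Suc r}"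

lemma arc_idemsI:
  assumes "dom g = {p..q}" "g p = Some p" "g q = Some q" "\<And>x y. g x = Some y \<Longrightarrow> g y = Some y"
    "\<And>x y a b. g x = Some a \<Longrightarrow> g y = Some b \<Longrightarrow> x \<le> y \<Longrightarrow> a \<le> b" "card (ran g) = Suc r"
  shows "g \<in> arc_idems p q r"
  unfolding arc_idems_def mem_Collect_eq by (intro conjI allI impI) (fact assms | (rule assms; assumption))+

lemma arc_idemsD:
  assumes "g \<in> arc_idems p q r"
  shows "x \<in> {p..q} \<longleftrightarrow> (\<exists>y. g x = Some y)" "g p = Some p" "g q = Some q" "g x = Some y \<Longrightarrow> g y = Some y"
    "g x = Some a \<Longrightarrow> g y = Some b \<Longrightarrow> x \<le> y \<Longrightarrow> a \<le> b" "card (ran g) = Suc r"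
    "g x = Some y \<Longrightarrow> p \<le> y \<and> y \<le> q" "g x = Some y \<Longrightarrow> p \<le> x \<and> x \<le> q" "finite (ran g)"
proof -
  have d: "dom g = {p..q}" and e: "g p = Some p" "g q = Some q"
    and m: "\<And>x y a b. g x = Some a \<Longrightarrow> g y = Some b \<Longrightarrow> x \<le> y \<Longrightarrow> a \<le> b"
    using assms unfolding arc_idems_def by blast+
  show "x \<in> {p..q} \<longleftrightarrow> (\<exists>y. g x = Some y)" unfolding d[symmetric] by auto
  show "g p = Some p" "g q = Some q" by (rule e)+
  show "g x = Some y \<Longrightarrow> g y = Some y" using assms unfolding arc_idems_def by blast
  show "g x = Some a \<Longrightarrow> g y = Some b \<Longrightarrow> x \<le> y \<Longrightarrow> a \<le> b" by (rule m)
  show c: "card (ran g) = Suc r" using assms unfolding arc_idems_def by blast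
  then show "finite (ran g)" by (metis card.infinite nat.distinct(1))
  assume a: "g x = Some y"
  then have "x \<in> {p..q}" unfolding d[symmetric] by auto
  then show "p \<le> x \<and> x \<le> q" by simp
  then show "p \<le> y \<and> y \<le> q" using m[OF e(1) a] m[OF a e(2)] by auto
qed

lemma arc_idems_ran: "g \<in> arc_idems p q r \<Longrightarrow> y \<in> ran g \<Longrightarrow> p \<le> y \<and> y \<le> q"
  unfolding ran_def by (auto dest: arc_idemsD(7))

text \<open>Appends a last gap: \<open>s\<close> is the fixed point before \<open>q\<close>, and
  \<open>t\<close> is the last point of the gap that still goes to \<open>s\<close>.\<close>

definition arc_ext :: "nat \<Rightarrow> nat \<times> nat \<times> (nat \<rightharpoonup> nat) \<Rightarrow> (nat \<rightharpoonup> nat)" where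
  "arc_ext q = (\<lambda>(s, t, g) x. if x \<le> s then g x else if x \<le> t then Some s else if x \<le> q then Some q else None)"

lemma arc_ext_Some:
  "arc_ext q (s, t, g) x = Some y \<longleftrightarrow> (x \<le> s \<and> g x = Some y) \<or> (s < x \<and> x \<le> t \<and> y = s) \<or> (s < x \<and> t < x \<and> x \<le> q \<and> y = q)"
  by (auto simp: arc_ext_def)

lemma ran_arc_ext:
  assumes g: "g \<in> arc_idems p s r" and st: "s \<le> t" "t < q" shows "ran (arc_ext q (s, t, g)) = insert q (ran g)"
proof (rule equalityI; rule subsetI)
  fix y assume "y \<in> ran (arc_ext q (s, t, g))"
  then show "y \<in> insert q (ran g)" using arc_idemsD(3)[OF g] by (auto simp: ran_def arc_ext_Some)
next
  fix y assume "y \<in> insert q (ran g)"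
  then consider "y = q" | x where "g x = Some y" by (auto simp: ran_def)
  then show "y \<in> ran (arc_ext q (s, t, g))"
  proof cases
    case 1
    then have "arc_ext q (s, t, g) q = Some y" using st by (simp add: arc_ext_Some)
    then show ?thesis by (rule ranI)
  next
    case 2
    then have "arc_ext q (s, t, g) x = Some y" using arc_idemsD(8)[OF g 2] by (simp add: arc_ext_Some)
    then show ?thesis by (rule ranI)
  qed
qed

lemma arc_ext_arc_idems:
  assumes "p \<le> s" and g: "g \<in> arc_idems p s r" and st: "s \<le> t" "t < q"
  shows "arc_ext q (s, t, g) \<in> arc_idems p q (Suc r)"
proof -
  let ?e = "arc_ext q (s, t, g)"
  have q: "q \<notin> ran g" using arc_idems_ran[OF g, of q] st by auto
  have "card (ran ?e) = Suc (Suc r)"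
    unfolding ran_arc_ext[OF g st] using q arc_idemsD(6,9)[OF g] by simp
  moreover have "dom ?e = {p..q}"
  proof (rule equalityI; rule subsetI)
    fix x assume "x \<in> dom ?e"
    then show "x \<in> {p..q}" using arc_idemsD(8)[OF g, of x] assms by (auto simp: arc_ext_Some)
  next
    fix x assume x: "x \<in> {p..q}"
    then have "\<exists>y. ?e x = Some y"
      unfolding arc_ext_Some using arc_idemsD(1)[OF g, of x] st by (cases "x \<le> s"; cases "x \<le> t") auto
    then show "x \<in> dom ?e" by auto
  qed
  moreover have "?e p = Some p" "?e q = Some q" using arc_idemsD(2)[OF g] assms by (simp_all add: arc_ext_Some)
  moreover have "?e y = Some y" if "?e x = Some y" for x y
    using that arc_idemsD(3)[OF g] arc_idemsD(4,7)[OF g, of x y] st unfolding arc_ext_Some by auto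
  moreover have "a \<le> b" if "?e x = Some a" "?e y = Some b" "x \<le> y" for x y a b
    using that arc_idemsD(5)[OF g, of x a y b] arc_idemsD(7)[OF g, of x a] arc_idemsD(7)[OF g, of y b] st unfolding arc_ext_Some by auto
  ultimately show ?thesis by (simp add: arc_idems_def)
qed

lemma arc_ext_inj:
  "inj_on (arc_ext q) (SIGMA s:{p..<q}. {s..<q} \<times> arc_idems p s r)"
proof (rule inj_onI)
  fix z z' assume z: "z \<in> (SIGMA s:{p..<q}. {s..<q} \<times> arc_idems p s r)" "z' \<in> (SIGMA s:{p..<q}. {s..<q} \<times> arc_idems p s r)"
    "arc_ext q z = arc_ext q z'"
  obtain s t g s' t' g' where e: "z = (s, t, g)" "z' = (s', t', g')" by (cases z, cases z') auto
  have s: "p \<le> s" "s \<le> t" "t < q" "p \<le> s'" "s' \<le> t'" "t' < q" and g: "g \<in> arc_idems p s r" "g' \<in> arc_idems p s' r"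
    and eq: "arc_ext q (s, t, g) = arc_ext q (s', t', g')"
    using z unfolding e by auto
  have "q \<notin> ran g" "q \<notin> ran g'" using arc_idems_ran[OF g(1), of q] arc_idems_ran[OF g(2), of q] s by auto
  then have r: "ran g = ran g'"
    using ran_arc_ext[OF g(1) s(2,3)] ran_arc_ext[OF g(2) s(5,6)] eq by (metis insert_ident)
  have "s \<in> ran g" "s' \<in> ran g'" using arc_idemsD(3)[OF g(1)] arc_idemsD(3)[OF g(2)] by (auto intro: ranI)
  then have ss: "s = s'" using r arc_idems_ran[OF g(1), of s'] arc_idems_ran[OF g(2), of s] by auto
  have "g x = g' x" for x
  proof (cases "x \<le> s")
    case True
    then show ?thesis using fun_cong[OF eq, of x] ss by (simp add: arc_ext_def)
  next
    case False
    then have "g x = None" "g' x = None"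
      using arc_idemsD(8)[OF g(1), of x] arc_idemsD(8)[OF g(2), of x] ss by (metis not_None_eq)+
    then show ?thesis by simp
  qed
  then have gg: "g = g'" by (rule ext)
  have "t = t'"
  proof (rule ccontr)
    assume "t \<noteq> t'"
    then consider "t < t'" | "t' < t" by linarith
    then show False
    proof cases
      case 1
      then have "arc_ext q (s, t, g) t' = Some q" "arc_ext q (s', t', g') t' = Some s" using s ss by (auto simp: arc_ext_Some)
      then show False using eq s by simp
    next
      case 2
      then have "arc_ext q (s, t, g) t = Some s" "arc_ext q (s', t', g') t = Some q" using s ss by (auto simp: arc_ext_Some)
      then show False using eq s by simp
    qed
  qed
  then show "z = z'" using ss gg e by simp
qed

text \<open>The last gap is recovered as follows: \<open>s\<close> is the largest value below
  \<open>q\<close>, and \<open>t\<close> the last point with value \<open>s\<close>. Monotonicity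
  leaves only the values \<open>s\<close> and \<open>q\<close> in between.\<close>

lemma arc_ext_surj:
  assumes "p \<le> q" and g: "g \<in> arc_idems p q (Suc r)"
  shows "g \<in> arc_ext q ` (SIGMA s:{p..<q}. {s..<q} \<times> arc_idems p s r)"
proof -
  note L = arc_idemsD[OF g]
  have pq: "p \<noteq> q"
  proof
    assume e: "p = q"
    have "ran g \<subseteq> {p}" using arc_idems_ran[OF g] e by fastforce
    then have "card (ran g) \<le> 1" using card_mono[of "{p}" "ran g"] by simp
    then show False using L(6) by simp
  qed
  let ?R = "ran g - {q}"
  define s where "s = Max ?R"
  have R: "finite ?R" "p \<in> ?R" using L(9) pq ranI[of g p p] L(2) by auto
  have sR: "s \<in> ?R" unfolding s_def using R by (intro Max_in) auto
  have smax: "y \<le> s" if "y \<in> ?R" for y unfolding s_def using R that by simp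
  obtain xs where "g xs = Some s" using sR by (auto simp: ran_def)
  then have gs: "g s = Some s" and sq: "p \<le> s" "s \<le> q" using L(4,7) by blast+
  then have sq: "p \<le> s" "s < q" using sR by auto
  define t where "t = Max {x. g x = Some s}"
  have fT: "finite {x. g x = Some s}" by (rule finite_subset[of _ "{p..q}"]) (use L(8) in auto)
  have tT: "g t = Some s" using Max_in[OF fT] gs by (auto simp: t_def)
  have tmax: "x \<le> t" if "g x = Some s" for x unfolding t_def using fT that by simp
  have st: "s \<le> t" using tmax[OF gs] .
  have tq: "t < q" using L(8)[OF tT] tT L(3) sq by (cases "t = q") auto
  define g' where "g' = g |` {..s}"
  have g': "g' x = Some y \<longleftrightarrow> x \<le> s \<and> g x = Some y" for x y by (auto simp: g'_def restrict_map_def)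
  have low: "y \<le> s" if "x \<le> s" "g x = Some y" for x y using L(5)[OF that(2) gs that(1)] .
  have rg: "ran g' = ?R"
  proof (rule equalityI; rule subsetI)
    fix y assume "y \<in> ran g'"
    then obtain x where x: "x \<le> s" "g x = Some y" by (auto simp: ran_def g')
    have "y \<in> ran g" by (rule ranI[of g x y], rule x(2))
    then show "y \<in> ?R" using low[OF x] sq by auto
  next
    fix y assume y: "y \<in> ?R"
    then obtain x where "g x = Some y" by (auto simp: ran_def)
    then have "g y = Some y" by (rule L(4))
    then have "g' y = Some y" using smax[OF y] by (simp add: g')
    then show "y \<in> ran g'" by (rule ranI)
  qed
  have "g' \<in> arc_idems p s r"
  proof (rule arc_idemsI)
    have "x \<in> dom g' \<longleftrightarrow> x \<in> {p..s}" for x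
    proof -
      have "x \<in> dom g' \<longleftrightarrow> x \<le> s \<and> x \<in> {p..q}" unfolding L(1) by (auto simp: g' dom_def)
      then show ?thesis using sq by auto
    qed
    then show "dom g' = {p..s}" by blast
    show "g' p = Some p" "g' s = Some s" using gs L(2) sq by (simp_all add: g')
    show "g' y = Some y" if "g' x = Some y" for x y
    proof -
      have "x \<le> s" "g x = Some y" using that g' by blast+
      then show ?thesis using low[of x y] L(4)[of x y] by (simp add: g')
    qed
    show "a \<le> b" if "g' x = Some a" "g' y = Some b" "x \<le> y" for x y a b
      by (rule L(5)[of x a y b]) (use that g' in blast)+
    show "card (ran g') = Suc r"
      unfolding rg using L(6,9) ranI[of g q q] L(3) by simp
  qed
  moreover have "g = arc_ext q (s, t, g')"
  proof
    fix x
    consider "x \<le> s" | "s < x" "x \<le> t" | "t < x" "x \<le> q" | "q < x" by linarith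
    then show "g x = arc_ext q (s, t, g') x"
    proof cases
      case 1
      then show ?thesis by (simp add: arc_ext_def g'_def)
    next
      case 2
      then have "x \<in> {p..q}" using sq tq by auto
      then obtain y where y: "g x = Some y" using L(1) by blast
      have "s \<le> y" "y \<le> s" using L(5)[OF gs y] L(5)[OF y tT] 2 by auto
      then show ?thesis using 2 y by (simp add: arc_ext_def)
    next
      case 3
      then have "x \<in> {p..q}" using sq st by auto
      then obtain y where y: "g x = Some y" using L(1) by blast
      have "s \<le> y" using L(5)[OF tT y] 3 by auto
      moreover have "y \<noteq> s" using tmax[of x] y 3 by auto
      ultimately have "y = q" using smax[of y] ranI[of g x y] y by fastforce
      then show ?thesis using 3 y st by (simp add: arc_ext_def)
    next
      case 4
      then have "g x = None" using L(8)[of x] by (cases "g x") auto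
      then show ?thesis using 4 sq tq by (simp add: arc_ext_def)
    qed
  qed
  ultimately show ?thesis using sq st tq by (intro image_eqI[where x="(s, t, g')"]) auto
qed

lemma card_arc_idems: "p \<le> q \<Longrightarrow> finite (arc_idems p q r) \<and> card (arc_idems p q r) = arc_num (q - p) r"
proof (induction r arbitrary: q)
  case 0
  show ?case
  proof (cases "p = q")
    case True
    have "arc_idems p q 0 = {\<lambda>x. if x = p then Some p else None}" (is "_ = {?u}")
    proof
      show "arc_idems p q 0 \<subseteq> {?u}"
      proof
        fix g assume g: "g \<in> arc_idems p q 0"
        have "g x = ?u x" for x
          using arc_idemsD(2)[OF g] arc_idemsD(8)[OF g, of x] True by (cases "g x") auto
        then show "g \<in> {?u}" by blast
      qed
      have "dom ?u = {p..q}" "ran ?u = {p}" using True by (auto simp: dom_def ran_def)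
      then show "{?u} \<subseteq> arc_idems p q 0" using True by (auto simp: arc_idems_def split: if_splits)
    qed
    then show ?thesis using True by simp
  next
    case False
    have "arc_idems p q 0 = {}"
    proof (rule ccontr)
      assume "arc_idems p q 0 \<noteq> {}"
      then obtain g where g: "g \<in> arc_idems p q 0" by blast
      have "{p, q} \<subseteq> ran g" using arc_idemsD(2,3)[OF g] by (auto intro: ranI)
      then have "card {p, q} \<le> card (ran g)" using arc_idemsD(9)[OF g] card_mono by blast
      then show False using arc_idemsD(6)[OF g] False by simp
    qed
    then show ?thesis using False 0 by simp
  qed
next
  case (Suc r)
  let ?S = "SIGMA s:{p..<q}. {s..<q} \<times> arc_idems p s r"
  have eq: "arc_idems p q (Suc r) = arc_ext q ` ?S"
    using arc_ext_surj[OF Suc.prems] arc_ext_arc_idems by (auto 0 3)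
  have IH: "finite (arc_idems p s r)" "card (arc_idems p s r) = arc_num (s - p) r" if "s \<in> {p..<q}" for s
    using Suc.IH[of s] that by auto
  have fin: "finite ?S" using IH by (intro finite_SigmaI) auto
  have "card (arc_idems p q (Suc r)) = card ?S"
    unfolding eq by (rule card_image[OF arc_ext_inj])
  \<comment> \<open>The factor \<open>q - s\<close> is the number of cuts \<open>t\<close> in the
    last gap.\<close>
  also have "card ?S = (\<Sum>s\<in>{p..<q}. (q - s) * arc_num (s - p) r)"
    using IH by (subst card_SigmaI) (auto simp: card_cartesian_product)
  also have "\<dots> = (\<Sum>h\<in>{1..q - p}. h * arc_num (q - p - h) r)"
    by (rule sum.reindex_bij_witness[of _ "\<lambda>h. q - h" "\<lambda>s. q - s"]) auto
  finally show ?case using fin unfolding eq by simp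
qed

section \<open>Total idempotents on the cycle\<close>

definition full_idems :: "nat \<Rightarrow> nat \<Rightarrow> (nat \<rightharpoonup> nat) set" where
  "full_idems i r = {e \<in> idems False i. dom e = {1..i} \<and> card (ran e) = r}"

text \<open>On the wrap-around arc from the largest fixed point \<open>q\<close> to the smallest one \<open>p\<close>, the
  points up to and including \<open>c\<close> go to \<open>q\<close> and the others to \<open>p\<close>.\<close>

definition wrap :: "nat \<Rightarrow> nat \<times> nat \<times> nat \<times> (nat \<rightharpoonup> nat) \<Rightarrow> (nat \<rightharpoonup> nat)" where
  "wrap i = (\<lambda>(p, q, c, g) x. if p \<le> x \<and> x \<le> q then g x else if 1 \<le> x \<and> x \<le> i then
      (if (if c < p then x \<le> c \<or> q < x else q < x \<and> x \<le> c) then Some q else Some p) else None)"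

text \<open>The cut runs cyclically from \<open>q\<close> to \<open>p - 1\<close>, with 0 standing
  for \<open>i\<close>, which gives \<open>i - (q - p)\<close> positions. At 0 every point after
  \<open>q\<close> goes to \<open>q\<close> and every point before \<open>p\<close> goes to
  \<open>p\<close>.\<close>

definition wrap_dom :: "nat \<Rightarrow> nat \<Rightarrow> (nat \<times> nat \<times> nat \<times> (nat \<rightharpoonup> nat)) set" where
  "wrap_dom i r = (SIGMA p:{1..i}. SIGMA q:{p<..i}. ({0..<i} - {p..<q}) \<times> arc_idems p q r)"

lemma wrap_Some:
  assumes "g \<in> arc_idems p q r"
  shows "wrap i (p, q, c, g) x = Some y \<longleftrightarrow> g x = Some y \<or>
    (1 \<le> x \<and> x \<le> i \<and> (x < p \<or> q < x) \<and>
     (if (if c < p then x \<le> c \<or> q < x else q < x \<and> x \<le> c) then y = q else y = p))"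
  using arc_idemsD(8)[OF assms, of x y] by (auto simp: wrap_def)

lemma ran_wrap:
  assumes g: "g \<in> arc_idems p q r" and pq: "1 \<le> p" "p \<le> q" "q \<le> i"
  shows "ran (wrap i (p, q, c, g)) = ran g"
proof (rule equalityI; rule subsetI)
  fix y assume "y \<in> ran (wrap i (p, q, c, g))"
  then obtain x where "wrap i (p, q, c, g) x = Some y" by (auto simp: ran_def)
  then have "g x = Some y \<or> y = q \<or> y = p" unfolding wrap_Some[OF g] by (auto split: if_splits)
  then show "y \<in> ran g" using arc_idemsD(2,3)[OF g] by (auto intro: ranI)
next
  fix y assume "y \<in> ran g"
  then obtain x where "g x = Some y" by (auto simp: ran_def)
  then have "wrap i (p, q, c, g) x = Some y" unfolding wrap_Some[OF g] by simp
  then show "y \<in> ran (wrap i (p, q, c, g))" by (rule ranI)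
qed

lemma wrap_full_idems:
  assumes g: "g \<in> arc_idems p q r" and pq: "1 \<le> p" "p < q" "q \<le> i" and c: "c < i" "c < p \<or> q \<le> c"
  shows "wrap i (p, q, c, g) \<in> full_idems i (Suc r)"
proof -
  let ?e = "wrap i (p, q, c, g)"
  note S = wrap_Some[OF g, of i c] and L = arc_idemsD[OF g]
  have r: "ran ?e = ran g" using ran_wrap[OF g] pq by simp
  have d: "dom ?e = {1..i}"
  proof (rule equalityI; rule subsetI)
    fix x assume "x \<in> dom ?e"
    then obtain y where "?e x = Some y" by blast
    then show "x \<in> {1..i}" unfolding S using L(8)[of x y] pq by auto
  next
    fix x assume x: "x \<in> {1..i}"
    have "\<exists>y. ?e x = Some y"
    proof (cases "x \<in> {p..q}")
      case True
      then show ?thesis unfolding S using L(1) by blast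
    next
      case False
      then show ?thesis using x by (auto simp: wrap_def)
    qed
    then show "x \<in> dom ?e" by auto
  qed
  have pt: "partial_transformation i ?e"
    unfolding partial_transformation_def d r using L(7) pq by (auto simp: ran_def) fastforce+
  have fixv: "?e y = Some y" if "?e x = Some y" for x y
  proof -
    have "y \<in> ran g" using r that by (metis ranI)
    then obtain z where "g z = Some y" by (auto simp: ran_def)
    then have "g y = Some y" by (rule L(4))
    then show ?thesis unfolding S by simp
  qed
  \<comment> \<open>Points before \<open>p\<close> that still belong to \<open>q\<close> lie one
    sheet below, points after \<open>q\<close> that already belong to \<open>p\<close> one sheet
    above.\<close>
  define m :: "nat \<Rightarrow> int" where
    "m x = (if x < p \<and> c < p \<and> x \<le> c then -1 else if q < x \<and> \<not> (c < p \<or> x \<le> c) then 1 else 0)" for x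
  have "lift_of i ?e m"
    unfolding lift_of_def
  proof (intro allI impI)
    fix x y a b assume h: "?e x = Some a" "?e y = Some b" "x \<le> y"
    have v: "(p \<le> z \<and> z \<le> q \<and> g z = Some w \<and> p \<le> w \<and> w \<le> q \<and> m z = 0) \<or>
        (z < p \<and> c < p \<and> z \<le> c \<and> w = q \<and> m z = -1) \<or> (z < p \<and> \<not> (c < p \<and> z \<le> c) \<and> w = p \<and> m z = 0) \<or>
        (q < z \<and> (c < p \<or> z \<le> c) \<and> w = q \<and> m z = 0) \<or> (q < z \<and> \<not> (c < p \<or> z \<le> c) \<and> w = p \<and> m z = 1)"
      if "?e z = Some w" for z w
      using that pq c L(7,8)[of z w] unfolding S m_def by (auto split: if_splits)
    show "int a + int i * m x \<le> int b + int i * m y \<and> int b + int i * m y \<le> int a + int i * m x + int i"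
      using v[OF h(1)] v[OF h(2)] h(3) L(5)[of x a y b] pq by (elim disjE conjE) simp_all
  qed
  then have "oriented ?e" using opres_imp_oriented[OF pt] by (auto simp: opres_def)
  moreover have "?e \<circ>\<^sub>m ?e = ?e" by (rule map_eqI) (use fixv in \<open>auto simp: map_comp_Some_iff\<close>)
  ultimately show ?thesis using pt d r L(6) by (simp add: full_idems_def idems_def PORX_def)
qed

lemma wrap_inj: "inj_on (wrap i) (wrap_dom i r)"
proof (rule inj_onI)
  fix z z' assume z: "z \<in> wrap_dom i r" "z' \<in> wrap_dom i r" "wrap i z = wrap i z'"
  obtain p q c g p' q' c' g' where e: "z = (p, q, c, g)" "z' = (p', q', c', g')" by (cases z, cases z') auto
  have pq: "1 \<le> p" "p < q" "q \<le> i" "c < i" "c < p \<or> q \<le> c" "1 \<le> p'" "p' < q'" "q' \<le> i" "c' < i" "c' < p' \<or> q' \<le> c'"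
    and g: "g \<in> arc_idems p q r" "g' \<in> arc_idems p' q' r" and eq: "wrap i (p, q, c, g) = wrap i (p', q', c', g')"
    using z unfolding e wrap_dom_def by auto
  have rr: "ran g = ran g'" using ran_wrap[OF g(1), of i c] ran_wrap[OF g(2), of i c'] pq eq by simp
  have mem: "p \<in> ran g" "q \<in> ran g" "p' \<in> ran g'" "q' \<in> ran g'" using arc_idemsD(2,3)[OF g(1)] arc_idemsD(2,3)[OF g(2)] by (auto intro: ranI)
  have bd: "p \<le> y \<and> y \<le> q" if "y \<in> ran g" for y by (rule arc_idems_ran[OF g(1) that])
  have bd': "p' \<le> y \<and> y \<le> q'" if "y \<in> ran g'" for y by (rule arc_idems_ran[OF g(2) that])
  have pp: "p = p'" "q = q'" using bd[of p'] bd[of q'] bd'[of p] bd'[of q] mem rr by (auto intro: le_antisym)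
  have "g x = g' x" for x
  proof (cases "p \<le> x \<and> x \<le> q")
    case True
    then show ?thesis using fun_cong[OF eq, of x] pp by (simp add: wrap_def)
  next
    case False
    then have "g x = None" "g' x = None"
      using arc_idemsD(8)[OF g(1), of x] arc_idemsD(8)[OF g(2), of x] pp by (metis not_None_eq)+
    then show ?thesis by simp
  qed
  then have gg: "g = g'" by (rule ext)
  have refl_num: "wrap i (p, q, c'', g) x = (if c'' < p then (if x \<le> c'' \<or> q < x then Some q else Some p) else (if q < x \<and> x \<le> c'' then Some q else Some p))"
    if "1 \<le> x" "x \<le> i" "x < p \<or> q < x" for x c'' using that by (auto simp: wrap_def)
  have E: "wrap i (p, q, c, g) x = wrap i (p, q, c', g) x" for x using eq pp gg by simp
  have "c = c'"
  proof (rule ccontr)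
    assume ne: "c \<noteq> c'"
    \<comment> \<open>Two cuts on the same side of the arc \<open>{p..q}\<close> are distinguished
      at the larger one, two cuts on different sides at the point \<open>i\<close>.\<close>
    have *: False if u: "u < v" "u < i" "v < i" "u < p \<or> q \<le> u" "v < p \<or> q \<le> v"
      "\<And>x. wrap i (p, q, u, g) x = wrap i (p, q, v, g) x" for u v
    proof -
      consider "v < p" | "u < p" "q \<le> v" | "q \<le> u" using u by linarith
      then show False
      proof cases
        case 1
        then show False using refl_num[of v u] refl_num[of v v] u(6)[of v] u pq by auto
      next
        case 2
        then show False using refl_num[of i u] refl_num[of i v] u(6)[of i] u pq by auto
      next
        case 3
        then show False using refl_num[of v u] refl_num[of v v] u(6)[of v] u pq by auto
      qed
    qed
    show False using *[of c c'] *[of c' c] ne pq pp E by (metis linorder_neqE_nat)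
  qed
  then show "z = z'" using pp gg e by simp
qed

lemma wrap_surj:
  assumes r: "r \<ge> 1" and e: "e \<in> full_idems i (Suc r)" shows "e \<in> wrap i ` wrap_dom i r"
proof -
  have eS: "e \<in> PORX False i" and ee: "e \<circ>\<^sub>m e = e" and d: "dom e = {1..i}" and cr: "card (ran e) = Suc r"
    using e by (auto simp: full_idems_def idems_def)
  note pt = PORX_pt[OF eS]
  have dd: "\<exists>y. e x = Some y" if "x \<in> {1..i}" for x using that d by blast
  have finr: "finite (ran e)" using cr by (metis card.infinite nat.distinct(1))
  have fixv: "e y = Some y" if "y \<in> ran e" for y by (rule idem_fix[OF ee that])
  have fixv': "e y = Some y" if "e x = Some y" for x y by (rule fixv, rule ranI[of e x y], rule that)
  define p where "p = Min (ran e)"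
  define q where "q = Max (ran e)"
  have ne: "ran e \<noteq> {}" using cr by auto
  have pr: "p \<in> ran e" and qr: "q \<in> ran e" unfolding p_def q_def using finr ne by auto
  have bd: "p \<le> y \<and> y \<le> q" if "e x = Some y" for x y
    unfolding p_def q_def using finr ranI[of e x y, OF that] by simp
  have ep: "e p = Some p" and eq: "e q = Some q" using fixv pr qr by auto
  have pi: "1 \<le> p" "q \<le> i" using pt_val[OF pt ep] pt_val[OF pt eq] by auto
  have "p \<noteq> q"
  proof
    assume "p = q"
    then have "ran e \<subseteq> {p}" using bd by (auto simp: ran_def intro: le_antisym)
    then have "card (ran e) \<le> 1" using card_mono[of "{p}" "ran e"] by simp
    then show False using cr r by simp
  qed
  then have pq: "p < q" using bd[OF ep] by simp
  \<comment> \<open>A third fixed point excludes reversal; if \<open>p\<close> and \<open>q\<close>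
    are the only values, the sequence is cyclic in any case.\<close>
  have "opres i e"
  proof (cases "\<exists>y\<in>ran e. y \<noteq> p \<and> y \<noteq> q")
    case True
    then obtain y where y: "y \<in> ran e" "y \<noteq> p" "y \<noteq> q" by blast
    have "e y = Some y" by (rule fixv[OF y(1)])
    moreover have "p < y" "y < q" using bd[OF calculation] y by auto
    ultimately show ?thesis using three_fixed_opres[OF pt ep _ eq] eS by (auto simp: PORX_def)
  next
    case False
    then have "ran e \<subseteq> {p, q}" by blast
    then show ?thesis using opres_of_two_values[OF pt _ pq] eS by (auto simp: PORX_def)
  qed
  then obtain m where m: "lift_of i e m" by (auto simp: opres_def)
  note sh = lift_of_sheets[OF pt m]
  \<comment> \<open>A change of sheet between two fixed points would reverse their order.\<close>
  have fixm: "m x = m y" if "e x = Some x" "e y = Some y" "x \<le> y" for x y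
  proof (rule ccontr)
    assume "m x \<noteq> m y"
    then have "m y \<noteq> m x" by simp
    from sh(4)[OF that this] that(3) have "x = y" by simp
    then show False using \<open>m x \<noteq> m y\<close> by simp
  qed
  have mpq: "m p = m q" using fixm[OF ep eq] pq by simp
  have mid: "m x = m p" if h: "p \<le> x" "x \<le> q" "x \<in> {1..i}" for x
  proof -
    obtain y where y: "e x = Some y" using dd[OF h(3)] by blast
    show ?thesis using sh(1)[OF ep y that(1)] sh(1)[OF y eq that(2)] mpq by simp
  qed
  have hi: "y = q \<and> m x = m p \<or> y = p \<and> m x = m p + 1" if "q < x" "e x = Some y" for x y
  proof -
    have qx: "q \<le> x" "p \<le> x" using that pq by auto
    have a: "m q \<le> m x" "m x \<le> m p + 1" using sh(1)[OF eq that(2) qx(1)] sh(2)[OF ep that(2) qx(2)] by auto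
    show ?thesis
    proof (cases "m x = m p")
      case True
      then show ?thesis using sh(3)[OF eq that(2) qx(1)] mpq bd[OF that(2)] by simp
    next
      case False
      then show ?thesis using sh(4)[OF ep that(2) qx(2)] a mpq bd[OF that(2)] by auto
    qed
  qed
  have lo: "y = p \<and> m x = m p \<or> y = q \<and> m x = m p - 1" if "x < p" "e x = Some y" for x y
  proof -
    have qx: "x \<le> q" "x \<le> p" using that pq by auto
    have a: "m q \<le> m x + 1" "m x \<le> m p" using sh(2)[OF that(2) eq qx(1)] sh(1)[OF that(2) ep qx(2)] by auto
    show ?thesis
    proof (cases "m x = m p")
      case True
      then show ?thesis using sh(3)[OF that(2) ep qx(2)] bd[OF that(2)] by simp
    next
      case False
      then show ?thesis using sh(4)[OF that(2) eq qx(1)] a mpq bd[OF that(2)] by auto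
    qed
  qed
  \<comment> \<open>A value \<open>q\<close> before \<open>p\<close> together with a value
    \<open>p\<close> after \<open>q\<close> would need a rise by two sheets. So the arc outside is
    cut only once.\<close>
  have excl: False if "x < p" "e x = Some q" "q < y" "e y = Some p" for x y
  proof -
    have "m x = m p - 1" "m y = m p + 1" using lo[OF that(1,2)] hi[OF that(3,4)] pq by auto
    then show False using sh(2)[OF that(2,4)] that pq by simp
  qed
  have mono_lo: "e x = Some q" if h: "x \<le> y" "y < p" "e y = Some q" "x \<in> {1..i}" for x y
  proof -
    obtain a where a: "e x = Some a" using dd[OF h(4)] by blast
    have "m y = m p - 1" using lo[OF that(2,3)] pq by auto
    then have "m x \<le> m p - 1" using sh(1)[OF a that(3,1)] by simp
    then show ?thesis using lo[of x a] a that by auto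
  qed
  have mono_hi: "e x = Some q" if h: "x \<le> y" "q < x" "e y = Some q" "x \<in> {1..i}" for x y
  proof -
    obtain a where a: "e x = Some a" using dd[OF h(4)] by blast
    have "m y = m p" using hi[of y q] that pq by auto
    then have "m x \<le> m p" using sh(1)[OF a that(3,1)] by simp
    then show ?thesis using hi[OF that(2) a] a by auto
  qed
  define g where "g = e |` {p..q}"
  have g: "g x = Some y \<longleftrightarrow> p \<le> x \<and> x \<le> q \<and> e x = Some y" for x y by (auto simp: g_def restrict_map_def)
  have gL: "g \<in> arc_idems p q r"
  proof (rule arc_idemsI)
    have "x \<in> dom g \<longleftrightarrow> x \<in> {p..q}" for x
    proof
      assume "x \<in> dom g"
      then obtain y where "g x = Some y" by blast
      then show "x \<in> {p..q}" by (simp add: g)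
    next
      assume x: "x \<in> {p..q}"
      then have "x \<in> {1..i}" using pi by auto
      then obtain y where "e x = Some y" using dd by blast
      then have "g x = Some y" using x by (simp add: g)
      then show "x \<in> dom g" by blast
    qed
    then show "dom g = {p..q}" by blast
    have "ran g = ran e"
    proof (rule equalityI; rule subsetI)
      fix y assume "y \<in> ran e"
      then have "e y = Some y" "p \<le> y" "y \<le> q" using fixv bd by blast+
      then have "g y = Some y" by (simp add: g)
      then show "y \<in> ran g" by (rule ranI)
    qed (auto simp: ran_def g)
    then show "card (ran g) = Suc r" using cr by simp
    show "a \<le> b" if "g x = Some a" "g y = Some b" "x \<le> y" for x y a b
    proof -
      have xy: "e x = Some a" "e y = Some b" using that g by auto
      have "m x = m y" using mid[of x] mid[of y] that(1,2) pt_val[OF pt xy(1)] pt_val[OF pt xy(2)] unfolding g by auto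
      then show ?thesis using sh(3)[OF xy that(3)] by simp
    qed
    show "g y = Some y" if "g x = Some y" for x y
      using that fixv'[of x y] bd[of x y] unfolding g by auto
    show "g p = Some p" "g q = Some q" using ep eq pq by (simp_all add: g)
  qed
  define A where "A = {x \<in> {1..i}. x < p \<and> e x = Some q}"
  define B where "B = {x \<in> {1..i}. q \<le> x \<and> e x = Some q}"
  \<comment> \<open>The cut is the last point with value \<open>q\<close> on the outer arc. If these
    points extend exactly to \<open>i\<close>, the position is recorded as 0.\<close>
  define c where "c = (if A \<noteq> {} then Max A else if Max B < i then Max B else 0)"
  have fA: "finite A" and fB: "finite B" by (auto simp: A_def B_def)
  have qB: "q \<in> B" using eq pi pq by (auto simp: B_def)
  have MB: "Max B \<in> B" using Max_in[OF fB] qB by blast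
  have w: "e x = wrap i (p, q, c, g) x \<and> c < i \<and> (c < p \<or> q \<le> c)" for x
  proof (cases "A \<noteq> {}")
    case True
    then have c: "c = Max A" by (simp add: c_def)
    then have cA: "c \<in> A" using Max_in[OF fA True] by simp
    then have cp: "c < p" "e c = Some q" "c \<in> {1..i}" by (auto simp: A_def)
    have "e x = wrap i (p, q, c, g) x"
    proof -
      consider "p \<le> x \<and> x \<le> q" | "x \<in> {1..i}" "x < p" | "x \<in> {1..i}" "q < x" | "x \<notin> {1..i}" by fastforce
      then show ?thesis
      proof cases
        case 1
        then show ?thesis by (simp add: wrap_def g_def)
      next
        case 2
        obtain y where y: "e x = Some y" using dd[OF 2(1)] by blast
        have "e x = Some q" if "x \<le> c" using mono_lo[OF that cp(1,2) 2(1)] .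
        moreover have "e x \<noteq> Some q" if "\<not> x \<le> c"
        proof
          assume "e x = Some q"
          then have "x \<in> A" using 2 by (simp add: A_def)
          then show False using that Max_ge[OF fA] c by simp
        qed
        ultimately show ?thesis using 2 cp y lo[OF 2(2) y] pq by (auto simp: wrap_def)
      next
        case 3
        obtain y where y: "e x = Some y" using dd[OF 3(1)] by blast
        then have "y = q" using hi[OF 3(2) y] excl[OF cp(1,2) 3(2)] by auto
        then show ?thesis using 3 cp y pq by (auto simp: wrap_def)
      next
        case 4
        then have "e x = None" using d by (metis domIff)
        then show ?thesis using 4 pi pq by (auto simp: wrap_def g_def)
      qed
    qed
    then show ?thesis using cp pq pi by auto
  next
    case A: False
    have loA: "e x = Some p" if h: "x \<in> {1..i}" "x < p" for x
    proof -
      obtain y where y: "e x = Some y" using dd[OF h(1)] by blast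
      then have "y \<noteq> q" using A that by (auto simp: A_def)
      then show ?thesis using lo[OF that(2) y] y by auto
    qed
    have hiB: "e x = (if x \<le> Max B then Some q else Some p)" if x: "x \<in> {1..i}" "q < x" for x
    proof (cases "x \<le> Max B")
      case True
      have "e (Max B) = Some q" using MB by (simp add: B_def)
      then show ?thesis using mono_hi[OF True x(2) _ x(1)] True by simp
    next
      case False
      then have "x \<notin> B" using Max_ge[OF fB] by blast
      then have "e x \<noteq> Some q" using x by (simp add: B_def)
      moreover obtain y where y: "e x = Some y" using dd[OF x(1)] by blast
      ultimately show ?thesis using hi[OF x(2) y] False by auto
    qed
    have cc: "c < i \<and> (c < p \<or> q \<le> c)" using A MB pi pq by (auto simp: c_def B_def)
    have "e x = wrap i (p, q, c, g) x"
    proof -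
      consider "p \<le> x \<and> x \<le> q" | "x \<in> {1..i}" "x < p" | "x \<in> {1..i}" "q < x" | "x \<notin> {1..i}" by fastforce
      then show ?thesis
      proof cases
        case 1
        then show ?thesis by (simp add: wrap_def g_def)
      next
        case 2
        have "c = 0 \<or> q \<le> c" using A MB by (auto simp: c_def B_def)
        then show ?thesis using 2 loA[OF 2] pq by (auto simp: wrap_def)
      next
        case 3
        show ?thesis
        proof (cases "Max B < i")
          case True
          then have "c = Max B" using A by (simp add: c_def)
          moreover have "q \<le> Max B" using MB by (simp add: B_def)
          ultimately show ?thesis using 3 hiB[OF 3] pq by (auto simp: wrap_def)
        next
          case False
          then have "c = 0" using A by (simp add: c_def)
          moreover have "x \<le> Max B" using False 3 by simp
          ultimately show ?thesis using 3 hiB[OF 3] pq pi by (auto simp: wrap_def)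
        qed
      next
        case 4
        then have "e x = None" using d by (metis domIff)
        then show ?thesis using 4 pi pq by (auto simp: wrap_def g_def)
      qed
    qed
    then show ?thesis using cc by simp
  qed
  then have "e = wrap i (p, q, c, g)" by blast
  moreover have "(p, q, c, g) \<in> wrap_dom i r" using w[of 0] gL pi pq by (auto simp: wrap_dom_def)
  ultimately show ?thesis by blast
qed

text \<open>Here \<open>j\<close> is the length of the gap from the largest fixed point around to
  the smallest. It has \<open>j\<close> cut positions, and for fixed \<open>j\<close> there are
  \<open>j\<close> choices of \<open>p\<close>, hence the square. The arc inside has positive
  length, so rank at least two is assumed.\<close>

lemma card_full_idems:
  assumes r: "r \<ge> 1" shows "card (full_idems i (Suc r)) = (\<Sum>j\<in>{1..<i}. j\<^sup>2 * arc_num (i - j) r)"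
proof -
  have "full_idems i (Suc r) = wrap i ` wrap_dom i r"
  proof
    show "wrap i ` wrap_dom i r \<subseteq> full_idems i (Suc r)" using wrap_full_idems by (auto simp: wrap_dom_def)
  qed (use wrap_surj[OF r] in blast)
  then have "card (full_idems i (Suc r)) = card (wrap_dom i r)" using card_image[OF wrap_inj] by simp
  also have "\<dots> = (\<Sum>p\<in>{1..i}. \<Sum>q\<in>{p<..i}. (i - (q - p)) * arc_num (q - p) r)"
  proof -
    have fin: "finite (arc_idems p q r)" if "q \<in> {p<..i}" for p q
      using card_arc_idems[of p q r] that by auto
    have c: "card (({0..<i} - {p..<q}) \<times> arc_idems p q r) = (i - (q - p)) * arc_num (q - p) r" if "p \<in> {1..i}" "q \<in> {p<..i}" for p q
    proof -
      have "card ({0..<i} - {p..<q}) = i - (q - p)" using that by (subst card_Diff_subset) auto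
      then show ?thesis using card_arc_idems[of p q r] that by (simp add: card_cartesian_product)
    qed
    have inner: "card (SIGMA q:{p<..i}. ({0..<i} - {p..<q}) \<times> arc_idems p q r) = (\<Sum>q\<in>{p<..i}. (i - (q - p)) * arc_num (q - p) r)"
      if "p \<in> {1..i}" for p
      using fin c[OF that] by (subst card_SigmaI) (auto intro!: sum.cong)
    have "finite (SIGMA q:{p<..i}. ({0..<i} - {p..<q}) \<times> arc_idems p q r)" for p
      using fin by (intro finite_SigmaI) auto
    then have "card (wrap_dom i r) = (\<Sum>p\<in>{1..i}. card (SIGMA q:{p<..i}. ({0..<i} - {p..<q}) \<times> arc_idems p q r))"
      unfolding wrap_dom_def by (intro card_SigmaI) auto
    also have "\<dots> = (\<Sum>p\<in>{1..i}. \<Sum>q\<in>{p<..i}. (i - (q - p)) * arc_num (q - p) r)"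
      by (rule sum.cong[OF refl inner])
    finally show ?thesis .
  qed
  also have "\<dots> = (\<Sum>(p, q)\<in>(SIGMA p:{1..i}. {p<..i}). (i - (q - p)) * arc_num (q - p) r)"
    by (rule sum.Sigma) auto
  also have "\<dots> = (\<Sum>(j, p)\<in>(SIGMA j:{1..<i}. {1..j}). j * arc_num (i - j) r)"
    by (rule sum.reindex_bij_witness[of _ "\<lambda>(j, p). (p, p + (i - j))" "\<lambda>(p, q). (i - (q - p), p)"]) auto
  also have "\<dots> = (\<Sum>j\<in>{1..<i}. j\<^sup>2 * arc_num (i - j) r)"
    by (simp add: sum.Sigma[symmetric] power2_eq_square mult.assoc)
  finally show ?thesis .
qed

section \<open>Ranks zero and one, and arbitrary domains\<close>

lemma card_full_idems_0: "card (full_idems i 0) = (if i = 0 then 1 else 0)"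
proof (cases "i = 0")
  case True
  have "full_idems 0 0 = {pid {}}"
    using pid_PORX[of "{}" 0 False] by (auto simp: full_idems_def idems_def)
  then show ?thesis using True by simp
next
  case False
  have "e \<notin> full_idems i 0" for e
  proof
    assume e: "e \<in> full_idems i 0"
    then have r: "ran e \<subseteq> {1..i}" "card (ran e) = 0" and d: "dom e = {1..i}"
      by (auto simp: full_idems_def idems_def PORX_def partial_transformation_def)
    have "finite (ran e)" using r(1) finite_subset by blast
    then have "ran e = {}" using r(2) by simp
    moreover have "1 \<in> dom e" using d False by simp
    then obtain y where "e 1 = Some y" by blast
    ultimately show False using ranI[of e 1 y] by simp
  qed
  then have "full_idems i 0 = {}" by blast
  then show ?thesis using False by simp
qed

lemma card_full_idems_1: "card (full_idems i (Suc 0)) = i"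
proof -
  let ?c = "\<lambda>p x. if x \<in> {1..i} then Some p else None"
  have "full_idems i (Suc 0) = ?c ` {1..i}"
  proof
    show "full_idems i (Suc 0) \<subseteq> ?c ` {1..i}"
    proof
      fix e assume e: "e \<in> full_idems i (Suc 0)"
      then obtain p where p: "ran e = {p}" by (auto simp: full_idems_def card_1_singleton_iff)
      have d: "dom e = {1..i}" and "ran e \<subseteq> {1..i}" using e by (auto simp: full_idems_def idems_def PORX_def partial_transformation_def)
      then have pi: "p \<in> {1..i}" using p by simp
      have "e x = ?c p x" for x
      proof (cases "x \<in> {1..i}")
        case True
        then obtain y where "e x = Some y" using d by blast
        moreover then have "y = p" using p ranI[of e x y] by simp
        ultimately show ?thesis using True by simp
      next
        case False
        then show ?thesis using d by (metis domIff)
      qed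
      then show "e \<in> ?c ` {1..i}" using pi by blast
    qed
    show "?c ` {1..i} \<subseteq> full_idems i (Suc 0)"
    proof
      fix e assume "e \<in> ?c ` {1..i}"
      then obtain p where p: "p \<in> {1..i}" "e = ?c p" by blast
      have d: "dom e = {1..i}" and r: "ran e = {p}" using p by (auto simp: dom_def ran_def split: if_splits)
      have pt: "partial_transformation i e" using d r p by (simp add: partial_transformation_def)
      have "e \<in> PORX False i" by (rule const_PORX[OF pt]) (auto simp: p split: if_splits)
      moreover have "e \<circ>\<^sub>m e = e" using p by (intro map_eqI) (auto simp: map_comp_Some_iff split: if_splits)
      ultimately show "e \<in> full_idems i (Suc 0)" using d r by (simp add: full_idems_def idems_def)
    qed
  qed
  moreover have "inj_on ?c {1..i}"
  proof (rule inj_onI)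
    fix p p' assume "p \<in> {1..i}" "?c p = ?c p'"
    then have "?c p p = ?c p' p" by metis
    then show "p = p'" using \<open>p \<in> {1..i}\<close> by simp
  qed
  ultimately show ?thesis by (simp add: card_image)
qed

text \<open>An idempotent maps into its own domain, so enumerating \<open>D\<close> increasingly
  turns it into a total idempotent of the same rank.\<close>

lemma card_idems_dom:
  assumes D: "D \<subseteq> {1..n}"
  shows "card {e \<in> idems False n. dom e = D \<and> card (ran e) = r} = card (full_idems (card D) r)"
proof -
  have "finite D" using D finite_subset by blast
  then obtain g where g: "bij_betw g {1..card D} D" "strict_mono_on {1..card D} g" using enum_iso by blast
  interpret embed n "card D" D g using D g by unfold_locales
  let ?k = "card D" and ?Gi = "minv G"
  have rGi: "ran ?Gi = {1..?k}" using gB by (force simp: ran_def Gi)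
  have domGi: "dom ?Gi = D"
  proof -
    have "D = g ` {1..?k}" using g(1) by (simp add: bij_betw_def)
    moreover have "x \<in> dom ?Gi \<longleftrightarrow> x \<in> g ` {1..?k}" for x
      unfolding domIff not_None_eq Gi by blast
    ultimately show ?thesis by blast
  qed
  have "bij_betw (\<lambda>e. ?Gi \<circ>\<^sub>m (e \<circ>\<^sub>m G)) {e \<in> idems False n. dom e = D \<and> card (ran e) = r} (full_idems ?k r)"
  proof (rule bij_betwI[where g="\<lambda>\<beta>. G \<circ>\<^sub>m (\<beta> \<circ>\<^sub>m ?Gi)"])
    have rc: "card (ran (G \<circ>\<^sub>m (\<beta> \<circ>\<^sub>m ?Gi))) = card (ran \<beta>)" if "partial_transformation ?k \<beta>" for \<beta>
    proof -
      have "ran (G \<circ>\<^sub>m (\<beta> \<circ>\<^sub>m ?Gi)) = g ` ran \<beta>"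
      proof (rule equalityI; rule subsetI)
        fix y assume "y \<in> ran (G \<circ>\<^sub>m (\<beta> \<circ>\<^sub>m ?Gi))"
        then obtain x where "(G \<circ>\<^sub>m (\<beta> \<circ>\<^sub>m ?Gi)) x = Some y" by (auto simp: ran_def)
        then obtain u v where "\<beta> u = Some v" "y = g v" unfolding map_comp_Some_iff G by blast
        then show "y \<in> g ` ran \<beta>" by (blast intro: ranI)
      next
        fix y assume "y \<in> g ` ran \<beta>"
        then obtain u v where uv: "\<beta> u = Some v" "y = g v" by (auto simp: ran_def)
        have "u \<in> {1..?k}" "v \<in> {1..?k}" using pt_val[OF that uv(1)] by auto
        then have "?Gi (g u) = Some u" "G v = Some y" using uv by (simp_all add: Gi G)
        then have "(G \<circ>\<^sub>m (\<beta> \<circ>\<^sub>m ?Gi)) (g u) = Some y" using uv by (simp add: map_comp_Some_iff)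
        then show "y \<in> ran (G \<circ>\<^sub>m (\<beta> \<circ>\<^sub>m ?Gi))" by (rule ranI)
      qed
      moreover have "ran \<beta> \<subseteq> {1..?k}" using that by (simp add: partial_transformation_def)
      then have "inj_on g (ran \<beta>)" using g(1) by (auto simp: bij_betw_def intro: inj_on_subset)
      ultimately show ?thesis by (simp add: card_image)
    qed
    have bck: "G \<circ>\<^sub>m ((?Gi \<circ>\<^sub>m (e \<circ>\<^sub>m G)) \<circ>\<^sub>m ?Gi) = e" and rD: "ran e \<subseteq> D" if "e \<in> idems False n" "dom e = D" for e
    proof -
      show rD: "ran e \<subseteq> D"
      proof
        fix y assume "y \<in> ran e"
        then have "e y = Some y" using idem_fix that by (auto simp: idems_def)
        then show "y \<in> D" using that by auto
      qed
      have "G \<circ>\<^sub>m ((?Gi \<circ>\<^sub>m (e \<circ>\<^sub>m G)) \<circ>\<^sub>m ?Gi) = (G \<circ>\<^sub>m ?Gi) \<circ>\<^sub>m (e \<circ>\<^sub>m (G \<circ>\<^sub>m ?Gi))" by (simp only: map_comp_assoc)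
      also have "\<dots> = e" unfolding GGi using pid_comp_id[OF rD] comp_pid_id[of e D] that by simp
      finally show "G \<circ>\<^sub>m ((?Gi \<circ>\<^sub>m (e \<circ>\<^sub>m G)) \<circ>\<^sub>m ?Gi) = e" .
    qed
    have forth: "?Gi \<circ>\<^sub>m ((G \<circ>\<^sub>m (\<beta> \<circ>\<^sub>m ?Gi)) \<circ>\<^sub>m G) = \<beta>" if "\<beta> \<in> PORX False ?k" for \<beta>
    proof -
      have "?Gi \<circ>\<^sub>m ((G \<circ>\<^sub>m (\<beta> \<circ>\<^sub>m ?Gi)) \<circ>\<^sub>m G) = (?Gi \<circ>\<^sub>m G) \<circ>\<^sub>m (\<beta> \<circ>\<^sub>m (?Gi \<circ>\<^sub>m G))" by (simp only: map_comp_assoc)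
      then show ?thesis unfolding GiG using PORX_id[OF that] by simp
    qed
    show "(\<lambda>e. ?Gi \<circ>\<^sub>m (e \<circ>\<^sub>m G)) \<in> {e \<in> idems False n. dom e = D \<and> card (ran e) = r} \<rightarrow> full_idems ?k r"
    proof (rule funcsetI)
      fix e assume "e \<in> {e \<in> idems False n. dom e = D \<and> card (ran e) = r}"
      then have e: "e \<in> idems False n" "dom e = D" "card (ran e) = r" by auto
      then have eS: "e \<in> PORX False n" "e \<circ>\<^sub>m e = e" by (auto simp: idems_def)
      let ?b = "?Gi \<circ>\<^sub>m (e \<circ>\<^sub>m G)"
      have bS: "?b \<in> PORX False ?k" by (rule down[OF eS(1)])
      have "?b \<circ>\<^sub>m ?b = ?Gi \<circ>\<^sub>m (e \<circ>\<^sub>m (((G \<circ>\<^sub>m ?Gi) \<circ>\<^sub>m e) \<circ>\<^sub>m G))" by (simp only: map_comp_assoc)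
      also have "\<dots> = ?Gi \<circ>\<^sub>m ((e \<circ>\<^sub>m e) \<circ>\<^sub>m G)" unfolding GGi pid_comp_id[OF rD[OF e(1,2)]] by (simp only: map_comp_assoc)
      finally have "?b \<circ>\<^sub>m ?b = ?b" using eS by simp
      moreover have "dom ?b = {1..?k}"
      proof -
        have "x \<in> dom ?b" if "x \<in> {1..?k}" for x
        proof -
          have "g x \<in> dom e" using gB[OF that] e(2) by simp
          then obtain y where y: "e (g x) = Some y" by blast
          then have "y \<in> D" using rD[OF e(1,2)] by (auto simp: ran_def)
          then obtain z where "?Gi y = Some z" using domGi by blast
          then have "?b x = Some z" using y that by (simp add: map_comp_Some_iff G)
          then show ?thesis by blast
        qed
        then have "{1..?k} \<subseteq> dom ?b" by blast
        moreover have "dom ?b \<subseteq> {1..?k}" using PORX_pt[OF bS] by (simp add: partial_transformation_def)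
        ultimately show ?thesis by (rule equalityI[rotated])
      qed
      moreover have "card (ran ?b) = r" using rc[OF PORX_pt[OF bS]] bck[OF e(1,2)] e(3) by simp
      ultimately show "?b \<in> full_idems ?k r" using bS by (simp add: full_idems_def idems_def)
    qed
    show "(\<lambda>\<beta>. G \<circ>\<^sub>m (\<beta> \<circ>\<^sub>m ?Gi)) \<in> full_idems ?k r \<rightarrow> {e \<in> idems False n. dom e = D \<and> card (ran e) = r}"
    proof (rule funcsetI)
      fix \<beta> assume "\<beta> \<in> full_idems ?k r"
      then have b: "\<beta> \<in> PORX False ?k" "\<beta> \<circ>\<^sub>m \<beta> = \<beta>" "dom \<beta> = {1..?k}" "card (ran \<beta>) = r" by (auto simp: full_idems_def idems_def)
      let ?e = "G \<circ>\<^sub>m (\<beta> \<circ>\<^sub>m ?Gi)"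
      have "?e \<circ>\<^sub>m ?e = G \<circ>\<^sub>m (\<beta> \<circ>\<^sub>m (((?Gi \<circ>\<^sub>m G) \<circ>\<^sub>m \<beta>) \<circ>\<^sub>m ?Gi))" by (simp only: map_comp_assoc)
      also have "\<dots> = G \<circ>\<^sub>m ((\<beta> \<circ>\<^sub>m \<beta>) \<circ>\<^sub>m ?Gi)" unfolding GiG PORX_id(1)[OF b(1)] by (simp only: map_comp_assoc)
      finally have "?e \<circ>\<^sub>m ?e = ?e" using b by simp
      moreover have "dom ?e = D"
      proof (rule equalityI; rule subsetI)
        fix x assume "x \<in> dom ?e"
        then obtain y where "?e x = Some y" by blast
        then obtain z where "?Gi x = Some z" unfolding map_comp_Some_iff by blast
        then show "x \<in> D" using domGi by blast
      next
        fix x assume "x \<in> D"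
        then obtain z where z: "?Gi x = Some z" using domGi by blast
        then have "z \<in> {1..?k}" by (simp add: Gi)
        then obtain w where w: "\<beta> z = Some w" using b(3) by blast
        then have "w \<in> {1..?k}" using pt_val[OF PORX_pt[OF b(1)]] by auto
        then have "?e x = Some (g w)" using z w by (simp add: map_comp_Some_iff G)
        then show "x \<in> dom ?e" by blast
      qed
      ultimately show "?e \<in> {e \<in> idems False n. dom e = D \<and> card (ran e) = r}"
        using up[OF b(1)] rc[OF PORX_pt[OF b(1)]] b(4) by (simp add: idems_def)
    qed
    show "G \<circ>\<^sub>m ((?Gi \<circ>\<^sub>m (e \<circ>\<^sub>m G)) \<circ>\<^sub>m ?Gi) = e" if "e \<in> {e \<in> idems False n. dom e = D \<and> card (ran e) = r}" for e
      using bck that by blast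
    show "?Gi \<circ>\<^sub>m ((G \<circ>\<^sub>m (\<beta> \<circ>\<^sub>m ?Gi)) \<circ>\<^sub>m G) = \<beta>" if "\<beta> \<in> full_idems ?k r" for \<beta>
      using forth that by (auto simp: full_idems_def idems_def)
  qed
  then show ?thesis by (rule bij_betw_same_card)
qed

lemma sum_Pow_card:
  fixes F :: "nat \<Rightarrow> nat"
  shows "(\<Sum>A\<in>Pow {1..n}. F (card A)) = (\<Sum>i\<le>n. (n choose i) * F i)"
proof -
  have "(\<Sum>A\<in>Pow {1..n}. F (card A)) = (\<Sum>i\<le>n. \<Sum>A\<in>{A \<in> Pow {1..n}. card A = i}. F (card A))"
    by (rule sum.group[symmetric]) (auto intro: card_mono[of "{1..n}", simplified])
  also have "\<dots> = (\<Sum>i\<le>n. (n choose i) * F i)"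
  proof (rule sum.cong[OF refl])
    fix i
    have "{A \<in> Pow {1..n}. card A = i} = {A. A \<subseteq> {1..n} \<and> card A = i}" by auto
    then have "card {A \<in> Pow {1..n}. card A = i} = n choose i" using n_subsets[of "{1..n}" i] by simp
    then show "(\<Sum>A\<in>{A \<in> Pow {1..n}. card A = i}. F (card A)) = (n choose i) * F i" by simp
  qed
  finally show ?thesis .
qed

lemma sum_idems_True: "(\<Sum>e\<in>idems True n. F (card (ran e))) = (\<Sum>i\<le>n. (n choose i) * F i :: nat)"
  unfolding idems_True sum.reindex[OF pid_inj] using sum_Pow_card[of F n] by simp

lemma sum_idems_False:
  fixes F :: "nat \<Rightarrow> nat"
  shows "(\<Sum>e\<in>idems False n. F (card (ran e))) = (\<Sum>r\<le>n. (\<Sum>i\<le>n. (n choose i) * card (full_idems i r)) * F r)"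
proof -
  have rn: "card (ran e) \<le> n" "dom e \<in> Pow {1..n}" if "e \<in> idems False n" for e
    using that card_mono[of "{1..n}" "ran e"] by (auto simp: idems_def PORX_def partial_transformation_def)
  have fin: "finite {e \<in> idems False n. P e}" for P using finite_idems by auto
  have "(\<Sum>e\<in>idems False n. F (card (ran e))) = (\<Sum>r\<le>n. \<Sum>e\<in>{e \<in> idems False n. card (ran e) = r}. F (card (ran e)))"
    by (rule sum.group[symmetric]) (use rn finite_idems in auto)
  also have "\<dots> = (\<Sum>r\<le>n. card {e \<in> idems False n. card (ran e) = r} * F r)" by simp
  also have "\<dots> = (\<Sum>r\<le>n. (\<Sum>i\<le>n. (n choose i) * card (full_idems i r)) * F r)"
  proof (rule sum.cong[OF refl])
    fix r
    have "card {e \<in> idems False n. card (ran e) = r} = (\<Sum>e\<in>{e \<in> idems False n. card (ran e) = r}. 1)" by simp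
    also have "\<dots> = (\<Sum>D\<in>Pow {1..n}. \<Sum>e\<in>{e \<in> {e \<in> idems False n. card (ran e) = r}. dom e = D}. 1)"
      by (rule sum.group[symmetric]) (use rn fin in auto)
    also have "\<dots> = (\<Sum>D\<in>Pow {1..n}. card (full_idems (card D) r))"
    proof (rule sum.cong[OF refl])
      fix D assume "D \<in> Pow {1..n}"
      then have "card {e \<in> idems False n. dom e = D \<and> card (ran e) = r} = card (full_idems (card D) r)" using card_idems_dom by blast
      moreover have "{e \<in> {e \<in> idems False n. card (ran e) = r}. dom e = D} = {e \<in> idems False n. dom e = D \<and> card (ran e) = r}" by blast
      ultimately show "(\<Sum>e\<in>{e \<in> {e \<in> idems False n. card (ran e) = r}. dom e = D}. 1) = card (full_idems (card D) r)" by simp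
    qed
    also have "\<dots> = (\<Sum>i\<le>n. (n choose i) * card (full_idems i r))" using sum_Pow_card[of "\<lambda>i. card (full_idems i r)" n] by simp
    finally show "card {e \<in> idems False n. card (ran e) = r} * F r = (\<Sum>i\<le>n. (n choose i) * card (full_idems i r)) * F r" by simp
  qed
  finally show ?thesis .
qed

section \<open>Evaluation of the sums\<close>

declare arc_num.simps(2) [simp del]

lemma arc_num_conv: "arc_num d (Suc r) = (\<Sum>m\<le>d. (d - m) * arc_num m r)"
proof -
  have "arc_num d (Suc r) = (\<Sum>m\<in>{0..<d}. (d - m) * arc_num m r)"
    unfolding arc_num.simps by (rule sum.reindex_bij_witness[of _ "\<lambda>m. d - m" "\<lambda>h. d - h"]) auto
  also have "\<dots> = (\<Sum>m\<le>d. (d - m) * arc_num m r)"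
    by (rule sum.mono_neutral_left) auto
  finally show ?thesis .
qed

lemma arc_num_step: "arc_num (Suc d) (Suc r) = arc_num d (Suc r) + (\<Sum>m\<le>d. arc_num m r)"
proof -
  have "(\<Sum>m\<le>Suc d. (Suc d - m) * arc_num m r) = (\<Sum>m\<le>d. (Suc d - m) * arc_num m r)" by simp
  also have "\<dots> = (\<Sum>m\<le>d. (d - m) * arc_num m r + arc_num m r)"
    by (rule sum.cong) (auto simp: Suc_diff_le)
  finally show ?thesis unfolding arc_num_conv by (simp add: sum.distrib)
qed

text \<open>One part has generating function \<open>x / (1 - x) ^ 2\<close>, and the binomial is the
  coefficient of \<open>x ^ d\<close> in its power with exponent \<open>Suc r\<close>. The induction
  uses the hockey-stick identity in place of power series.\<close>

lemma arc_num_choose: "arc_num d (Suc r) = (d + r) choose (2 * r + 1)"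
proof (induction r arbitrary: d)
  case 0
  show ?case
  proof (induction d)
    case (Suc d)
    have "(\<Sum>m\<le>d. arc_num m 0) = 1" by (simp add: sum.delta)
    then show ?case using arc_num_step[of d 0] Suc by simp
  qed (simp add: arc_num.simps)
next
  case (Suc r)
  note outer = Suc.IH
  have hockey: "(\<Sum>m\<le>d. (m + r) choose (2 * r + 1)) = (d + r + 1) choose (2 * r + 2)" for d
    by (induction d) (simp_all add: binomial_eq_0)
  show ?case
  proof (induction d)
    case (Suc d)
    show ?case using arc_num_step[of d "Suc r"] Suc.IH hockey[of d] by (simp add: outer)
  qed (simp add: binomial_eq_0 arc_num.simps)
qed

lemma arc_num_eq_0: "d < r \<Longrightarrow> arc_num d r = 0"
  by (cases r) (auto simp: arc_num_choose binomial_eq_0)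

text \<open>The Fibonacci numbers of even index: 0, 1, 3, 8, and so on.\<close>

definition arc_sum :: "nat \<Rightarrow> nat" where "arc_sum d = (\<Sum>r<d. arc_num d (Suc r))"

lemma arc_sum_bound: "d \<le> R \<Longrightarrow> (\<Sum>r<R. arc_num d (Suc r)) = arc_sum d"
  unfolding arc_sum_def by (rule sum.mono_neutral_right) (auto intro: arc_num_eq_0)

lemma arc_sum_rec: "arc_sum (Suc d) = arc_sum d + 1 + (\<Sum>m\<le>d. arc_sum m)"
proof -
  have "arc_sum (Suc d) = (\<Sum>r<Suc d. arc_num d (Suc r)) + (\<Sum>r<Suc d. \<Sum>m\<le>d. arc_num m r)"
    unfolding arc_sum_def arc_num_step by (simp only: sum.distrib)
  also have "(\<Sum>r<Suc d. arc_num d (Suc r)) = arc_sum d" by (rule arc_sum_bound) simp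
  also have "(\<Sum>r<Suc d. \<Sum>m\<le>d. arc_num m r) = (\<Sum>m\<le>d. arc_num m 0 + (\<Sum>r<d. arc_num m (Suc r)))"
    by (subst sum.swap) (simp only: sum.lessThan_Suc_shift)
  also have "\<dots> = (\<Sum>m\<le>d. arc_num m 0) + (\<Sum>m\<le>d. arc_sum m)"
    unfolding sum.distrib by (simp add: arc_sum_bound del: arc_num.simps)
  also have "(\<Sum>m\<le>d. arc_num m 0) = 1" by simp
  finally show ?thesis by simp
qed

text \<open>Subtracting consecutive instances of the previous recurrence removes the partial sums.
  This is where the golden ratio enters.\<close>

lemma arc_sum_rec2: "real (arc_sum (Suc (Suc d))) = 3 * real (arc_sum (Suc d)) - real (arc_sum d)"
proof -
  have "real (arc_sum (Suc (Suc d))) = real (arc_sum (Suc d)) + 1 + (\<Sum>m\<le>d. real (arc_sum m)) + real (arc_sum (Suc d))"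
    unfolding arc_sum_rec[of "Suc d"] by simp
  moreover have "real (arc_sum (Suc d)) = real (arc_sum d) + 1 + (\<Sum>m\<le>d. real (arc_sum m))"
    unfolding arc_sum_rec[of d] by simp
  ultimately show ?thesis by linarith
qed

text \<open>The Lucas numbers of even index: 2, 3, 7, and so on.\<close>

definition Luc :: "nat \<Rightarrow> real" where "Luc i = \<tau> ^ (2 * i) + \<theta> ^ (2 * i)"

lemma tau_theta: "\<tau>\<^sup>2 = \<tau> + 1" "\<theta>\<^sup>2 = \<theta> + 1" "\<tau> + \<theta> = 1"
  by (simp_all add: \<tau>_def \<theta>_def power2_eq_square field_simps)

lemma Luc_rec: "Luc (Suc (Suc i)) = 3 * Luc (Suc i) - Luc i"
proof -
  have *: "x ^ (2 * Suc (Suc i)) = 3 * x ^ (2 * Suc i) - x ^ (2 * i)" if x: "x\<^sup>2 = x + 1" for x :: real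
  proof -
    have "x ^ 4 = (x\<^sup>2)\<^sup>2" by simp
    also have "\<dots> = 3 * x\<^sup>2 - 1" using x by (simp add: power2_eq_square algebra_simps)
    finally have x4: "x ^ 4 = 3 * x\<^sup>2 - 1" .
    have "2 * Suc (Suc i) = 2 * i + 4" "2 * Suc i = 2 * i + 2" by simp_all
    then have "x ^ (2 * Suc (Suc i)) = x ^ (2 * i) * x ^ 4" "x ^ (2 * Suc i) = x ^ (2 * i) * x\<^sup>2"
      by (simp_all only: power_add)
    moreover have "p * (3 * q - 1) = 3 * (p * q) - p" for p q :: real by (simp add: algebra_simps)
    ultimately show ?thesis unfolding x4 by (simp only:)
  qed
  show ?thesis unfolding Luc_def using *[OF tau_theta(1)] *[OF tau_theta(2)] by simp
qed

lemma Luc_0: "Luc 0 = 2" and Luc_1: "Luc (Suc 0) = 3"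
  using tau_theta by (simp_all add: Luc_def)

definition sq_conv :: "nat \<Rightarrow> real" where "sq_conv i = (\<Sum>j\<in>{1..<i}. (real j)\<^sup>2 * real (arc_sum (i - j)))"

text \<open>The linear recurrence passes to the convolution; at the upper end the terms with
  \<open>i\<close> cancel and the last square remains as inhomogeneity.\<close>

lemma sq_conv_rec:
  assumes "i \<ge> 1"
  shows "sq_conv (Suc (Suc i)) = 3 * sq_conv (Suc i) - sq_conv i + (real (Suc i))\<^sup>2"
proof -
  have l1: "arc_sum 1 = 1" "arc_sum 2 = 3"
    using arc_sum_rec[of 0] arc_sum_rec[of 1] by (simp_all add: arc_sum_def numeral_2_eq_2)
  have e1: "sq_conv (Suc i) = (\<Sum>j\<in>{1..<i}. (real j)\<^sup>2 * real (arc_sum (Suc i - j))) + (real i)\<^sup>2"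
    unfolding sq_conv_def using assms l1 by simp
  have e2: "sq_conv (Suc (Suc i)) = (\<Sum>j\<in>{1..<i}. (real j)\<^sup>2 * real (arc_sum (Suc (Suc i) - j))) + 3 * (real i)\<^sup>2 + (real (Suc i))\<^sup>2"
    unfolding sq_conv_def using assms l1 by (simp add: numeral_2_eq_2)
  have "(\<Sum>j\<in>{1..<i}. (real j)\<^sup>2 * real (arc_sum (Suc (Suc i) - j)))
      = (\<Sum>j\<in>{1..<i}. 3 * ((real j)\<^sup>2 * real (arc_sum (Suc i - j))) - (real j)\<^sup>2 * real (arc_sum (i - j)))"
  proof (rule sum.cong[OF refl])
    fix j assume "j \<in> {1..<i}"
    then have "Suc (Suc i) - j = Suc (Suc (i - j))" "Suc i - j = Suc (i - j)" by auto
    then show "(real j)\<^sup>2 * real (arc_sum (Suc (Suc i) - j)) = 3 * ((real j)\<^sup>2 * real (arc_sum (Suc i - j))) - (real j)\<^sup>2 * real (arc_sum (i - j))"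
      by (simp only: arc_sum_rec2) (simp add: algebra_simps)
  qed
  also have "\<dots> = 3 * (\<Sum>j\<in>{1..<i}. (real j)\<^sup>2 * real (arc_sum (Suc i - j))) - sq_conv i"
    by (simp add: sum_subtractf sum_distrib_left sq_conv_def)
  finally show ?thesis unfolding e2 e1 by simp
qed

text \<open>Minus the square minus 2 is a particular solution of the inhomogeneous recurrence, and
  the homogeneous part is matched by the first two values.\<close>

lemma sq_conv_Luc: "i \<ge> 1 \<Longrightarrow> sq_conv i = Luc i - (real i)\<^sup>2 - 2"
proof (induction i rule: less_induct)
  case (less i)
  consider "i = 1" | "i = 2" | k where "i = Suc (Suc k)" "k \<ge> 1"
    using less.prems by (metis One_nat_def Suc_1 Suc_le_eq gr0_implies_Suc not_gr_zero)
  then show ?case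
  proof cases
    case 1
    then show ?thesis by (simp add: sq_conv_def Luc_1)
  next
    case 2
    have "arc_sum 1 = 1" using arc_sum_rec[of 0] by (simp add: arc_sum_def)
    moreover have "Luc 2 = 7" using Luc_rec[of 0] Luc_0 Luc_1 by (simp add: numeral_2_eq_2)
    moreover have "{1..<2::nat} = {1}" by auto
    ultimately show ?thesis using 2 by (simp add: sq_conv_def)
  next
    case 3
    have "sq_conv k = Luc k - (real k)\<^sup>2 - 2" "sq_conv (Suc k) = Luc (Suc k) - (real (Suc k))\<^sup>2 - 2"
      using less.IH[of k] less.IH[of "Suc k"] 3 by auto
    then show ?thesis
      unfolding 3(1) sq_conv_rec[OF 3(2)] Luc_rec by (simp add: power2_eq_square algebra_simps)
  qed
qed

lemma sum_full_idems:
  assumes "1 \<le> i" "i \<le> R"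
  shows "real (\<Sum>s\<le>R. card (full_idems i s)) = Luc i - (real i)\<^sup>2 + real i - 2"
proof -
  obtain R' where R: "R = Suc R'" using assms by (cases R) auto
  have "(\<Sum>s\<le>R. card (full_idems i s)) = card (full_idems i 0) + (card (full_idems i (Suc 0)) + (\<Sum>r<R'. card (full_idems i (Suc (Suc r)))))"
    unfolding R by (simp only: lessThan_Suc_atMost[symmetric] sum.lessThan_Suc_shift)
  \<comment> \<open>The separate \<open>i\<close> counts the constant maps, the total idempotents of
    rank one.\<close>
  also have "\<dots> = i + (\<Sum>r<R'. \<Sum>j\<in>{1..<i}. j\<^sup>2 * arc_num (i - j) (Suc r))"
    using assms by (simp add: card_full_idems_0 card_full_idems_1 card_full_idems del: arc_num.simps)
  also have "(\<Sum>r<R'. \<Sum>j\<in>{1..<i}. j\<^sup>2 * arc_num (i - j) (Suc r)) = (\<Sum>j\<in>{1..<i}. j\<^sup>2 * (\<Sum>r<R'. arc_num (i - j) (Suc r)))"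
    by (subst sum.swap) (simp only: sum_distrib_left)
  also have "\<dots> = (\<Sum>j\<in>{1..<i}. j\<^sup>2 * arc_sum (i - j))"
  proof (rule sum.cong[OF refl])
    fix j assume "j \<in> {1..<i}"
    then have "i - j \<le> R'" using assms R by auto
    then show "j\<^sup>2 * (\<Sum>r<R'. arc_num (i - j) (Suc r)) = j\<^sup>2 * arc_sum (i - j)" by (simp only: arc_sum_bound)
  qed
  finally have "real (\<Sum>s\<le>R. card (full_idems i s)) = real i + sq_conv i" by (simp add: sq_conv_def)
  then show ?thesis using sq_conv_Luc[OF assms(1)] by simp
qed

section \<open>Closed forms for the injective monoid and for reflections\<close>

definition idem_sum :: "nat \<Rightarrow> real" where
  "idem_sum k = (\<Sum>l = 1..k. real (k choose l) * (\<tau> ^ (2 * l) + \<theta> ^ (2 * l) - (real l)\<^sup>2 + real l - 2))"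

text \<open>The summand 1 is the empty map, the only idempotent with empty domain.\<close>

lemma sum_numbers:
  "real (\<Sum>r\<le>k. \<Sum>i\<le>k. (k choose i) * card (full_idems i r)) = 1 + idem_sum k"
proof -
  have "(\<Sum>r\<le>k. \<Sum>i\<le>k. (k choose i) * card (full_idems i r)) = (\<Sum>i\<le>k. (k choose i) * (\<Sum>r\<le>k. card (full_idems i r)))"
    by (subst sum.swap) (simp only: sum_distrib_left)
  then have "real (\<Sum>r\<le>k. \<Sum>i\<le>k. (k choose i) * card (full_idems i r)) = (\<Sum>i\<le>k. real (k choose i) * real (\<Sum>r\<le>k. card (full_idems i r)))"
    by (simp only: of_nat_sum of_nat_mult)
  also have "\<dots> = real (k choose 0) * real (\<Sum>r\<le>k. card (full_idems 0 r)) + (\<Sum>i = 1..k. real (k choose i) * real (\<Sum>r\<le>k. card (full_idems i r)))"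
    by (simp add: atMost_atLeast0 sum.atLeast_Suc_atMost)
  also have "(\<Sum>i = 1..k. real (k choose i) * real (\<Sum>r\<le>k. card (full_idems i r))) = idem_sum k"
    unfolding idem_sum_def by (rule sum.cong[OF refl]) (simp only: sum_full_idems atLeastAtMost_iff Luc_def)
  also have "(\<Sum>r\<le>k. card (full_idems 0 r)) = 1"
  proof -
    have "card (full_idems 0 r) = (if r = 0 then 1 else 0)" for r
    proof (cases r)
      case (Suc r')
      then show ?thesis using card_full_idems_1[of 0] card_full_idems[of r' 0] by (cases r') auto
    qed (simp add: card_full_idems_0)
    then show ?thesis by (simp add: sum.delta)
  qed
  finally show ?thesis by simp
qed

lemma card_idems_False: "real (card (idems False k)) = 1 + idem_sum k"
proof -
  have "card (idems False k) = (\<Sum>r\<le>k. \<Sum>i\<le>k. (k choose i) * card (full_idems i r))"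
    using sum_idems_False[of "\<lambda>_. 1" k] by simp
  then show ?thesis using sum_numbers by simp
qed

lemma card_idems_True: "card (idems True k) = 2 ^ k"
  unfolding idems_True card_image[OF pid_inj] by (simp add: card_Pow)

lemma card_typeC_rank:
  assumes n: "3 \<le> n"
  shows "card (typeC b n) = (\<Sum>e\<in>idems b n. (\<lambda>k. card (rep_triples b k n (pid {1..k}))) (card (ran e)))"
  unfolding card_typeC[OF n] by (rule sum.cong[OF refl]) (simp add: card_rep_triples_local del: One_nat_def)

definition index2_num :: "nat \<Rightarrow> real" where "index2_num n = (-1) ^ n + 2"

lemma index2_num_alt: "index2_num n = (if even n then 3 else 1)"
  by (simp add: index2_num_def)

text \<open>For \<open>k\<close> at least 3 the bracket is \<open>5 * k / 2 + 1\<close> for even and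
  \<open>2 * k\<close> for odd \<open>k\<close>, merged by means of \<open>(-1) ^ k\<close>. The
  subtracted 1, 2 and 5 correct this expression at ranks 0, 1 and 2, so that the binomial theorem
  applies to the full range of summation.\<close>

lemma rep_triples_True:
  assumes n: "3 \<le> n"
  shows "real (card (rep_triples True k n (pid {1..k}))) = 2 ^ k
     + (if 3 \<le> k then real k * (real (\<epsilon> n k) + 2 * real (\<delta> n k)) else 0)
     + index2_num n * (1 / 2 + 9 / 4 * real k + (-1) ^ k * (1 / 2 + real k / 4)
         - (if k = 0 then 1 else if k = 1 then 2 else if k = 2 then 5 else 0))"
proof -
  have N: "n \<ge> 1" using n by simp
  consider "k = 0" | "k = 1" | "k = 2" | "3 \<le> k" by linarith
  then show ?thesis
  proof cases
    case 1
    then show ?thesis using card_rep_triples_small[OF N, of 0 True] by (simp add: card_idems_True)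
  next
    case 2
    then show ?thesis using card_rep_triples_small[OF N, of 1 True] by (simp add: card_idems_True)
  next
    case 3
    then show ?thesis using card_rep_triples_2[OF N, of True] by (simp add: card_idems_True index2_num_alt)
  next
    case 4
    have k1: "k \<ge> 1" using 4 by simp
    have w: "real ((\<Sum>t<k. refl_num True k (int t)) + (if even k then 1 else 0)) = 1 / 2 + 9 / 4 * real k + (-1) ^ k * (1 / 2 + real k / 4)"
      unfolding sum_refl_num[OF k1] refl_num_True_0[OF k1] by (auto elim!: evenE)
    have "real (card (rep_triples True k n (pid {1..k}))) = 2 ^ k + real k * real (\<epsilon> n k)
        + index2_num n * real ((\<Sum>t<k. refl_num True k (int t)) + (if even k then 1 else 0)) + 2 * real k * real (\<delta> n k)"
      unfolding card_rep_triples_dihedral[OF 4 N] card_idems_True index2_num_alt by simp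
    then show ?thesis unfolding w using 4 by (simp add: algebra_simps)
  qed
qed

lemma real_sum_choose:
  "(\<Sum>i\<le>n. real (n choose i)) = 2 ^ n" "(\<Sum>i\<le>n. real (n choose i) * 2 ^ i) = 3 ^ n"
  "n \<ge> 1 \<Longrightarrow> (\<Sum>i\<le>n. real (n choose i) * real i) = real n * 2 ^ (n - 1)"
  "n \<ge> 1 \<Longrightarrow> (\<Sum>i\<le>n. real (n choose i) * (-1) ^ i) = 0"
  "n \<ge> 2 \<Longrightarrow> (\<Sum>i\<le>n. real (n choose i) * ((-1) ^ i * real i)) = 0"
proof -
  show "(\<Sum>i\<le>n. real (n choose i)) = 2 ^ n"
    using binomial_ring[of "1::real" 1 n] by simp
  show "(\<Sum>i\<le>n. real (n choose i) * 2 ^ i) = 3 ^ n"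
    using binomial_ring[of "2::real" 1 n] by simp
  show "(\<Sum>i\<le>n. real (n choose i) * real i) = real n * 2 ^ (n - 1)"
  proof -
    have "real (\<Sum>i\<le>n. i * (n choose i)) = real (n * 2 ^ (n - 1))" unfolding choose_linear_sum ..
    then show ?thesis by (simp add: mult.commute)
  qed
  show "n \<ge> 1 \<Longrightarrow> (\<Sum>i\<le>n. real (n choose i) * (-1) ^ i) = 0"
    using choose_alternating_sum[of n, where 'a=real] by (simp add: mult.commute)
  show "n \<ge> 2 \<Longrightarrow> (\<Sum>i\<le>n. real (n choose i) * ((-1) ^ i * real i)) = 0"
    using choose_alternating_linear_sum[of n, where 'a=real] by (simp add: mult_ac)
qed

lemma sum_from_3:
  assumes "3 \<le> (n::nat)"
  shows "(\<Sum>k\<le>n. f k) = f 0 + f 1 + f 2 + (\<Sum>k = 3..n. f k :: real)"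
proof -
  have "{..n} = {0, 1, 2} \<union> {3..n}" using assms by auto
  then have "(\<Sum>k\<le>n. f k) = (\<Sum>k\<in>{0, 1, 2}. f k) + (\<Sum>k = 3..n. f k)"
    by (simp only:) (rule sum.union_disjoint, auto)
  then show ?thesis by simp
qed

lemma choose_two_real: "real (n choose 2) = real n * (real n - 1) / 2"
proof (cases n)
  case (Suc m)
  have "even (n * (n - 1))" using Suc by simp
  then have "2 * (n choose 2) = n * (n - 1)" unfolding choose_two by (rule dvd_mult_div_cancel)
  then have "2 * real (n choose 2) = real n * real (n - 1)" by (metis of_nat_mult of_nat_numeral)
  then show ?thesis using Suc by simp
qed simp

lemma card_typeC_True:
  assumes n: "3 \<le> n"
  shows "real (card (typeC True n)) = 3 ^ n
     + (\<Sum>k = 3..n. real (n choose k) * real k * (real (\<epsilon> n k) + 2 * real (\<delta> n k)))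
     + index2_num n * ((9 * real n + 4) * 2 ^ (n - 3) - 1 - 2 * real n - 5 / 2 * real n * (real n - 1))"
proof -
  let ?g = "\<lambda>k. real k * (real (\<epsilon> n k) + 2 * real (\<delta> n k))"
  let ?c = "\<lambda>k::nat. if k = 0 then 1 else if k = 1 then 2 else if k = 2 then 5 else (0::real)"
  have "card (typeC True n) = (\<Sum>k\<le>n. (n choose k) * card (rep_triples True k n (pid {1..k})))"
    unfolding card_typeC_rank[OF n] by (rule sum_idems_True[where F="\<lambda>k. card (rep_triples True k n (pid {1..k}))"])
  then have "real (card (typeC True n)) = (\<Sum>k\<le>n. real (n choose k) * real (card (rep_triples True k n (pid {1..k}))))"
    by (simp only: of_nat_sum of_nat_mult)
  also have "\<dots> = (\<Sum>k\<le>n. real (n choose k) * 2 ^ k + real (n choose k) * (if 3 \<le> k then ?g k else 0)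
      + index2_num n * (1 / 2 * real (n choose k) + 9 / 4 * (real (n choose k) * real k)
        + 1 / 2 * (real (n choose k) * (-1) ^ k) + 1 / 4 * (real (n choose k) * ((-1) ^ k * real k)) - real (n choose k) * ?c k))"
    unfolding rep_triples_True[OF n] by (rule sum.cong[OF refl]) (simp only: algebra_simps, simp)
  also have "\<dots> = (\<Sum>k\<le>n. real (n choose k) * 2 ^ k) + (\<Sum>k\<le>n. real (n choose k) * (if 3 \<le> k then ?g k else 0))
      + index2_num n * (1 / 2 * (\<Sum>k\<le>n. real (n choose k)) + 9 / 4 * (\<Sum>k\<le>n. real (n choose k) * real k)
        + 1 / 2 * (\<Sum>k\<le>n. real (n choose k) * (-1) ^ k) + 1 / 4 * (\<Sum>k\<le>n. real (n choose k) * ((-1) ^ k * real k))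
        - (\<Sum>k\<le>n. real (n choose k) * ?c k))"
    by (simp only: sum.distrib sum_subtractf sum_distrib_left[symmetric])
  also have "(\<Sum>k\<le>n. real (n choose k) * (if 3 \<le> k then ?g k else 0)) = (\<Sum>k = 3..n. real (n choose k) * ?g k)"
    unfolding sum_from_3[OF n] by simp
  also have "(\<Sum>k\<le>n. real (n choose k) * ?c k) = 1 + 2 * real n + 5 / 2 * real n * (real n - 1)"
    unfolding sum_from_3[OF n] by (simp add: choose_two_real)
  also have "(\<Sum>k\<le>n. real (n choose k) * 2 ^ k) = 3 ^ n" by (rule real_sum_choose)
  also have "(\<Sum>k\<le>n. real (n choose k)) = 2 ^ n" by (rule real_sum_choose)
  also have "(\<Sum>k\<le>n. real (n choose k) * real k) = real n * 2 ^ (n - 1)" by (rule real_sum_choose) (use n in simp)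
  also have "(\<Sum>k\<le>n. real (n choose k) * (-1) ^ k) = 0" by (rule real_sum_choose) (use n in simp)
  also have "(\<Sum>k\<le>n. real (n choose k) * ((-1) ^ k * real k)) = 0" by (rule real_sum_choose) (use n in simp)
  finally have main: "real (card (typeC True n)) = 3 ^ n + (\<Sum>k = 3..n. real (n choose k) * ?g k)
      + index2_num n * (1 / 2 * 2 ^ n + 9 / 4 * (real n * 2 ^ (n - 1)) + 1 / 2 * 0 + 1 / 4 * 0
        - (1 + 2 * real n + 5 / 2 * real n * (real n - 1)))" .
  \<comment> \<open>Shifting by 3 expresses all powers of 2 through one and removes truncated
    subtraction.\<close>
  define m where "m = n - 3"
  have m: "n = Suc (Suc (Suc m))" using n by (simp add: m_def)
  have pows: "(2::real) ^ n = 8 * 2 ^ m" "(2::real) ^ (n - 1) = 4 * 2 ^ m" unfolding m by simp_all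
  show ?thesis unfolding main pows m_def[symmetric] by (simp add: algebra_simps)
qed

text \<open>The number of invariant idempotents summed over all \<open>k\<close> reflections, plus 1
  for even \<open>k\<close>; the parity is expressed by \<open>((-1) ^ k + 1) / 2\<close>.\<close>

definition refl_sum :: "nat \<Rightarrow> real" where
  "refl_sum k = real k + real k * 2 ^ (k div 2) + ((-1) ^ k + 1) / 2 * (1 + ((real k)\<^sup>2 + 2 * real k) / 16 * 2 ^ (k div 2))"

lemma rep_triples_False:
  assumes n: "3 \<le> n" and k: "3 \<le> k"
  shows "real (card (rep_triples False k n (pid {1..k}))) = 1 + idem_sum k + real k * (real (\<epsilon> n k) + 2 * real (\<delta> n k)) + index2_num n * refl_sum k"
proof -
  have N: "n \<ge> 1" and k1: "k \<ge> 1" using n k by simp_all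
  have w: "real ((\<Sum>t<k. refl_num False k (int t)) + (if even k then 1 else 0)) = refl_sum k"
  proof (cases "even k")
    case True
    \<comment> \<open>With this form \<open>k div 2 - 1\<close>, the length available to the
      separated pairs, is \<open>h\<close>.\<close>
    then obtain h where h: "k = 2 * Suc h" using k by (metis evenE gr0_implies_Suc mult_0_right not_gr_zero not_numeral_le_zero)
    have "2 * real (card (sep_pairs h)) = (real h + 2) * 2 ^ h"
    proof -
      have "real (2 * card (sep_pairs h)) = real ((h + 2) * 2 ^ h)" using card_sep_pairs by metis
      then show ?thesis by (simp add: algebra_simps)
    qed
    then have s: "real (card (sep_pairs h)) = (real h + 2) * 2 ^ h / 2" by simp
    have "real ((\<Sum>t<k. refl_num False k (int t)) + (if even k then 1 else 0))
        = real (Suc h) * (1 + 2 * 2 ^ Suc h + real (card (sep_pairs h)) + 1) + 1"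
      unfolding sum_refl_num[OF k1] refl_num_False_0[OF k1] using h by (simp add: algebra_simps)
    also have "\<dots> = refl_sum k" unfolding s refl_sum_def h by (simp add: power2_eq_square field_simps)
    finally show ?thesis .
  next
    case False
    then show ?thesis unfolding sum_refl_num[OF k1] refl_num_False_0[OF k1] refl_sum_def by (simp add: algebra_simps)
  qed
  have "real (card (rep_triples False k n (pid {1..k}))) = real (card (idems False k)) + real k * real (\<epsilon> n k)
        + index2_num n * real ((\<Sum>t<k. refl_num False k (int t)) + (if even k then 1 else 0)) + 2 * real k * real (\<delta> n k)"
    unfolding card_rep_triples_dihedral[OF k N] index2_num_alt by simp
  then show ?thesis unfolding w card_idems_False by (simp add: algebra_simps)
qed

section \<open>Idempotents of fixed rank and the final count\<close>

definition idem_num :: "nat \<Rightarrow> nat \<Rightarrow> real" where "idem_num n r = real (\<Sum>i\<le>n. (n choose i) * card (full_idems i r))"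

lemma idem_num_1: "n \<ge> 1 \<Longrightarrow> idem_num n 1 = real n * 2 ^ (n - 1)"
  using real_sum_choose(3)[of n] by (simp add: idem_num_def card_full_idems_1)

lemma sum_j2: "(\<Sum>j\<in>{1..<i}. (real j)\<^sup>2 * (real i - real j)) = (real i)\<^sup>2 * ((real i)\<^sup>2 - 1) / 12"
proof -
  have 2: "(\<Sum>j\<in>{1..<i}. (real j)\<^sup>2) = (real i - 1) * real i * (2 * real i - 1) / 6"
  proof (induction i)
    case (Suc i)
    then show ?case by (cases "i = 0") (simp_all add: power2_eq_square field_simps)
  qed simp
  have 3: "(\<Sum>j\<in>{1..<i}. (real j)\<^sup>2 * real j) = (real i - 1)\<^sup>2 * (real i)\<^sup>2 / 4"
  proof (induction i)
    case (Suc i)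
    then show ?case by (cases "i = 0") (simp_all add: power2_eq_square field_simps)
  qed simp
  have "(\<Sum>j\<in>{1..<i}. (real j)\<^sup>2 * (real i - real j)) = real i * (\<Sum>j\<in>{1..<i}. (real j)\<^sup>2) - (\<Sum>j\<in>{1..<i}. (real j)\<^sup>2 * real j)"
    by (simp add: sum_distrib_left sum_subtractf algebra_simps)
  then show ?thesis unfolding 2 3 by (simp add: power2_eq_square field_simps)
qed

lemma idem_num_2: assumes "2 \<le> n" shows "idem_num n 2 = 1 / 12 * (\<Sum>i = 2..n. real (n choose i) * (real i)\<^sup>2 * ((real i)\<^sup>2 - 1))"
proof -
  have c: "real (card (full_idems i 2)) = (real i)\<^sup>2 * ((real i)\<^sup>2 - 1) / 12" for i
  proof -
    have "arc_num d 1 = d" for d using arc_num_choose[of d 0] by simp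
    then have "card (full_idems i 2) = (\<Sum>j\<in>{1..<i}. j\<^sup>2 * (i - j))"
      using card_full_idems[of 1 i] by (simp only: Suc_1)
    then have "real (card (full_idems i 2)) = (\<Sum>j\<in>{1..<i}. (real j)\<^sup>2 * real (i - j))" by simp
    also have "\<dots> = (\<Sum>j\<in>{1..<i}. (real j)\<^sup>2 * (real i - real j))"
      by (rule sum.cong[OF refl]) (simp add: of_nat_diff)
    finally show ?thesis using sum_j2 by simp
  qed
  have "idem_num n 2 = (\<Sum>i\<le>n. real (n choose i) * ((real i)\<^sup>2 * ((real i)\<^sup>2 - 1) / 12))"
    unfolding idem_num_def by (simp add: c)
  also have "\<dots> = (\<Sum>i = 2..n. real (n choose i) * ((real i)\<^sup>2 * ((real i)\<^sup>2 - 1) / 12))"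
  proof (rule sum.mono_neutral_right)
    show "\<forall>i\<in>{..n} - {2..n}. real (n choose i) * ((real i)\<^sup>2 * ((real i)\<^sup>2 - 1) / 12) = 0"
    proof
      fix i assume "i \<in> {..n} - {2..n}"
      then have "i = 0 \<or> i = 1" by auto
      then show "real (n choose i) * ((real i)\<^sup>2 * ((real i)\<^sup>2 - 1) / 12) = 0" by auto
    qed
  qed auto
  finally show ?thesis by (simp add: sum_distrib_left mult_ac)
qed

lemma idem_num_ge_3:
  assumes r: "3 \<le> r"
  shows "idem_num n r = (\<Sum>i = r..n. real (n choose i) * (\<Sum>j = 1..i - r + 1. (real j)\<^sup>2 * real ((i - j + r - 2) choose (2 * r - 3))))"
proof -
  define r' where "r' = r - 2"
  have r': "r = Suc (Suc r')" using r by (simp add: r'_def)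
  have z: "arc_num (i - j) (Suc r') = 0" if "i - j < Suc r'" for i j using arc_num_eq_0 that by simp
  have c: "card (full_idems i r) = (\<Sum>j\<in>{1..<i}. j\<^sup>2 * arc_num (i - j) (Suc r'))" for i
    unfolding r' using card_full_idems[of "Suc r'" i] by simp
  have c0: "card (full_idems i r) = 0" if "i < r" for i
    unfolding c using that z r' by (intro sum.neutral ballI) (auto simp del: arc_num.simps)
  have c1: "real (card (full_idems i r)) = (\<Sum>j = 1..i - r + 1. (real j)\<^sup>2 * real ((i - j + r - 2) choose (2 * r - 3)))" if "r \<le> i" for i
  proof -
    \<comment> \<open>The \<open>r - 1\<close> gaps inside the arc need total length at least
      \<open>r - 1\<close>, so the outer gap \<open>j\<close> is at most
      \<open>i - r + 1\<close>.\<close>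
    have "card (full_idems i r) = (\<Sum>j = 1..i - r + 1. j\<^sup>2 * arc_num (i - j) (Suc r'))"
      unfolding c using that z r r' by (intro sum.mono_neutral_right) (auto simp del: arc_num.simps)
    also have "\<dots> = (\<Sum>j = 1..i - r + 1. j\<^sup>2 * ((i - j + r - 2) choose (2 * r - 3)))"
      unfolding arc_num_choose r' by simp
    finally show ?thesis by simp
  qed
  have "idem_num n r = (\<Sum>i\<le>n. real (n choose i) * real (card (full_idems i r)))" by (simp add: idem_num_def)
  also have "\<dots> = (\<Sum>i = r..n. real (n choose i) * real (card (full_idems i r)))"
    by (rule sum.mono_neutral_right) (auto simp: c0)
  also have "\<dots> = (\<Sum>i = r..n. real (n choose i) * (\<Sum>j = 1..i - r + 1. (real j)\<^sup>2 * real ((i - j + r - 2) choose (2 * r - 3))))"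
    by (rule sum.cong[OF refl]) (simp only: c1 atLeastAtMost_iff)
  finally show ?thesis .
qed

lemma idem_sum_small: "idem_sum 0 = 0" "idem_sum 1 = 1" "idem_sum 2 = 5"
proof -
  show "idem_sum 0 = 0" by (simp add: idem_sum_def)
  show "idem_sum 1 = 1" using Luc_1 by (simp add: idem_sum_def Luc_def)
  have "{1..2::nat} = {1, 2}" by auto
  moreover have "Luc 2 = 7" using Luc_rec[of 0] Luc_0 Luc_1 by (simp add: numeral_2_eq_2)
  ultimately show "idem_sum 2 = 5" using Luc_1 by (simp add: idem_sum_def Luc_def)
qed

lemma card_typeC_False:
  assumes n: "3 \<le> n"
  shows "real (card (typeC False n)) = 1 + idem_sum n + real n * 2 ^ (n - 1)
      + (index2_num n + 5) / 12 * (\<Sum>i = 2..n. real (n choose i) * (real i)\<^sup>2 * ((real i)\<^sup>2 - 1))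
      + (\<Sum>k = 3..n. idem_num n k * (real k * (real (\<epsilon> n k) + 2 * real (\<delta> n k)) + idem_sum k + index2_num n * refl_sum k))"
proof -
  have N: "n \<ge> 1" using n by simp
  define T where "T k = real (card (rep_triples False k n (pid {1..k})))" for k
  have T0: "T 0 = 1" using card_rep_triples_small[OF N, of 0 False] card_idems_False[of 0] idem_sum_small by (simp add: T_def)
  have T1: "T 1 = 2" using card_rep_triples_small[OF N, of 1 False] card_idems_False[of 1] idem_sum_small by (simp add: T_def)
  have T2: "T 2 = 6 + index2_num n" using card_rep_triples_2[OF N, of False] card_idems_False[of 2] idem_sum_small by (simp add: T_def index2_num_alt)
  have "card (typeC False n) = (\<Sum>r\<le>n. (\<Sum>i\<le>n. (n choose i) * card (full_idems i r)) * card (rep_triples False r n (pid {1..r})))"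
    unfolding card_typeC_rank[OF n] by (rule sum_idems_False[where F="\<lambda>k. card (rep_triples False k n (pid {1..k}))"])
  then have "real (card (typeC False n)) = (\<Sum>r\<le>n. idem_num n r * T r)"
    unfolding idem_num_def T_def by (simp only: of_nat_sum of_nat_mult)
  \<comment> \<open>The 1 split off at every rank accounts for the trivial homomorphism with
    \<open>f\<close> empty, one for each idempotent \<open>e\<close>; it produces the leading sum
    over all idempotents. What remains is 0, 1 and \<open>5 + index2_num n\<close> at the ranks
    below 3.\<close>
  also have "\<dots> = (\<Sum>r\<le>n. idem_num n r) + (\<Sum>r\<le>n. idem_num n r * (T r - 1))"
    by (simp add: sum.distrib[symmetric] algebra_simps)
  also have "(\<Sum>r\<le>n. idem_num n r) = 1 + idem_sum n" using sum_numbers[of n] by (simp add: idem_num_def)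
  also have "(\<Sum>r\<le>n. idem_num n r * (T r - 1)) = idem_num n 1 + idem_num n 2 * (5 + index2_num n) + (\<Sum>k = 3..n. idem_num n k * (T k - 1))"
    unfolding sum_from_3[OF n] T0 T1 T2 by simp
  also have "(\<Sum>k = 3..n. idem_num n k * (T k - 1)) = (\<Sum>k = 3..n. idem_num n k * (real k * (real (\<epsilon> n k) + 2 * real (\<delta> n k)) + idem_sum k + index2_num n * refl_sum k))"
    by (rule sum.cong[OF refl]) (simp add: T_def rep_triples_False[OF n] del: One_nat_def)
  finally show ?thesis using idem_num_1[OF N] idem_num_2[of n] n by simp
qed

theorem theorem3p7:
  fixes n :: nat
  assumes "n \<ge> 3"
  shows
    "finite (semigroup_End (PORI n)) \<and>
     real (card (semigroup_End (PORI n))) =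
       real n * real (totient n) + 3 ^ n
       + (\<Sum>k = 3..n. real (n choose k) * real k * (real (\<epsilon> n k) + 2 * real (\<delta> n k)))
       + ((-1) ^ n + 2) *
           ((9 * real n + 4) * 2 ^ (n - 3) - 5 / 2 * real n * (real n - 1) - 1)
       - 2 * ((-1) ^ n + 1) * real n
     \<and>
     finite (semigroup_End (POR n)) \<and>
     real (card (semigroup_End (POR n))) =
       1 + 2 * real n + real n * real (totient n) + real n * 2 ^ (n - 1)
       + (\<Sum>k = 1..n. real (n choose k) *
            (\<tau> ^ (2 * k) + \<theta> ^ (2 * k) - (real k)\<^sup>2 + real k - 2))
       + ((-1) ^ n + 7) / 12 *
           (\<Sum>i = 2..n. real (n choose i) * (real i)\<^sup>2 * ((real i)\<^sup>2 - 1))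
       + (\<Sum>k = 3..n. \<Sum>i = k..n. real (n choose i) *
            (\<Sum>j = 1..i - k + 1. (real j)\<^sup>2 * real ((i - j + k - 2) choose (2 * k - 3)) *
              (real k * (real (\<epsilon> n k) + 2 * real (\<delta> n k))
               + (\<Sum>l = 1..k. real (k choose l) *
                    (\<tau> ^ (2 * l) + \<theta> ^ (2 * l) - (real l)\<^sup>2 + real l - 2))
               + ((-1) ^ n + 2) *
                   (real k + real k * 2 ^ (k div 2)
                    + ((-1) ^ k + 1) / 2 *
                        (1 + ((real k)\<^sup>2 + 2 * real k) / 16 * 2 ^ (k div 2))))))"
proof (intro conjI)
  note n = assms
  show "finite (semigroup_End (PORI n))" "finite (semigroup_End (POR n))"
    unfolding semigroup_End_eq by (rule finite_Endo)+
  show "real (card (semigroup_End (PORI n))) =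
       real n * real (totient n) + 3 ^ n
       + (\<Sum>k = 3..n. real (n choose k) * real k * (real (\<epsilon> n k) + 2 * real (\<delta> n k)))
       + ((-1) ^ n + 2) *
           ((9 * real n + 4) * 2 ^ (n - 3) - 5 / 2 * real n * (real n - 1) - 1)
       - 2 * ((-1) ^ n + 1) * real n"
    \<comment> \<open>The \<open>2 * n\<close> conjugations at rank 1 combine with the term
      \<open>- 2 * n\<close> inside the bracket multiplied by \<open>(-1) ^ n + 2\<close>; this
      yields the last summand.\<close>
    unfolding semigroup_End_eq card_Endo[OF n] of_nat_add card_typeC_True[OF n] index2_num_def
    by (simp add: algebra_simps)
  \<comment> \<open>The last factor depends on \<open>k\<close> only; it is moved inside the two
    inner sums to match the stated form.\<close>
  have idem_num: "idem_num n k * (real k * (real (\<epsilon> n k) + 2 * real (\<delta> n k)) + idem_sum k + index2_num n * refl_sum k)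
      = (\<Sum>i = k..n. real (n choose i) * (\<Sum>j = 1..i - k + 1. (real j)\<^sup>2 * real ((i - j + k - 2) choose (2 * k - 3)) *
          (real k * (real (\<epsilon> n k) + 2 * real (\<delta> n k)) + idem_sum k + index2_num n * refl_sum k)))" if "k \<in> {3..n}" for k
  proof -
    have "3 \<le> k" using that by simp
    then show ?thesis unfolding idem_num_ge_3[OF \<open>3 \<le> k\<close>] by (simp only: sum_distrib_right sum_distrib_left mult.assoc)
  qed
  define Z where "Z = (\<Sum>k = 3..n. idem_num n k * (real k * (real (\<epsilon> n k) + 2 * real (\<delta> n k)) + idem_sum k + index2_num n * refl_sum k))"
  have Z: "Z = (\<Sum>k = 3..n. \<Sum>i = k..n. real (n choose i) * (\<Sum>j = 1..i - k + 1. (real j)\<^sup>2 * real ((i - j + k - 2) choose (2 * k - 3)) *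
          (real k * (real (\<epsilon> n k) + 2 * real (\<delta> n k)) + idem_sum k + index2_num n * refl_sum k)))"
    unfolding Z_def by (rule sum.cong[OF refl idem_num])
  show "real (card (semigroup_End (POR n))) =
       1 + 2 * real n + real n * real (totient n) + real n * 2 ^ (n - 1)
       + (\<Sum>k = 1..n. real (n choose k) *
            (\<tau> ^ (2 * k) + \<theta> ^ (2 * k) - (real k)\<^sup>2 + real k - 2))
       + ((-1) ^ n + 7) / 12 *
           (\<Sum>i = 2..n. real (n choose i) * (real i)\<^sup>2 * ((real i)\<^sup>2 - 1))
       + (\<Sum>k = 3..n. \<Sum>i = k..n. real (n choose i) *
            (\<Sum>j = 1..i - k + 1. (real j)\<^sup>2 * real ((i - j + k - 2) choose (2 * k - 3)) *
              (real k * (real (\<epsilon> n k) + 2 * real (\<delta> n k))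
               + (\<Sum>l = 1..k. real (k choose l) *
                    (\<tau> ^ (2 * l) + \<theta> ^ (2 * l) - (real l)\<^sup>2 + real l - 2))
               + ((-1) ^ n + 2) *
                   (real k + real k * 2 ^ (k div 2)
                    + ((-1) ^ k + 1) / 2 *
                        (1 + ((real k)\<^sup>2 + 2 * real k) / 16 * 2 ^ (k div 2))))))"
    unfolding semigroup_End_eq card_Endo[OF n] of_nat_add card_typeC_False[OF n]
      idem_sum_def[symmetric] index2_num_def[symmetric] refl_sum_def[symmetric] Z_def[symmetric] Z[symmetric]
    by (simp add: index2_num_def)
qed

end
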